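(* Let $\lambda\in P\setminus\{0\}$, $p\ne q$ in $\{1,\dots,n\}$, and assume $t_p-t_q\pm\lambda\notin\Lambda$. Put $\lambda'=\lambda-t_p+t_q$ and $c'=(c'_0,\dots,c'_n)$ with $c'_p=c_p+1$, $c'_q=c_q-1$, $c'_l=c_l$ otherwise; let $I'_c$ denote the intersection form $I_c$ built with parameters $(c',\lambda')$ in place of $(c,\lambda)$. Define the following elements of $\Omega^1_{-\lambda'}( *D)(E)$ (writing $\psi'^\vee_j=\mathfrak{s}(u-t_j;-\lambda')du$): $$\eta'^\vee_q=\psi'^\vee_q,\quad \eta'^\vee_k=\psi'^\vee_k-\frac{\mathfrak{s}(t_p-t_k;-\lambda')}{\mathfrak{s}(t_p-t_q;-\lambda')}\psi'^\vee_q\ (k\ne p,q),$$ $$\eta'^\vee_p=\psi'^\vee_p+\frac{1}{\mathfrak{s}(t_p-t_q;-\lambda')}\Big(\frac{1}{c_p+1}\Big(2\pi\sqrt{-1}c_0+\sum_{l\ne p}c'_l\rho(t_p-t_l)\Big)-\rho(\lambda')\Big)\psi'^\vee_q.$$ For $\varphi\in\Omega^1_{\lambda'}( *D)(E)$ write $J_k=I'_c([\varphi],[\eta'^\vee_k])/(2\pi\sqrt{-1})$. Then, with $\psi_j=\mathfrak{s}(u-t_j;\lambda)du$ and $\mathcal{S}^p_q([\varphi])=[\frac{\vartheta_1(u-t_p)}{\vartheta_1(u-t_q)}\varphi]$, $$\mathcal{S}^p_q([\varphi])=\sum_{j\ne p,q}J_j\frac{c_j\vartheta_1(t_j-t_p)}{\vartheta_1(t_j-t_q)}[\psi_j]+J_q\frac{c_p\vartheta_1(\lambda-t_p+t_q)}{\vartheta_1(\lambda)}[\psi_p]+B\,[\psi_q]$$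 in $H^1(M;\mathcal{L}_\lambda)$, where $$B=J_p\frac{(c_p+1)\vartheta_1(\lambda)}{\vartheta_1(\lambda-t_p+t_q)}-J_q\frac{c_p\vartheta_1(t_p-t_q)}{\vartheta_1'(0)}\big(\rho(t_p-t_q)-\rho(\lambda)\big)+\sum_{j\ne p,q}J_j\frac{c_j\vartheta_1(t_p-t_q)\vartheta_1(\lambda-t_p+t_j)}{\vartheta_1(t_j-t_q)\vartheta_1(\lambda-t_p+t_q)}.$$
   Context: Fix $\tau$ in the upper half plane, $\Lambda=\mathbb{Z}+\mathbb{Z}\tau$, $E=\mathbb{C}/\Lambda$, $P=\{a+b\tau:0\le a,b<1\}$. Let $\vartheta_1(u)=-\sum_{m\in\mathbb{Z}}\exp\big(\pi\sqrt{-1}(m+\tfrac12)^2\tau+2\pi\sqrt{-1}(m+\tfrac12)(u+\tfrac12)\big)$, $\rho(u)=\vartheta_1'(u)/\vartheta_1(u)$, and for $\mu\notin\Lambda$, $\mathfrak{s}(u;\mu)=\dfrac{\vartheta_1(u-\mu)\vartheta_1'(0)}{\vartheta_1(u)\vartheta_1(-\mu)}$. Let $n\ge2$, $t_1,\dots,t_n\in\mathbb{C}$ pairwise incongruent modulo $\Lambda$, $D=\{t_j\}\subset E$, $M=E\setminus D$. Let $c_0\in\mathbb{C}$, $c_1,\dots,c_n\in\mathbb{C}\setminus\mathbb{Z}$ with $\sum_{j\ge1}c_j=0$. For parameters $(c,\mu)$ let $\omega_c=\big(2\pi\sqrt{-1}c_0+\sum_j c_j\rho(u-t_j)\big)du$;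 $\mathcal{O}_\mu( *D)(E)$ is the space of meromorphic $f$ on $\mathbb{C}$ with poles only in $\{t_j\}+\Lambda$, $f(u+1)=f(u)$, $f(u+\tau)=e^{2\pi\sqrt{-1}\mu}f(u)$, and $\Omega^1_\mu( *D)(E)=\{f\,du\}$. The twisted cohomology groups are $H^1(M;\mathcal{L}_\mu)=\Omega^1_\mu( *D)(E)/\{df+f\omega_c\}$ and $H^1(M;\mathcal{L}^\vee_\mu)=\Omega^1_{-\mu}( *D)(E)/\{df-f\omega_c\}$. The intersection form $I_c([\varphi],[\varphi'])$ for $\varphi\in\Omega^1_\mu( *D)(E)$, $\varphi'\in\Omega^1_{-\mu}( *D)(E)$ is $\int_\Pi\varphi_1\wedge\varphi'$, where $\Pi$ is a fundamental parallelogram and $\varphi_1=\varphi-(dF+F\omega_c)$ is a smooth form vanishing near $\{t_j\}+\Lambda$ with $F$ smooth on $\mathbb{C}\setminus(\{t_j\}+\Lambda)$, $F(u+1)=F(u)$, $F(u+\tau)=e^{2\pi\sqrt{-1}\mu}F(u)$; equivalently $I_c=2\pi\sqrt{-1}\sum_j\operatorname{Res}_{u=t_j}(f_j\varphi')$ with $f_j$ the unique meromorphic solution near $t_j$ of $df_j+f_j\omega_c=\varphi$. The map $\mathcal{S}^p_q$ goes from $H^1(M;\mathcal{L}_{\lambda'})$ (parameters $(c',\lambda')$) to $H^1(M;\mathcal{L}_\lambda)$ (parameters $(c,\lambda)$) and is well defined. *)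

theory Defs
  imports "HOL-Complex_Analysis.Complex_Analysis"
begin

definition theta1 :: "complex \<Rightarrow> complex \<Rightarrow> complex" where
  "theta1 \<tau> u = - (\<Sum>\<^sub>\<infinity>m::int.
      exp (pi * \<i> * (of_int m + 1/2)^2 * \<tau> + 2 * pi * \<i> * (of_int m + 1/2) * (u + 1/2)))"

definition rho :: "complex \<Rightarrow> complex \<Rightarrow> complex" where
  "rho \<tau> u = deriv (theta1 \<tau>) u / theta1 \<tau> u"

definition sfun :: "complex \<Rightarrow> complex \<Rightarrow> complex \<Rightarrow> complex" where
  "sfun \<tau> u \<mu> = theta1 \<tau> (u - \<mu>) * deriv (theta1 \<tau>) 0 / (theta1 \<tau> u * theta1 \<tau> (- \<mu>))"

definition lattice :: "complex \<Rightarrow> complex set" where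
  "lattice \<tau> = {of_int a + of_int b * \<tau> | a b. True}"

definition fund_par :: "complex \<Rightarrow> complex set" where
  "fund_par \<tau> = {of_real a + of_real b * \<tau> | a b. 0 \<le> a \<and> a < 1 \<and> 0 \<le> b \<and> b < 1}"

definition pole_set :: "complex \<Rightarrow> (nat \<Rightarrow> complex) \<Rightarrow> nat \<Rightarrow> complex set" where
  "pole_set \<tau> t n = {t j + w | j w. j \<in> {1..n} \<and> w \<in> lattice \<tau>}"

text \<open>O_mu(*D)(E), equivalently coefficient functions f of elements f du of Omega^1_mu(*D)(E).\<close>
definition merom_sections :: "complex \<Rightarrow> (nat \<Rightarrow> complex) \<Rightarrow> nat \<Rightarrow> complex \<Rightarrow> (complex \<Rightarrow> complex) set" where
  "merom_sections \<tau> t n \<mu> = {f.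
     f holomorphic_on (- pole_set \<tau> t n) \<and>
     (\<forall>z\<in>pole_set \<tau> t n. not_essential f z) \<and>
     (\<forall>u. u \<notin> pole_set \<tau> t n \<longrightarrow>
        f (u + 1) = f u \<and> f (u + \<tau>) = exp (2 * pi * \<i> * \<mu>) * f u)}"

definition omega :: "complex \<Rightarrow> (nat \<Rightarrow> complex) \<Rightarrow> nat \<Rightarrow> (nat \<Rightarrow> complex) \<Rightarrow> complex \<Rightarrow> complex" where
  "omega \<tau> t n c u = 2 * pi * \<i> * c 0 + (\<Sum>j=1..n. c j * rho \<tau> (u - t j))"

text \<open>Equality of classes [phi1] = [phi2] in H^1(M; L_mu) for parameters (c, mu):
  phi1 - phi2 = dF + F omega_c with F in O_mu(*D)(E).\<close>
definition cohom_eq :: "complex \<Rightarrow> (nat \<Rightarrow> complex) \<Rightarrow> nat \<Rightarrow> (nat \<Rightarrow> complex) \<Rightarrow> complex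
      \<Rightarrow> (complex \<Rightarrow> complex) \<Rightarrow> (complex \<Rightarrow> complex) \<Rightarrow> bool" where
  "cohom_eq \<tau> t n c \<mu> \<phi>1 \<phi>2 \<longleftrightarrow>
     (\<exists>F \<in> merom_sections \<tau> t n \<mu>. \<forall>u. u \<notin> pole_set \<tau> t n \<longrightarrow>
        \<phi>1 u - \<phi>2 u = deriv F u + F u * omega \<tau> t n c u)"

text \<open>Res_{u=t_j}(f_j phi') where f_j is the unique meromorphic solution near t_j
  of d f_j + f_j omega_c = phi.\<close>
definition local_res :: "complex \<Rightarrow> (nat \<Rightarrow> complex) \<Rightarrow> nat \<Rightarrow> (nat \<Rightarrow> complex) \<Rightarrow> nat
      \<Rightarrow> (complex \<Rightarrow> complex) \<Rightarrow> (complex \<Rightarrow> complex) \<Rightarrow> complex" where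
  "local_res \<tau> t n c j \<phi> \<phi>' = (THE r. \<exists>f e. e > 0 \<and>
      f holomorphic_on (ball (t j) e - {t j}) \<and> not_essential f (t j) \<and>
      (\<forall>u \<in> ball (t j) e - {t j}. deriv f u + f u * omega \<tau> t n c u = \<phi> u) \<and>
      r = residue (\<lambda>u. f u * \<phi>' u) (t j))"

definition intersection :: "complex \<Rightarrow> (nat \<Rightarrow> complex) \<Rightarrow> nat \<Rightarrow> (nat \<Rightarrow> complex)
      \<Rightarrow> (complex \<Rightarrow> complex) \<Rightarrow> (complex \<Rightarrow> complex) \<Rightarrow> complex" where
  "intersection \<tau> t n c \<phi> \<phi>' = 2 * pi * \<i> * (\<Sum>j=1..n. local_res \<tau> t n c j \<phi> \<phi>')"

end

theory Submission
  imports Defs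
begin

text \<open>
  Put \<open>g u = \<theta>(u - t\<^sub>p) / \<theta>(u - t\<^sub>q)\<close>. Since \<open>dlog g = \<omega>\<^sub>c\<^sub>' - \<omega>\<^sub>c\<close>, multiplication by \<open>g\<close> turns the local
  solutions \<open>f\<^sub>j\<close> of \<open>df + f \<omega>\<^sub>c\<^sub>' = \<phi>\<close> into local solutions of \<open>dF + F \<omega>\<^sub>c = g \<phi>\<close>. As \<open>\<lambda>\<close> is not in the
  lattice, there is a global section \<open>G\<close> with the principal parts of all \<open>g f\<^sub>j\<close>; put \<open>h\<^sub>j = g f\<^sub>j - G\<close>, which is
  holomorphic at \<open>t\<^sub>j\<close>. Then \<open>g \<phi> - dG - G \<omega>\<^sub>c\<close> has at most simple poles, hence equals the sum of the
  \<open>c\<^sub>j h\<^sub>j(t\<^sub>j) \<psi>\<^sub>j\<close>. By the residue theorem on the torus, \<open>J\<^sub>k\<close> is the sum of the residues of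
  \<open>h\<^sub>j \<eta>'\<^sub>k / g\<close>. The form \<open>\<eta>'\<^sub>k / g\<close> has a single pole, at \<open>t\<^sub>k\<close> for \<open>k \<noteq> p, q\<close> and at \<open>t\<^sub>p\<close> for \<open>k = p, q\<close>,
  where it is double for \<open>k = p\<close>; in this last case \<open>h\<^sub>p'(t\<^sub>p)\<close> is eliminated with the constant term at \<open>t\<^sub>p\<close> of
  \<open>dh\<^sub>p + h\<^sub>p \<omega>\<^sub>c = \<Sum>\<^sub>l c\<^sub>l h\<^sub>l(t\<^sub>l) \<psi>\<^sub>l\<close>, and this brings in the coefficient of \<open>\<psi>\<^sub>q\<close>.

  The zeros of the theta series are found by comparing it with a product that has the same
  quasi-periods. The residue theorem needs no contour: after subtracting derivatives of \<open>\<rho>\<close> an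
  elliptic function becomes entire with additive quasi-period \<open>2 \<pi> \<i>\<close> times the sum of its residues,
  and such a function is constant.
\<close>

section \<open>The theta series\<close>

locale upper_half_plane =
  fixes tau :: complex
  assumes Im_tau: "Im tau > 0"
begin

definition theta_term :: "int \<Rightarrow> complex \<Rightarrow> complex" where
  "theta_term m u = exp (pi * \<i> * (of_int m + 1/2)^2 * tau + 2 * pi * \<i> * (of_int m + 1/2) * (u + 1/2))"

lemma theta1_eq_infsum: "theta1 tau u = - (\<Sum>\<^sub>\<infinity>m. theta_term m u)"
  by (simp add: theta1_def theta_term_def)

text \<open>Each half of the integers carries a geometric series of ratio exp (-1); the overlap at 0
  does no harm.\<close>

lemma summable_on_exp_neg_abs: "(\<lambda>m::int. exp (- \<bar>real_of_int m\<bar>)) summable_on UNIV"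
proof -
  have nat: "(\<lambda>n::nat. exp (- real n)) summable_on UNIV"
  proof -
    have "summable (\<lambda>n::nat. (exp (-1::real)) ^ n)"
      by (rule summable_geometric) auto
    then have "summable (\<lambda>n::nat. norm (exp (- real n)))"
      by (simp add: exp_of_nat_mult [symmetric])
    then show ?thesis
      by (rule norm_summable_imp_summable_on)
  qed
  have "(\<lambda>m::int. exp (- \<bar>real_of_int m\<bar>)) summable_on (range int)"
    by (subst summable_on_reindex) (use nat in \<open>auto simp: o_def\<close>)
  moreover have "(\<lambda>m::int. exp (- \<bar>real_of_int m\<bar>)) summable_on (range (\<lambda>n. - int n))"
    by (subst summable_on_reindex) (use nat in \<open>auto simp: o_def inj_on_def\<close>)
  moreover have "UNIV = range int \<union> range (\<lambda>n. - int n)"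
  proof -
    have "m \<in> range int \<union> range (\<lambda>n. - int n)" for m
      by (cases m rule: int_cases2) auto
    then show ?thesis by blast
  qed
  ultimately show ?thesis
    by (metis summable_on_union)
qed

text \<open>A summable majorant on the disc of radius \<open>R\<close>. With x = m + 1/2, the
  Gaussian exponent - pi Im tau x^2 absorbs (2 pi R + 1) |x| at the cost of the constant obtained by
  completing the square, which leaves exp (- |x|). The 1/2 pays for passing from |x| to |m|.\<close>

definition theta_bound :: "real \<Rightarrow> int \<Rightarrow> real" where
  "theta_bound R m = exp ((2 * pi * R + 1)\<^sup>2 / (4 * pi * Im tau) + 1/2) * exp (- \<bar>real_of_int m\<bar>)"

lemma theta_bound_summable: "theta_bound R summable_on UNIV"
  unfolding theta_bound_def [abs_def] by (intro summable_on_cmult_right summable_on_exp_neg_abs)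

lemma norm_theta_term_le:
  assumes "norm u \<le> R"
  shows "norm (theta_term m u) \<le> theta_bound R m"
proof -
  define x where "x = real_of_int m + 1/2"
  have x: "of_int m + 1/2 = complex_of_real x" by (simp add: x_def)
  have R: "\<bar>Im u\<bar> \<le> R" using assms abs_Im_le_cmod order_trans by blast
  have "norm (theta_term m u) = exp (- pi * Im tau * x\<^sup>2 - 2 * pi * x * Im u)"
  proof -
    have "Re (pi * \<i> * (of_real x)^2 * tau + 2 * pi * \<i> * of_real x * (u + 1/2)) =
        Re (of_real (pi * x\<^sup>2) * (\<i> * tau) + of_real (2 * pi * x) * (\<i> * (u + 1/2)))"
      by (simp add: mult_ac)
    also have "\<dots> = - pi * Im tau * x\<^sup>2 - 2 * pi * x * Im u"
      by simp
    finally show ?thesis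
      unfolding theta_term_def x norm_exp_eq_Re by simp
  qed
  also have "\<dots> \<le> exp ((2 * pi * R + 1)\<^sup>2 / (4 * pi * Im tau) - \<bar>x\<bar>)"
  proof -
    have "- (x * Im u) \<le> \<bar>x\<bar> * R"
    proof -
      have "- (x * Im u) \<le> \<bar>x\<bar> * \<bar>Im u\<bar>"
        unfolding abs_mult[symmetric] by linarith
      also have "\<dots> \<le> \<bar>x\<bar> * R" using R by (intro mult_left_mono) auto
      finally show ?thesis .
    qed
    then have "(2 * pi) * - (x * Im u) \<le> (2 * pi) * (\<bar>x\<bar> * R)"
      by (intro mult_left_mono) auto
    then have "- 2 * pi * x * Im u \<le> 2 * pi * R * \<bar>x\<bar>"
      by (simp add: mult_ac)
    moreover have "- pi * Im tau * x\<^sup>2 + (2 * pi * R + 1) * \<bar>x\<bar> \<le> (2 * pi * R + 1)\<^sup>2 / (4 * pi * Im tau)"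
    proof -
      define a where "a = pi * Im tau"
      define b where "b = 2 * pi * R + 1"
      have a: "a > 0" using Im_tau by (simp add: a_def)
      have "0 \<le> (2 * a * \<bar>x\<bar> - b)\<^sup>2" by simp
      then have "4 * a * (- a * x\<^sup>2 + b * \<bar>x\<bar>) \<le> b\<^sup>2"
        by (simp add: power2_diff power_mult_distrib) (simp add: power2_eq_square algebra_simps)
      then have "- a * x\<^sup>2 + b * \<bar>x\<bar> \<le> b\<^sup>2 / (4 * a)"
        using a by (simp add: pos_le_divide_eq mult.commute)
      then show ?thesis by (simp add: a_def b_def mult.assoc)
    qed
    ultimately show ?thesis by (simp add: algebra_simps)
  qed
  also have "\<dots> \<le> exp ((2 * pi * R + 1)\<^sup>2 / (4 * pi * Im tau) + 1/2 - \<bar>real_of_int m\<bar>)"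
    by (simp add: x_def)
  also have "\<dots> = theta_bound R m"
    by (simp add: theta_bound_def mult_exp_exp)
  finally show ?thesis .
qed

text \<open>Uniform convergence on discs serves twice: for holomorphy and for the termwise
  integration in \<open>theta1_not_identically_0\<close>.\<close>

lemma theta_uniform_limit:
  "uniform_limit (cball 0 R) (\<lambda>M u. \<Sum>m\<in>M. theta_term m u) (\<lambda>u. - theta1 tau u)
     (finite_subsets_at_top UNIV)"
  unfolding theta1_eq_infsum minus_minus
  by (rule Weierstrass_m_test_general[OF _ theta_bound_summable[of R]])
     (auto intro: norm_theta_term_le)

lemma theta1_holomorphic_UNIV: "theta1 tau holomorphic_on UNIV"
proof -
  have ball: "theta1 tau holomorphic_on ball 0 R" for R
  proof -
    have "(\<lambda>u. - theta1 tau u) holomorphic_on ball 0 R"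
      by (rule holomorphic_uniform_limit[OF _ theta_uniform_limit])
         (auto simp: theta_term_def intro!: always_eventually continuous_intros holomorphic_intros)
    from holomorphic_on_minus[OF this] show ?thesis by simp
  qed
  have "theta1 tau field_differentiable at u" for u
    using ball[of "norm u + 1"] by (auto simp: holomorphic_on_open holomorphic_on_def
        intro!: holomorphic_on_imp_differentiable_at[of _ "ball 0 (norm u + 1)"])
  then show ?thesis by (simp add: holomorphic_on_def field_differentiable_at_within)
qed

lemma theta1_holomorphic [holomorphic_intros]:
  assumes "f holomorphic_on A" shows "(\<lambda>u. theta1 tau (f u)) holomorphic_on A"
  using holomorphic_on_compose[OF assms holomorphic_on_subset[OF theta1_holomorphic_UNIV]]
  by (simp add: o_def)

lemma theta1_add_1: "theta1 tau (u + 1) = - theta1 tau u"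
proof -
  have "theta_term m (u + 1) = - theta_term m u" for m
  proof -
    have "theta_term m (u + 1) = theta_term m u * exp (2 * pi * \<i> * (of_int m + 1/2))"
      unfolding theta_term_def exp_add[symmetric] by (simp add: algebra_simps)
    also have "2 * pi * \<i> * (of_int m + 1/2) = (2 * of_int m * pi) * \<i> + pi * \<i>"
      by (simp add: algebra_simps)
    also have "exp \<dots> = -1"
      unfolding exp_add by (simp add: exp_integer_2pi mult_ac)
    finally show ?thesis by simp
  qed
  then show ?thesis by (simp add: theta1_eq_infsum infsum_uminus)
qed

text \<open>Since (m + 1/2)^2 + 2 (m + 1/2) = (m + 3/2)^2 - 1, the shift by \<open>tau\<close>
  carries term \<open>m\<close> to term \<open>m + 1\<close> up to a factor independent of
  \<open>m\<close>.\<close>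

lemma theta1_add_tau: "theta1 tau (u + tau) = - exp (- pi * \<i> * tau - 2 * pi * \<i> * u) * theta1 tau u"
proof -
  have *: "theta_term m (u + tau) = - exp (- pi * \<i> * tau - 2 * pi * \<i> * u) * theta_term (m + 1) u" for m
  proof -
    have "- exp (- pi * \<i> * tau - 2 * pi * \<i> * u) * theta_term (m + 1) u =
       exp (- pi * \<i> + (- pi * \<i> * tau - 2 * pi * \<i> * u)) * theta_term (m + 1) u"
      unfolding exp_add[of "- pi * \<i>"] by (simp add: exp_minus)
    also have "\<dots> = theta_term m (u + tau)"
      unfolding theta_term_def exp_add[symmetric] by (simp add: algebra_simps power2_eq_square)
    finally show ?thesis ..
  qed
  have "(\<Sum>\<^sub>\<infinity>m. theta_term (m + 1) u) = (\<Sum>\<^sub>\<infinity>m. theta_term m u)"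
    by (rule infsum_reindex_bij_betw) (rule bij_betwI[of _ _ _ "\<lambda>m. m - 1"], auto)
  then show ?thesis
    unfolding theta1_eq_infsum * by (subst infsum_cmult_right') simp
qed

text \<open>The reflection of m to - 1 - m negates m + 1/2 and so keeps its square; the summand 1/2
  in u + 1/2 produces the sign.\<close>

lemma theta1_minus [simp]: "theta1 tau (- u) = - theta1 tau u"
proof -
  have *: "theta_term m (- u) = - theta_term (- 1 - m) u" for m
  proof -
    have "theta_term m (- u) = exp (2 * pi * \<i> * (of_int m + 1/2)) * theta_term (- 1 - m) u"
      unfolding theta_term_def exp_add[symmetric] by (simp add: algebra_simps power2_eq_square)
    also have "2 * pi * \<i> * (of_int m + 1/2) = (2 * of_int m * pi) * \<i> + pi * \<i>"
      by (simp add: algebra_simps)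
    also have "exp \<dots> = -1"
      unfolding exp_add by (simp add: exp_integer_2pi mult_ac)
    finally show ?thesis by simp
  qed
  have "(\<Sum>\<^sub>\<infinity>m. theta_term (- 1 - m) u) = (\<Sum>\<^sub>\<infinity>m. theta_term m u)"
    by (rule infsum_reindex_bij_betw) (rule bij_betwI[of _ _ _ "\<lambda>m. - 1 - m"], auto)
  then show ?thesis
    unfolding theta1_eq_infsum * by (simp add: infsum_uminus)
qed

lemma theta1_0 [simp]: "theta1 tau 0 = 0"
  using theta1_minus[of 0] by (simp add: eq_neg_iff_add_eq_0)

text \<open>On the real interval from 0 to 1 the series times exp (- pi i x) is a uniformly
  convergent Fourier series. If theta vanished identically, its constant coefficient
  \<open>a 0\<close> would be 0 as a limit of integrals, yet it is an exponential.\<close>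

lemma theta1_not_identically_0: "\<exists>u. theta1 tau u \<noteq> 0"
proof (rule ccontr)
  assume "\<nexists>u. theta1 tau u \<noteq> 0"
  then have zero: "theta1 tau u = 0" for u by blast
  \<comment> \<open>The extra factor moves the frequencies m + 1/2 to the integers, so that
    integration over a full period singles out m = 0.\<close>
  define F where "F = (\<lambda>M (x::real). \<Sum>m\<in>M. theta_term m (of_real x) * exp (- pi * \<i> * of_real x))"
  define a where "a = (\<lambda>m. theta_term m 0)"
  have term_eq: "theta_term m (of_real x) * exp (- pi * \<i> * of_real x) = a m * exp (2 * pi * \<i> * of_int m * of_real x)" for m x
    unfolding a_def theta_term_def exp_add[symmetric] by (simp add: algebra_simps power2_eq_square)
  have lim0: "uniform_limit (cball 0 1) (\<lambda>M u. \<Sum>m\<in>M. theta_term m u) (\<lambda>u. 0) (finite_subsets_at_top UNIV)"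
    using theta_uniform_limit[of 1] zero by simp
  have "uniform_limit {0..1::real} F (\<lambda>u. 0) (finite_subsets_at_top UNIV)"
  proof (rule uniform_limitI)
    fix e :: real assume "e > 0"
    with lim0 have "\<forall>\<^sub>F M in finite_subsets_at_top UNIV. \<forall>u\<in>cball 0 1. dist (\<Sum>m\<in>M. theta_term m u) 0 < e"
      by (rule uniform_limitD)
    then show "\<forall>\<^sub>F M in finite_subsets_at_top UNIV. \<forall>x\<in>{0..1}. dist (F M x) 0 < e"
    proof eventually_elim
      case (elim M)
      show ?case
      proof
        fix x :: real assume x: "x \<in> {0..1}"
        then have "dist (\<Sum>m\<in>M. theta_term m (of_real x)) 0 < e"
          using elim by auto
        then show "dist (F M x) 0 < e"
          by (simp add: F_def sum_distrib_right[symmetric] norm_mult)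
      qed
    qed
  qed
  then obtain I J where I: "\<And>M. (F M has_integral I M) {0..1}" and J: "((\<lambda>_. 0::complex) has_integral J) {0..1::real}"
    and lim: "(I \<longlongrightarrow> J) (finite_subsets_at_top UNIV)"
    by (rule uniform_limit_integral)
       (auto simp: F_def theta_term_def intro!: continuous_intros)
  have J0: "J = 0" using J has_integral_0 has_integral_unique by blast
  have int0: "((\<lambda>x. exp (2 * pi * \<i> * of_int m * of_real x)) has_integral (if m = 0 then 1 else 0)) {0..1::real}" for m :: int
  proof (cases "m = 0")
    case True
    then show ?thesis using has_integral_const_real[of "1::complex" 0 1] by simp
  next
    case False
    define k where "k = 2 * pi * \<i> * of_int m"
    have k: "k \<noteq> 0" using False by (simp add: k_def)
    have "((\<lambda>x. exp (k * of_real x)) has_integral (exp (k * of_real 1) / k - exp (k * of_real 0) / k)) {0..1::real}"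
    proof (rule fundamental_theorem_of_calculus)
      fix x :: real
      have "((\<lambda>z. exp (k * z) / k) has_field_derivative exp (k * of_real x)) (at (of_real x))"
        using k by (auto intro!: derivative_eq_intros)
      then show "((\<lambda>x. exp (k * of_real x) / k) has_vector_derivative exp (k * of_real x)) (at x within {0..1})"
        using has_vector_derivative_real_field by (blast intro: has_vector_derivative_at_within)
    qed simp
    moreover have "exp k = 1" unfolding k_def
      using exp_integer_2pi[of "of_int m"] by (simp add: mult_ac)
    ultimately show ?thesis using False by (simp add: k_def)
  qed
  have "I M = a 0" if "finite M" "0 \<in> M" for M
  proof -
    have "(F M has_integral (\<Sum>m\<in>M. a m * (if m = 0 then 1 else 0))) {0..1}"
      unfolding F_def term_eq using that
      by (intro has_integral_sum has_integral_mult_right int0)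
    then have "I M = (\<Sum>m\<in>M. a m * (if m = 0 then 1 else 0))"
      using I[of M] has_integral_unique by blast
    also have "\<dots> = a 0"
      using that by (simp add: if_distrib[of "(*) _"] sum.delta' cong: if_cong)
    finally show ?thesis .
  qed
  then have "eventually (\<lambda>M. I M = a 0) (finite_subsets_at_top UNIV)"
    unfolding eventually_finite_subsets_at_top
    by (intro exI[of _ "{0}"]) auto
  then have "(I \<longlongrightarrow> a 0) (finite_subsets_at_top UNIV)"
    by (rule tendsto_eventually)
  then have "a 0 = J" using lim tendsto_unique finite_subsets_at_top_neq_bot by blast
  then show False by (simp add: J0 a_def theta_term_def)
qed

end

section \<open>Zeros of the theta function\<close>

lemma periodic_of_int_mult:
  fixes F :: "complex \<Rightarrow> 'a"
  assumes "\<And>u. F (u + w) = F u"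
  shows "F (u + of_int a * w) = F u"
proof (induction a arbitrary: u rule: int_induct[where k=0])
  case (step1 i)
  have "F (u + of_int (i + 1) * w) = F ((u + of_int i * w) + w)" by (simp add: algebra_simps)
  then show ?case using assms step1 by simp
next
  case (step2 i)
  have "F (u + of_int i * w) = F ((u + of_int (i - 1) * w) + w)" by (simp add: algebra_simps)
  then show ?case using assms step2 by simp
qed simp

lemma latticeE:
  assumes "w \<in> lattice \<tau>"
  obtains a b :: int where "w = of_int a + of_int b * \<tau>"
  using assms by (auto simp: lattice_def)

lemma latticeI: "of_int a + of_int b * \<tau> \<in> lattice \<tau>"
  by (auto simp: lattice_def)

lemma lattice_0 [simp]: "0 \<in> lattice \<tau>"
  using latticeI[of 0 0] by simp

lemma lattice_uminus [simp]: "- w \<in> lattice \<tau> \<longleftrightarrow> w \<in> lattice \<tau>"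
proof -
  have "- w \<in> lattice \<tau>" if "w \<in> lattice \<tau>" for w
    using that latticeI[of "- _" "- _" \<tau>] by (elim latticeE) (simp add: algebra_simps)
  then show ?thesis by force
qed

lemma lattice_add: "v \<in> lattice \<tau> \<Longrightarrow> w \<in> lattice \<tau> \<Longrightarrow> v + w \<in> lattice \<tau>"
proof (elim latticeE)
  fix a b c d :: int assume "v = of_int a + of_int b * \<tau>" "w = of_int c + of_int d * \<tau>"
  then show ?thesis using latticeI[of "a + c" "b + d" \<tau>] by (simp add: algebra_simps)
qed

lemma lattice_diff: "v \<in> lattice \<tau> \<Longrightarrow> w \<in> lattice \<tau> \<Longrightarrow> v - w \<in> lattice \<tau>"
  using lattice_add[of v \<tau> "- w"] by simp

lemma lattice_1 [simp]: "1 \<in> lattice \<tau>" and lattice_period [simp]: "\<tau> \<in> lattice \<tau>"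
  using latticeI[of 1 0 \<tau>] latticeI[of 0 1 \<tau>] by simp_all

lemma periodic_lattice:
  assumes "\<And>u. F (u + 1) = F u" "\<And>u. F (u + \<tau>) = F u" "w \<in> lattice \<tau>"
  shows "F (u + w) = F u"
  using assms(3)
proof (elim latticeE)
  fix a b assume w: "w = of_int a + of_int b * \<tau>"
  have "F (u + w) = F ((u + of_int a * 1) + of_int b * \<tau>)" by (simp add: w algebra_simps)
  also have "\<dots> = F u"
    using periodic_of_int_mult[of F \<tau>, OF assms(2)] periodic_of_int_mult[of F 1, OF assms(1)] by simp
  finally show ?thesis .
qed

lemma exp_2pi_i_eq_1: "exp (2 * pi * \<i> * x) = 1 \<Longrightarrow> \<exists>n::int. x = of_int n"
proof -
  assume "exp (2 * pi * \<i> * x) = 1"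
  then obtain n :: int where "Re (2 * pi * \<i> * x) = 0" "Im (2 * pi * \<i> * x) = of_int (2 * n) * pi"
    unfolding exp_eq_1 by blast
  then have "Im x = 0" "Re x = of_int n" by auto
  then show ?thesis by (intro exI[of _ n]) (simp add: complex_eq_iff)
qed

lemma filterlim_at_shift:
  fixes f :: "complex \<Rightarrow> complex"
  shows "filterlim f F (at (z + w)) \<longleftrightarrow> filterlim (\<lambda>u. f (u + w)) F (at z)"
proof -
  have "filterlim f F (at (z + w)) \<longleftrightarrow> filterlim (\<lambda>x. f (x + (z + w))) F (at 0)"
    by (subst at_to_0) (simp add: filterlim_filtermap)
  also have "\<dots> \<longleftrightarrow> filterlim (\<lambda>u. f (u + w)) F (at z)"
    by (subst (2) at_to_0) (simp add: filterlim_filtermap add_ac)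
  finally show ?thesis .
qed

section \<open>Entire functions with quasi-periods\<close>

context upper_half_plane
begin

lemma real_coordinates:
  obtains a b :: real where "u = of_real a + of_real b * tau"
proof
  define b where "b = Im u / Im tau"
  show "u = of_real (Re u - b * Re tau) + of_real b * tau"
    using Im_tau by (simp add: complex_eq_iff b_def)
qed

text \<open>All norms occur on the compact parallelogram \<open>K\<close>, so Liouville's theorem
  applies. Only the norm is asked to be periodic, because \<open>entire_multiplier_eq_0\<close> has
  multipliers of modulus one.\<close>

lemma entire_norm_periodic_constant:
  assumes f: "f holomorphic_on UNIV"
    and 1: "\<And>u. norm (f (u + 1)) = norm (f u)" and tau: "\<And>u. norm (f (u + tau)) = norm (f u)"
  obtains C where "\<And>u. f u = C"
proof -
  define K where "K = (\<lambda>(a, b). of_real a + of_real b * tau) ` ({0..1::real} \<times> {0..1::real})"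
  have "compact K"
    unfolding K_def case_prod_unfold
    by (intro compact_continuous_image continuous_intros compact_Times compact_Icc)
  then have "compact (f ` K)"
    using f by (meson compact_continuous_image holomorphic_on_imp_continuous_on holomorphic_on_subset top_greatest)
  then have "bounded (f ` K)" by (rule compact_imp_bounded)
  then obtain B where B: "\<And>u. u \<in> K \<Longrightarrow> norm (f u) \<le> B" by (auto simp: bounded_iff)
  have "norm (f u) \<le> B" for u
  proof -
    obtain a b :: real where u: "u = of_real a + of_real b * tau" by (rule real_coordinates)
    define v where "v = of_real (frac a) + of_real (frac b) * tau"
    have "v \<in> K" unfolding K_def v_def
      by (rule image_eqI[of _ _ "(frac a, frac b)"]) (auto simp: less_imp_le frac_lt_1)
    moreover have "u = v + (of_int \<lfloor>a\<rfloor> + of_int \<lfloor>b\<rfloor> * tau)"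
      by (simp add: u v_def frac_def algebra_simps)
    ultimately show ?thesis
      using periodic_lattice[of "\<lambda>u. norm (f u)" tau, OF 1 tau latticeI] B by metis
  qed
  then have "bounded (range f)" by (auto simp: bounded_iff)
  with f have "f constant_on UNIV" by (rule Liouville_theorem)
  then show ?thesis using that by (auto simp: constant_on_def)
qed

text \<open>With \<open>\<mu>\<close> = a + b tau for real a and b, multiplication by exp (- 2 pi i
  b u) turns both multipliers into numbers of modulus one, so the product is constant. A nonzero
  constant would force both multipliers to be 1, hence a and b to be integers.\<close>

lemma entire_multiplier_eq_0:
  assumes f: "f holomorphic_on UNIV"
    and 1: "\<And>u. f (u + 1) = f u" and tau: "\<And>u. f (u + tau) = exp (2 * pi * \<i> * \<mu>) * f u"
    and \<mu>: "\<mu> \<notin> lattice tau"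
  shows "f u = 0"
proof -
  obtain a b :: real where ab: "\<mu> = of_real a + of_real b * tau" by (rule real_coordinates)
  define g where "g = (\<lambda>u. exp (- (2 * pi * \<i> * b * u)) * f u)"
  have g: "g holomorphic_on UNIV"
    unfolding g_def by (intro holomorphic_intros f)
  have g1: "g (u + 1) = exp (2 * pi * \<i> * of_real (- b)) * g u" for u
  proof -
    have "exp (- (2 * pi * \<i> * b * (u + 1))) = exp (2 * pi * \<i> * of_real (- b)) * exp (- (2 * pi * \<i> * b * u))"
      unfolding exp_add[symmetric] by (simp add: algebra_simps)
    then show ?thesis by (simp add: g_def 1)
  qed
  have gtau: "g (u + tau) = exp (2 * pi * \<i> * of_real a) * g u" for u
  proof -
    have "exp (- (2 * pi * \<i> * b * (u + tau))) * exp (2 * pi * \<i> * \<mu>) = exp (2 * pi * \<i> * of_real a) * exp (- (2 * pi * \<i> * b * u))"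
      unfolding exp_add[symmetric] by (simp add: ab algebra_simps)
    then show ?thesis by (simp add: g_def tau)
  qed
  have unit: "norm (exp (2 * pi * \<i> * of_real x)) = 1" for x :: real
    by simp
  have "norm (g (u + 1)) = norm (g u)" "norm (g (u + tau)) = norm (g u)" for u
    unfolding g1 gtau norm_mult unit by simp_all
  then obtain C where C: "\<And>u. g u = C"
    using entire_norm_periodic_constant[OF g] by blast
  have "C = 0"
  proof (rule ccontr)
    assume "C \<noteq> 0"
    with g1[of 0] gtau[of 0] have "exp (2 * pi * \<i> * of_real (- b)) = 1" "exp (2 * pi * \<i> * of_real a) = 1"
      by (simp_all add: C)
    then obtain m n :: int where "of_real (- b) = complex_of_int m" "of_real a = complex_of_int n"
      using exp_2pi_i_eq_1 by metis
    then have "\<mu> = of_int n + of_int (- m) * tau"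
      by (simp add: ab minus_equation_iff[of "of_real b"])
    with \<mu> show False using latticeI by metis
  qed
  then show ?thesis using C[of u] by (simp add: g_def)
qed

text \<open>Having a finite limit passes to all lattice translates, in both directions since
  \<open>\<kappa>\<close> is not 0, so one translate per class suffices. The affine law covers at
  once quotients with the same quasi-periods, sections with a multiplier, and the additive
  quasi-period in the residue theorem. The laws are asked only on punctured neighbourhoods because
  values at poles are arbitrary.\<close>

lemma quasi_periodic_extension:
  assumes mero: "f meromorphic_on UNIV"
    and 1: "\<And>z. \<forall>\<^sub>F u in at z. f (u + 1) = f u"
    and tau: "\<And>z. \<forall>\<^sub>F u in at z. f (u + tau) = \<kappa> * f u + d" and \<kappa>: "\<kappa> \<noteq> 0"
    and lim: "\<And>z. \<exists>w\<in>lattice tau. \<exists>c. f \<midarrow>z + w\<rightarrow> c"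
  shows "remove_sings f holomorphic_on UNIV"
    and "remove_sings f (u + 1) = remove_sings f u"
    and "remove_sings f (u + tau) = \<kappa> * remove_sings f u + d"
proof -
  have lim1: "f \<midarrow>z + 1\<rightarrow> c \<longleftrightarrow> f \<midarrow>z\<rightarrow> c" for z c
    unfolding filterlim_at_shift by (intro filterlim_cong refl 1)
  have limtau: "f \<midarrow>z + tau\<rightarrow> \<kappa> * c + d" if "f \<midarrow>z\<rightarrow> c" for z c
  proof -
    have "(\<lambda>u. \<kappa> * f u + d) \<midarrow>z\<rightarrow> \<kappa> * c + d" by (intro tendsto_intros that)
    also have "?this \<longleftrightarrow> (\<lambda>u. f (u + tau)) \<midarrow>z\<rightarrow> \<kappa> * c + d"
      using tau[of z] by (intro filterlim_cong refl) (auto elim: eventually_mono)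
    finally show ?thesis unfolding filterlim_at_shift .
  qed
  have limtau': "f \<midarrow>z\<rightarrow> (c - d) / \<kappa>" if "f \<midarrow>z + tau\<rightarrow> c" for z c
  proof -
    have "(\<lambda>u. (f (u + tau) - d) / \<kappa>) \<midarrow>z\<rightarrow> (c - d) / \<kappa>"
      using that \<kappa> unfolding filterlim_at_shift by (intro tendsto_intros)
    also have "?this \<longleftrightarrow> ?thesis"
      using tau[of z] \<kappa> by (intro filterlim_cong refl) (auto elim: eventually_mono)
    finally show ?thesis .
  qed
  define L where "L = (\<lambda>z. \<exists>c. f \<midarrow>z\<rightarrow> c)"
  have "L (z + 1) = L z" "L (z + tau) = L z" for z
    unfolding L_def using lim1 limtau limtau' by blast+
  then have "L (z + w) = L z" if "w \<in> lattice tau" for z w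
    using that by (rule periodic_lattice)
  with lim have L: "L z" for z
    unfolding L_def by blast
  have "remove_sings f analytic_on {z}" for z
    using L[of z] mero unfolding L_def
    by (auto intro!: remove_sings_analytic_at meromorphic_on_isolated_singularity
        intro: meromorphic_on_subset)
  then show "remove_sings f holomorphic_on UNIV"
    by (metis analytic_imp_holomorphic analytic_on_analytic_at)
  obtain c where c: "f \<midarrow>u\<rightarrow> c" using L[of u] by (auto simp: L_def)
  show "remove_sings f (u + 1) = remove_sings f u"
    using c lim1 remove_sings_eqI by metis
  show "remove_sings f (u + tau) = \<kappa> * remove_sings f u + d"
    using c limtau remove_sings_eqI by metis
qed

section \<open>Euler's product and a product with the quasi-periods of theta\<close>

text \<open>The q of the product formulas, which is the square of exp (pi i tau).\<close>

definition nome :: complex where "nome = exp (2 * pi * \<i> * tau)"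

lemma norm_nome: "norm nome < 1"
  using Im_tau by (simp add: nome_def)

lemma nome_neq_0 [simp]: "nome \<noteq> 0"
  by (simp add: nome_def)

lemma nome_power_neq_1: "nome ^ Suc k \<noteq> 1"
proof
  assume "nome ^ Suc k = 1"
  then have "norm nome ^ Suc k = 1" by (metis norm_one norm_power)
  moreover have "norm nome ^ Suc k < 1"
    using norm_nome by (intro power_Suc_less_one) (auto simp del: power_Suc)
  ultimately show False by simp
qed

text \<open>The coefficients of Euler's expansion of the product of all \<open>1 - q ^ n * w\<close> with \<open>n \<ge> 0\<close>.\<close>
fun euler_coeff :: "nat \<Rightarrow> complex" where
  "euler_coeff 0 = 1"
| "euler_coeff (Suc k) = - (nome ^ k / (1 - nome ^ Suc k)) * euler_coeff k"

definition euler_fun :: "complex \<Rightarrow> complex" where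
  "euler_fun w = (\<Sum>k. euler_coeff k * w ^ k)"

text \<open>Consecutive terms have a ratio of norm at most |nome|^k |w| / (1 - |nome|), which tends
  to 0, so the series converges for every \<open>w\<close>.\<close>

lemma euler_fun_sums: "(\<lambda>k. euler_coeff k * w ^ k) sums euler_fun w"
proof -
  define d where "d = norm w / (1 - norm nome)"
  have "(\<lambda>k. norm nome ^ k * d) \<longlonglongrightarrow> 0 * d"
    using norm_nome by (intro tendsto_intros LIMSEQ_power_zero) auto
  then have "\<forall>\<^sub>F k in sequentially. norm nome ^ k * d < 1/2"
    by (intro order_tendstoD(2)[of _ 0]) auto
  then obtain N where N: "\<And>k. k \<ge> N \<Longrightarrow> norm nome ^ k * d < 1/2"
    by (auto simp: eventually_sequentially)
  have "summable (\<lambda>k. euler_coeff k * w ^ k)"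
  proof (rule summable_ratio_test[of "1/2" N])
    fix k assume k: "k \<ge> N"
    have "norm (nome ^ Suc k) \<le> norm nome"
      using norm_nome by (simp add: norm_mult norm_power mult_left_le power_le_one)
    then have le: "norm (1 - nome ^ Suc k) \<ge> 1 - norm nome"
      using norm_triangle_ineq2[of 1 "nome ^ Suc k"] by simp
    have "norm (euler_coeff (Suc k) * w ^ Suc k) =
        (norm nome ^ k * (norm w / norm (1 - nome ^ Suc k))) * norm (euler_coeff k * w ^ k)"
      by (simp add: norm_mult norm_divide norm_power)
    also have "\<dots> \<le> (norm nome ^ k * d) * norm (euler_coeff k * w ^ k)"
      unfolding d_def using le norm_nome
      by (intro mult_right_mono mult_left_mono divide_left_mono mult_pos_pos) auto
    also have "\<dots> \<le> 1/2 * norm (euler_coeff k * w ^ k)"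
      using N[OF k] by (intro mult_right_mono) auto
    finally show "norm (euler_coeff (Suc k) * w ^ Suc k) \<le> 1/2 * norm (euler_coeff k * w ^ k)" .
  qed simp
  then show ?thesis unfolding euler_fun_def by (rule summable_sums)
qed

lemma euler_fun_0 [simp]: "euler_fun 0 = 1"
  using sums_unique2[OF euler_fun_sums[of 0] powser_sums_zero[of euler_coeff]] by simp

lemma euler_fun_holomorphic_UNIV: "euler_fun holomorphic_on UNIV"
proof -
  have "euler_fun holomorphic_on ball 0 r" for r
    by (rule power_series_holomorphic[where a = euler_coeff]) (use euler_fun_sums in auto)
  then have "euler_fun field_differentiable at u" for u
    by (rule holomorphic_on_imp_differentiable_at[of _ "ball 0 (norm u + 1)"]) auto
  then show ?thesis by (simp add: holomorphic_on_def field_differentiable_at_within)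
qed

lemma euler_fun_holomorphic [holomorphic_intros]:
  assumes "f holomorphic_on A" shows "(\<lambda>u. euler_fun (f u)) holomorphic_on A"
  using holomorphic_on_compose[OF assms holomorphic_on_subset[OF euler_fun_holomorphic_UNIV]]
  by (simp add: o_def)

text \<open>At w^(k+1) this amounts to (1 - nome^(k+1)) e_(k+1) = - nome^k e_k, the recursion that
  defines \<open>euler_coeff\<close>.\<close>

lemma euler_fun_rec: "euler_fun w = (1 - w) * euler_fun (nome * w)"
proof -
  have shift: "(\<lambda>k. euler_coeff (Suc k) * x ^ Suc k) sums (euler_fun x - 1)" for x
    using euler_fun_sums[of x] by (subst sums_Suc_iff) simp
  have "(\<lambda>k. euler_coeff (Suc k) * w ^ Suc k - euler_coeff (Suc k) * (nome * w) ^ Suc k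
          + w * (euler_coeff k * (nome * w) ^ k))
      sums ((euler_fun w - 1) - (euler_fun (nome * w) - 1) + w * euler_fun (nome * w))"
    by (intro sums_add sums_diff sums_mult shift euler_fun_sums)
  also have "(\<lambda>k. euler_coeff (Suc k) * w ^ Suc k - euler_coeff (Suc k) * (nome * w) ^ Suc k
          + w * (euler_coeff k * (nome * w) ^ k)) = (\<lambda>k. 0)"
  proof
    fix k
    have "euler_coeff (Suc k) * (1 - nome ^ Suc k) = - (nome ^ k * euler_coeff k)"
      using nome_power_neq_1[of k] by (simp add: field_simps)
    then have "(euler_coeff (Suc k) * (1 - nome ^ Suc k) + nome ^ k * euler_coeff k) * w ^ Suc k = 0"
      by simp
    then show "euler_coeff (Suc k) * w ^ Suc k - euler_coeff (Suc k) * (nome * w) ^ Suc k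
          + w * (euler_coeff k * (nome * w) ^ k) = 0"
      by (simp only: power_mult_distrib power_Suc algebra_simps mult_1)
  qed
  finally have "euler_fun w - 1 - (euler_fun (nome * w) - 1) + w * euler_fun (nome * w) = 0"
    using sums_zero sums_unique2 by blast
  then show ?thesis by (simp add: algebra_simps)
qed

text \<open>If no factor 1 - nome^n w is zero, \<open>euler_fun_rec\<close> carries a zero at
  \<open>w\<close> to all points nome^n w. These tend to 0, where the value is 1. In this way the
  zeros are located without an infinite product.\<close>

lemma euler_fun_eq_0D:
  assumes "euler_fun w = 0"
  shows "\<exists>n. nome ^ n * w = 1"
proof (rule ccontr)
  assume *: "\<nexists>n. nome ^ n * w = 1"
  have zero: "euler_fun (nome ^ n * w) = 0" for n
  proof (induction n)
    case (Suc n)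
    then show ?case using euler_fun_rec[of "nome ^ n * w"] * by (auto simp: mult_ac)
  qed (use assms in simp)
  have "isCont euler_fun 0"
    using holomorphic_on_imp_continuous_on[OF euler_fun_holomorphic_UNIV]
    by (simp add: continuous_on_eq_continuous_at)
  moreover have "(\<lambda>n. nome ^ n * w) \<longlonglongrightarrow> 0"
    using norm_nome by (intro tendsto_mult_left_zero LIMSEQ_power_zero)
  ultimately have "(\<lambda>n. euler_fun (nome ^ n * w)) \<longlonglongrightarrow> euler_fun 0"
    by (rule isCont_tendsto_compose)
  then show False by (simp add: zero LIMSEQ_const_iff)
qed

text \<open>Up to a constant this is Jacobi's product for exp (pi i u) times theta; the exponential
  makes it periodic under u + 1, where theta is antiperiodic.\<close>

definition theta_prod :: "complex \<Rightarrow> complex" where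
  "theta_prod u = euler_fun (exp (2 * pi * \<i> * u)) * euler_fun (nome * exp (- (2 * pi * \<i> * u)))"

lemma theta_prod_holomorphic: "theta_prod holomorphic_on UNIV"
  unfolding theta_prod_def [abs_def] by (intro holomorphic_intros)

lemma theta_prod_add_1: "theta_prod (u + 1) = theta_prod u"
proof -
  have "exp (2 * pi * \<i> * (u + 1)) = exp (2 * pi * \<i> * u)"
    by (simp add: ring_distribs exp_add)
  then show ?thesis by (simp add: theta_prod_def exp_minus)
qed

text \<open>With w = exp (2 pi i u) the shift replaces w by nome w; \<open>euler_fun_rec\<close> at
  w and at 1 / w then leaves, formally, the ratio (1 - 1 / w) / (1 - w) = - 1 / w.\<close>

lemma theta_prod_add_tau: "theta_prod (u + tau) = - exp (- (2 * pi * \<i> * u)) * theta_prod u"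
proof -
  define w where "w = exp (2 * pi * \<i> * u)"
  have w: "w \<noteq> 0" by (simp add: w_def)
  have "exp (2 * pi * \<i> * (u + tau)) = nome * w"
    by (simp add: ring_distribs exp_add w_def nome_def)
  then have l: "theta_prod (u + tau) = euler_fun (nome * w) * euler_fun (1 / w)"
    unfolding theta_prod_def exp_minus by (simp add: divide_simps w)
  have r: "theta_prod u = euler_fun w * euler_fun (nome * (1 / w))"
    by (simp add: theta_prod_def exp_minus w_def field_simps)
  have e1: "exp (- (2 * pi * \<i> * u)) = 1 / w" by (simp add: w_def exp_minus field_simps)
  show ?thesis
    unfolding l r e1 euler_fun_rec[of w] euler_fun_rec[of "1 / w"] using w by (simp add: field_simps)
qed

lemma theta_prod_eq_0D:
  assumes "theta_prod u = 0"
  shows "u \<in> lattice tau"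
proof -
  have pow: "nome ^ n = exp (2 * pi * \<i> * (of_nat n * tau))" for n
    by (simp add: nome_def exp_of_nat_mult[symmetric] mult_ac)
  from assms consider "euler_fun (exp (2 * pi * \<i> * u)) = 0" | "euler_fun (nome * exp (- (2 * pi * \<i> * u))) = 0"
    by (auto simp: theta_prod_def)
  then show ?thesis
  proof cases
    case 1
    then obtain n where "nome ^ n * exp (2 * pi * \<i> * u) = 1" using euler_fun_eq_0D by blast
    then have "exp (2 * pi * \<i> * (of_nat n * tau + u)) = 1"
      by (simp add: pow exp_add ring_distribs)
    then obtain m :: int where "of_nat n * tau + u = of_int m" using exp_2pi_i_eq_1 by blast
    then have "u = of_int m + of_int (- int n) * tau" by (simp add: algebra_simps)
    then show ?thesis using latticeI by metis
  next
    case 2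
    then obtain n where "nome ^ n * (nome * exp (- (2 * pi * \<i> * u))) = 1" using euler_fun_eq_0D by blast
    then have "nome ^ Suc n * exp (- (2 * pi * \<i> * u)) = 1" by (simp add: mult_ac)
    then have "exp (2 * pi * \<i> * (of_nat (Suc n) * tau - u)) = 1"
      unfolding pow exp_add[symmetric] by (simp add: algebra_simps)
    then obtain m :: int where "of_nat (Suc n) * tau - u = of_int m" using exp_2pi_i_eq_1 by blast
    then have "u = of_int (- m) + of_int (int (Suc n)) * tau" by (simp add: algebra_simps)
    then show ?thesis using latticeI by metis
  qed
qed

text \<open>One use of \<open>euler_fun_rec\<close> splits off 1 - exp (2 pi i u), which has a
  simple zero at 0; the other factor \<open>S\<close> is nonzero there because no positive power of
  \<open>nome\<close> is 1.\<close>

lemma theta_prod_deriv_0: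
  obtains D where "D \<noteq> 0" "(theta_prod has_field_derivative D) (at 0)" "theta_prod 0 = 0"
proof -
  define S where "S = (\<lambda>u. euler_fun (nome * exp (2 * pi * \<i> * u)) * euler_fun (nome * exp (- (2 * pi * \<i> * u))))"
  have S_eq: "theta_prod = (\<lambda>u. (1 - exp (2 * pi * \<i> * u)) * S u)"
  proof
    fix u show "theta_prod u = (1 - exp (2 * pi * \<i> * u)) * S u"
      using euler_fun_rec[of "exp (2 * pi * \<i> * u)"] by (simp add: theta_prod_def S_def)
  qed
  have "S holomorphic_on UNIV" unfolding S_def by (intro holomorphic_intros)
  then have "(S has_field_derivative deriv S 0) (at 0)"
    using holomorphic_derivI open_UNIV UNIV_I by blast
  then have "((\<lambda>u. (1 - exp (2 * pi * \<i> * u)) * S u) has_field_derivative - (2 * pi * \<i>) * S 0) (at 0)"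
    by (auto intro!: derivative_eq_intros)
  moreover have "S 0 \<noteq> 0"
    using euler_fun_eq_0D[of nome] nome_power_neq_1 by (auto simp: S_def mult.commute)
  ultimately show thesis
    by (intro that[of "- (2 * pi * \<i>) * S 0"]) (auto simp: S_eq)
qed

lemma theta1_deriv: "(theta1 tau has_field_derivative deriv (theta1 tau) u) (at u)"
  using theta1_holomorphic_UNIV holomorphic_derivI open_UNIV UNIV_I by blast

lemma theta1_lattice:
  assumes "u \<in> lattice tau"
  shows "theta1 tau u = 0"
proof -
  define L where "L = (\<lambda>u. theta1 tau u = 0)"
  have "L (u + 1) = L u" "L (u + tau) = L u" for u
    by (simp_all add: L_def theta1_add_1 theta1_add_tau)
  then have "L (0 + u) = L 0" using assms by (rule periodic_lattice)
  then show ?thesis by (simp add: L_def)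
qed

text \<open>A form of the Jacobi triple product with an unspecified constant.\<close>
lemma theta1_eq_prod:
  obtains C where "C \<noteq> 0" "\<And>u. u \<notin> lattice tau \<Longrightarrow> exp (pi * \<i> * u) * theta1 tau u = C * theta_prod u"
    and "deriv (theta1 tau) 0 \<noteq> 0"
proof -
  define f where "f = (\<lambda>u. exp (pi * \<i> * u) * theta1 tau u / theta_prod u)"
  have "f meromorphic_on UNIV"
    unfolding f_def using theta_prod_holomorphic
    by (intro meromorphic_intros analytic_on_imp_meromorphic_on)
       (auto simp: analytic_on_open intro!: holomorphic_intros)
  have f1: "f (u + 1) = f u" for u
    by (simp add: f_def theta_prod_add_1 theta1_add_1 ring_distribs exp_add)
  have ftau: "f (u + tau) = f u" for u
  proof -
    have "exp (pi * \<i> * (u + tau)) * exp (- pi * \<i> * tau - 2 * pi * \<i> * u) = exp (pi * \<i> * u) * exp (- (2 * pi * \<i> * u))"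
      unfolding exp_add[symmetric] by (simp add: algebra_simps)
    then have "f (u + tau) = (exp (- (2 * pi * \<i> * u)) * (exp (pi * \<i> * u) * theta1 tau u)) /
        (exp (- (2 * pi * \<i> * u)) * theta_prod u)"
      by (simp add: f_def theta_prod_add_tau theta1_add_tau mult_ac)
    then show ?thesis by (simp add: f_def)
  qed
  obtain D where D: "D \<noteq> 0" "(theta_prod has_field_derivative D) (at 0)" "theta_prod 0 = 0"
    by (rule theta_prod_deriv_0)
  \<comment> \<open>Numerator and denominator both vanish at 0, the latter to first order, so a
    limit exists; by periodicity this settles all lattice points. The limit equals the constant
    \<open>C\<close>, so a nonzero \<open>C\<close> also makes the derivative of theta at 0
    nonzero.\<close>
  have lim0: "f \<midarrow>0\<rightarrow> deriv (theta1 tau) 0 / D"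
  proof -
    have "(\<lambda>u. theta_prod u / u) \<midarrow>0\<rightarrow> D" "(\<lambda>u. theta1 tau u / u) \<midarrow>0\<rightarrow> deriv (theta1 tau) 0"
      using D(2,3) theta1_deriv[of 0] by (simp_all add: has_field_derivative_iff)
    then have "(\<lambda>u. exp (pi * \<i> * u) * (theta1 tau u / u) / (theta_prod u / u)) \<midarrow>0\<rightarrow> exp (pi * \<i> * 0) * deriv (theta1 tau) 0 / D"
      by (intro tendsto_intros D)
    also have "?this \<longleftrightarrow> ?thesis"
      by (intro filterlim_cong) (auto simp: f_def eventually_at_filter)
    finally show ?thesis .
  qed
  have ana: "f analytic_on {z}" if "z \<notin> lattice tau" for z
    unfolding f_def using theta_prod_eq_0D[of z] that
    by (intro analytic_intros holomorphic_on_imp_analytic_at[OF theta_prod_holomorphic]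
          holomorphic_on_imp_analytic_at[OF theta1_holomorphic_UNIV]) auto
  have lims: "\<exists>w\<in>lattice tau. \<exists>c. f \<midarrow>z + w\<rightarrow> c" for z
    proof (cases "z \<in> lattice tau")
      case True
      then show ?thesis using lim0 by (intro bexI[of _ "- z"]) auto
    next
      case False
      then show ?thesis using analytic_at_imp_isCont[OF ana] by (intro bexI[of _ 0]) (auto simp: isCont_def)
    qed
  have ev: "\<forall>\<^sub>F u in at z. f (u + 1) = f u" "\<forall>\<^sub>F u in at z. f (u + tau) = 1 * f u + 0" for z
    by (simp_all add: f1 ftau)
  note ext = quasi_periodic_extension[OF \<open>f meromorphic_on UNIV\<close> ev _ lims]
  obtain C where C: "\<And>u. remove_sings f u = C"
    by (rule entire_norm_periodic_constant[OF ext(1)]) (use ext(2,3) in auto)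
  have eq: "exp (pi * \<i> * u) * theta1 tau u = C * theta_prod u" if "u \<notin> lattice tau" for u
    using C[of u] ana[OF that] theta_prod_eq_0D[of u] that by (auto simp: f_def field_simps)
  \<comment> \<open>With \<open>C = 0\<close> theta would vanish off the lattice, and on the lattice
    it vanishes in any case.\<close>
  have "C \<noteq> 0"
  proof
    assume "C = 0"
    with eq have zero: "theta1 tau u = 0" if "u \<notin> lattice tau" for u using that by simp
    have "theta1 tau u = 0" for u
      using zero theta1_lattice by (cases "u \<in> lattice tau") auto
    then show False using theta1_not_identically_0 by blast
  qed
  moreover have "deriv (theta1 tau) 0 \<noteq> 0"
    using remove_sings_eqI[OF lim0] C[of 0] \<open>C \<noteq> 0\<close> by auto
  ultimately show thesis using that eq by blast
qed

lemma theta1_eq_0_iff: "theta1 tau u = 0 \<longleftrightarrow> u \<in> lattice tau"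
proof
  assume "u \<in> lattice tau"
  then show "theta1 tau u = 0" by (rule theta1_lattice)
next
  assume "theta1 tau u = 0"
  then show "u \<in> lattice tau"
    using theta1_eq_prod theta_prod_eq_0D by (metis mult_eq_0_iff)
qed

lemma deriv_theta1_0_neq_0: "deriv (theta1 tau) 0 \<noteq> 0"
  using theta1_eq_prod by blast

end

section \<open>Principal parts and the residue theorem on the torus\<close>

text \<open>Derivatives of a simple pole with residue 1 are the building blocks of principal parts;
  the m-th one starts with (-1)^m m! x^(-m-1).\<close>

lemma fls_deriv_funpow_principal:
  fixes K :: "complex fls"
  assumes "\<And>k. k < -1 \<Longrightarrow> fls_nth K k = 0" and "fls_nth K (-1) = 1"
  shows "k < - int (Suc m) \<Longrightarrow> fls_nth ((fls_deriv ^^ m) K) k = 0"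
    and "fls_nth ((fls_deriv ^^ m) K) (- int (Suc m)) = (-1) ^ m * fact m"
proof (induction m arbitrary: k)
  case (Suc m)
  case 1
  then show ?case using Suc.IH(1)[of "k + 1"] by simp
next
  case (Suc m)
  case 2
  then show ?case using Suc.IH(2) by (simp add: algebra_simps)
qed (use assms in auto)

text \<open>Triangular elimination from the most negative exponent upwards: the N-th derivative of
  \<open>K\<close> removes the coefficient of pole order N + 1. Derivatives have no residue, so
  \<open>a 0\<close> is the residue of \<open>F\<close>.\<close>

lemma fls_principal_part:
  fixes F K :: "complex fls"
  assumes K: "\<And>k. k < -1 \<Longrightarrow> fls_nth K k = 0" "fls_nth K (-1) = 1"
    and F: "\<And>k. k < - int (Suc N) \<Longrightarrow> fls_nth F k = 0"
  shows "\<exists>a. (\<forall>k<0. fls_nth (F - (\<Sum>m\<le>N. fls_const (a m) * (fls_deriv ^^ m) K)) k = 0) \<and> a 0 = fls_nth F (-1)"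
  using F
proof (induction N arbitrary: F)
  case 0
  show ?case
  proof (intro exI[of _ "\<lambda>_. fls_nth F (-1)"] conjI allI impI)
    fix k :: int assume "k < 0"
    then consider "k = -1" | "k < -1" by linarith
    then show "fls_nth (F - (\<Sum>m\<le>0. fls_const (fls_nth F (-1)) * (fls_deriv ^^ m) K)) k = 0"
      using 0 K by cases simp_all
  qed simp
next
  case (Suc N)
  define D where "D = (fls_deriv ^^ Suc N) K"
  define b where "b = fls_nth F (- int (Suc (Suc N))) / ((-1) ^ Suc N * fact (Suc N))"
  define F1 where "F1 = F - fls_const b * D"
  have D: "\<And>k. k < - int (Suc (Suc N)) \<Longrightarrow> fls_nth D k = 0"
    "fls_nth D (- int (Suc (Suc N))) = (-1) ^ Suc N * fact (Suc N)"
    unfolding D_def using fls_deriv_funpow_principal[of K, OF K] by blast+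
  have "fls_nth F1 k = 0" if "k < - int (Suc N)" for k
  proof -
    from that consider "k = - int (Suc (Suc N))" | "k < - int (Suc (Suc N))" by linarith
    then show ?thesis
    proof cases
      case 1
      have "(-1) ^ Suc N * fact (Suc N) \<noteq> (0::complex)" by (simp del: fact_Suc)
      then show ?thesis using D(2) by (simp add: F1_def b_def 1 del: fact_Suc power_Suc of_nat_Suc)
    next
      case 2
      then show ?thesis using D(1)[OF 2] Suc.prems by (simp add: F1_def)
    qed
  qed
  from Suc.IH[OF this] obtain a where
    a: "\<And>k. k < 0 \<Longrightarrow> fls_nth (F1 - (\<Sum>m\<le>N. fls_const (a m) * (fls_deriv ^^ m) K)) k = 0" "a 0 = fls_nth F1 (-1)"
    by blast
  have "fls_nth F1 (-1) = fls_nth F (-1)"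
    by (simp add: F1_def D_def)
  moreover have "(\<Sum>m\<le>Suc N. fls_const ((a(Suc N := b)) m) * (fls_deriv ^^ m) K) =
      (\<Sum>m\<le>N. fls_const (a m) * (fls_deriv ^^ m) K) + fls_const b * D"
    by (simp add: D_def)
  ultimately show ?case
    using a by (intro exI[of _ "a(Suc N := b)"] conjI) (simp_all add: F1_def algebra_simps del: sum.atMost_Suc)
qed

lemma has_laurent_expansion_higher_deriv:
  assumes "f has_laurent_expansion F"
  shows "(deriv ^^ m) f has_laurent_expansion (fls_deriv ^^ m) F"
  by (induction m) (auto intro: has_laurent_expansion_deriv assms)

text \<open>Since \<open>K x * x\<close> has a finite limit, its Laurent series has no negative
  exponents, and its constant term is \<open>r\<close>.\<close>

lemma laurent_expansion_simple_pole:
  assumes K: "K has_laurent_expansion F" and lim: "(\<lambda>x. K x * x) \<midarrow>0\<rightarrow> r"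
  shows "k < -1 \<Longrightarrow> fls_nth F k = 0" and "fls_nth F (-1) = r"
proof -
  have F1: "(\<lambda>x. K x * x powi 1) has_laurent_expansion (fls_shift (-1) F)"
    by (intro laurent_expansion_intros K)
  have lim': "(\<lambda>x. K x * x powi 1) \<midarrow>0\<rightarrow> r" using lim by simp
  have "\<not> fls_subdegree (fls_shift (-1) F) < 0"
    using has_laurent_expansion_imp_filterlim_infinity_0[OF F1] lim'
      not_tendsto_and_filterlim_at_infinity trivial_limit_at by blast
  then have sub: "fls_subdegree (fls_shift (-1) F) \<ge> 0" by simp
  show "fls_nth F (-1) = r"
    using LIM_unique[OF has_laurent_expansion_imp_tendsto_0[OF F1 sub] lim'] by simp
  assume "k < -1"
  then have "fls_nth (fls_shift (-1) F) (k + 1) = 0"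
    using sub by (intro fls_eq0_below_subdegree) linarith
  then show "fls_nth F k = 0" by simp
qed

text \<open>The kernel \<open>K\<close> is left open: it will be \<open>rho tau\<close> for trivial
  multiplier and an s-function for a nontrivial one. The value of \<open>a 0\<close> is recorded for
  the residue theorem.\<close>

lemma meromorphic_principal_part:
  assumes f: "f meromorphic_on {z}" and K: "K meromorphic_on {0}" "(\<lambda>x. K x * x) \<midarrow>0\<rightarrow> 1"
  obtains N a c where "(\<lambda>u. f u - (\<Sum>m\<le>N. a m * (deriv ^^ m) K (u - z))) \<midarrow>z\<rightarrow> c" "a 0 = residue f z"
proof -
  obtain KF where KF: "K has_laurent_expansion KF"
    using K(1) meromorphic_on_imp_has_laurent_expansion[of K "{0}" 0] by auto
  obtain F where F: "(\<lambda>x. f (z + x)) has_laurent_expansion F"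
    using f meromorphic_on_imp_has_laurent_expansion[of f "{z}" z] by auto
  note K0 = laurent_expansion_simple_pole[OF KF K(2)]
  define N where "N = nat (- fls_subdegree F)"
  have "fls_nth F k = 0" if "k < - int (Suc N)" for k
    using that unfolding N_def by (intro fls_eq0_below_subdegree) linarith
  from fls_principal_part[OF K0 this] obtain a where
    a: "\<And>k. k < 0 \<Longrightarrow> fls_nth (F - (\<Sum>m\<le>N. fls_const (a m) * (fls_deriv ^^ m) KF)) k = 0" "a 0 = fls_nth F (-1)"
    by blast
  have a0: "a 0 = residue f z"
    using has_laurent_expansion_residue[OF F] by (simp add: a(2))
  have "(\<lambda>x. f (z + x) - (\<Sum>m\<le>N. a m * (deriv ^^ m) K x)) has_laurent_expansion
      F - (\<Sum>m\<le>N. fls_const (a m) * (fls_deriv ^^ m) KF)"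
    by (intro laurent_expansion_intros F has_laurent_expansion_higher_deriv KF)
  then have "(\<lambda>x. f (z + x) - (\<Sum>m\<le>N. a m * (deriv ^^ m) K (z + x - z))) has_laurent_expansion
      F - (\<Sum>m\<le>N. fls_const (a m) * (fls_deriv ^^ m) KF)"
    by simp
  from has_laurent_expansion_imp_tendsto[OF this fls_subdegree_ge0I[OF a(1)]]
  show thesis using a0 by (rule that)
qed

section \<open>Quasi-periodicity and poles of rho and s\<close>

context upper_half_plane
begin

lemma theta1_analytic [analytic_intros]:
  assumes "f analytic_on A" shows "(\<lambda>u. theta1 tau (f u)) analytic_on A"
proof -
  have "theta1 tau analytic_on UNIV"
    using theta1_holomorphic_UNIV by (simp add: analytic_on_open)
  then show ?thesis
    using analytic_on_compose_gen[OF assms, of "theta1 tau" UNIV] by (simp add: o_def)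
qed

lemma deriv_theta1_analytic [analytic_intros]:
  assumes "f analytic_on A" shows "(\<lambda>u. deriv (theta1 tau) (f u)) analytic_on A"
proof -
  have "deriv (theta1 tau) analytic_on UNIV"
    using theta1_holomorphic_UNIV by (simp add: analytic_on_open holomorphic_deriv)
  then show ?thesis
    using analytic_on_compose_gen[OF assms, of "deriv (theta1 tau)" UNIV] by (simp add: o_def)
qed

lemma rho_analytic [analytic_intros]:
  assumes "f analytic_on A" "\<And>z. z \<in> A \<Longrightarrow> f z \<notin> lattice tau"
  shows "(\<lambda>u. rho tau (f u)) analytic_on A"
  unfolding rho_def using assms by (intro analytic_intros) (auto simp: theta1_eq_0_iff)

lemma rho_meromorphic [meromorphic_intros]:
  assumes "f analytic_on A"
  shows "(\<lambda>u. rho tau (f u)) meromorphic_on A"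
  unfolding rho_def 
  by (rule meromorphic_on_divide; rule analytic_on_imp_meromorphic_on; intro analytic_intros assms)

lemma sfun_analytic [analytic_intros]:
  assumes "f analytic_on A" "\<And>z. z \<in> A \<Longrightarrow> f z \<notin> lattice tau"
  shows "(\<lambda>u. sfun tau (f u) \<mu>) analytic_on A"
proof (cases "theta1 tau (- \<mu>) = 0")
  case False
  then show ?thesis
    unfolding sfun_def using assms by (intro analytic_intros) (auto simp: theta1_eq_0_iff)
qed (simp add: sfun_def)

lemma sfun_meromorphic [meromorphic_intros]:
  assumes "f analytic_on A"
  shows "(\<lambda>u. sfun tau (f u) \<mu>) meromorphic_on A"
  unfolding sfun_def 
  by (rule meromorphic_on_divide; rule analytic_on_imp_meromorphic_on; intro analytic_intros assms)

text \<open>With the lattice seen as the zero set of theta, its discreteness is the isolation of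
  zeros of a holomorphic function that is not identically 0.\<close>

lemma eventually_not_lattice: "\<forall>\<^sub>F u in at z. u - a \<notin> lattice tau"
proof -
  obtain b where "theta1 tau b \<noteq> 0" using theta1_not_identically_0 by blast
  then have "\<forall>\<^sub>F u in at z. theta1 tau (u - a) \<noteq> 0 \<and> u \<in> UNIV"
    by (intro non_zero_neighbour_alt[where \<beta> = "b + a"] holomorphic_intros) auto
  then show ?thesis by (simp add: theta1_eq_0_iff)
qed

lemma closed_lattice: "closed (lattice tau)"
proof -
  have "closed {u. theta1 tau u = 0}"
    using holomorphic_on_imp_continuous_on[OF theta1_holomorphic_UNIV]
    by (intro closed_Collect_eq) auto
  then show ?thesis by (simp add: theta1_eq_0_iff)
qed

lemma deriv_theta1_add_1: "deriv (theta1 tau) (u + 1) = - deriv (theta1 tau) u"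
proof -
  have "((\<lambda>u. theta1 tau (u + 1)) has_field_derivative deriv (theta1 tau) (u + 1)) (at u)"
    using theta1_deriv[of "u + 1"] by (simp add: DERIV_shift)
  moreover have "((\<lambda>u. - theta1 tau u) has_field_derivative - deriv (theta1 tau) u) (at u)"
    by (intro derivative_intros theta1_deriv)
  ultimately show ?thesis by (simp add: theta1_add_1 DERIV_unique)
qed

lemma deriv_theta1_add_tau:
  "deriv (theta1 tau) (u + tau) = - exp (- pi * \<i> * tau - 2 * pi * \<i> * u) *
     (deriv (theta1 tau) u - 2 * pi * \<i> * theta1 tau u)"
proof -
  have "((\<lambda>u. theta1 tau (u + tau)) has_field_derivative deriv (theta1 tau) (u + tau)) (at u)"
    using theta1_deriv[of "u + tau"] by (simp add: DERIV_shift)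
  moreover have "((\<lambda>u. - exp (- pi * \<i> * tau - 2 * pi * \<i> * u) * theta1 tau u) has_field_derivative
      - exp (- pi * \<i> * tau - 2 * pi * \<i> * u) * (deriv (theta1 tau) u - 2 * pi * \<i> * theta1 tau u)) (at u)"
    by (auto intro!: derivative_eq_intros theta1_deriv simp: algebra_simps)
  ultimately show ?thesis unfolding theta1_add_tau by (rule DERIV_unique)
qed

lemma deriv_theta1_minus: "deriv (theta1 tau) (- u) = deriv (theta1 tau) u"
proof -
  have "((\<lambda>u. - theta1 tau (- u)) has_field_derivative - (deriv (theta1 tau) (- u) * - 1)) (at u)"
    by (rule DERIV_minus, rule DERIV_chain2[where g = uminus], rule theta1_deriv)
       (auto intro!: derivative_eq_intros)
  then have "(theta1 tau has_field_derivative deriv (theta1 tau) (- u)) (at u)" by simp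
  then show ?thesis using theta1_deriv DERIV_unique by blast
qed

lemma rho_add_1: "rho tau (u + 1) = rho tau u"
  by (simp add: rho_def theta1_add_1 deriv_theta1_add_1)

lemma rho_add_tau: "u \<notin> lattice tau \<Longrightarrow> rho tau (u + tau) = rho tau u - 2 * pi * \<i>"
  using theta1_eq_0_iff[of u]
  unfolding rho_def theta1_add_tau deriv_theta1_add_tau by (simp add: diff_divide_distrib)

text \<open>The exponential factors of numerator and denominator cancel up to exp (2 pi i (a - b)).
  Both s and the factor in the map \<open>\<S>\<close> are such quotients, up to constants.\<close>

lemma theta1_quotient_add_tau:
  "theta1 tau (u + tau - a) / theta1 tau (u + tau - b) = exp (2 * pi * \<i> * (a - b)) * (theta1 tau (u - a) / theta1 tau (u - b))"
proof -
  have shift: "theta1 tau (u + tau - x) = - exp (- pi * \<i> * tau - 2 * pi * \<i> * (u - x)) * theta1 tau (u - x)" for x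
    using theta1_add_tau[of "u - x"] by (simp add: algebra_simps)
  have "exp (- pi * \<i> * tau - 2 * pi * \<i> * (u - a)) = exp (2 * pi * \<i> * (a - b)) * exp (- pi * \<i> * tau - 2 * pi * \<i> * (u - b))"
    unfolding exp_add[symmetric] by (simp add: algebra_simps)
  then show ?thesis unfolding shift by simp
qed

lemma theta1_quotient_add_1:
  "theta1 tau (u + 1 - a) / theta1 tau (u + 1 - b) = theta1 tau (u - a) / theta1 tau (u - b)"
  using theta1_add_1[of "u - a"] theta1_add_1[of "u - b"] by (simp add: algebra_simps)

lemma sfun_eq_quotient:
  "sfun tau u \<mu> = theta1 tau (u - \<mu>) / theta1 tau (u - 0) * (deriv (theta1 tau) 0 / theta1 tau (- \<mu>))"
  by (simp add: sfun_def)

lemma sfun_add_1: "sfun tau (u + 1) \<mu> = sfun tau u \<mu>"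
  unfolding sfun_eq_quotient theta1_quotient_add_1 ..

lemma sfun_add_tau: "sfun tau (u + tau) \<mu> = exp (2 * pi * \<i> * \<mu>) * sfun tau u \<mu>"
  unfolding sfun_eq_quotient theta1_quotient_add_tau by simp

text \<open>Common source of the normalised simple poles of rho and s at 0.\<close>

lemma tendsto_div_theta1_mult:
  assumes "A analytic_on {0}" "A 0 = deriv (theta1 tau) 0"
  shows "(\<lambda>x. A x / theta1 tau x * x) \<midarrow>0\<rightarrow> 1"
proof -
  have "(\<lambda>u. theta1 tau u / u) \<midarrow>0\<rightarrow> deriv (theta1 tau) 0"
    using theta1_deriv[of 0] by (simp add: has_field_derivative_iff)
  moreover have "A \<midarrow>0\<rightarrow> deriv (theta1 tau) 0"
    using analytic_at_imp_isCont[OF assms(1)] assms(2) by (simp add: isCont_def)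
  ultimately have "(\<lambda>x. A x / (theta1 tau x / x)) \<midarrow>0\<rightarrow> deriv (theta1 tau) 0 / deriv (theta1 tau) 0"
    by (intro tendsto_intros deriv_theta1_0_neq_0)
  then show ?thesis using deriv_theta1_0_neq_0 by simp
qed

lemma tendsto_rho_mult: "(\<lambda>x. rho tau x * x) \<midarrow>0\<rightarrow> 1"
  unfolding rho_def by (intro tendsto_div_theta1_mult analytic_intros) auto

lemma tendsto_sfun_mult:
  assumes "\<mu> \<notin> lattice tau"
  shows "(\<lambda>x. sfun tau x \<mu> * x) \<midarrow>0\<rightarrow> 1"
proof -
  have \<mu>: "theta1 tau \<mu> \<noteq> 0" using assms by (simp add: theta1_eq_0_iff)
  define A where "A = (\<lambda>x. theta1 tau (x - \<mu>) * deriv (theta1 tau) 0 / theta1 tau (- \<mu>))"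
  have "A analytic_on {0}" "A 0 = deriv (theta1 tau) 0"
    unfolding A_def using \<mu> by (auto intro!: analytic_intros)
  from tendsto_div_theta1_mult[OF this] show ?thesis
    by (simp add: A_def sfun_def mult_ac)
qed

text \<open>Differentiation keeps the factor \<open>\<kappa>\<close> and kills the additive constant
  \<open>d\<close>.\<close>

lemma higher_deriv_quasi_periodic:
  assumes K: "K holomorphic_on - lattice tau"
    and w: "w \<in> lattice tau" and eq: "\<And>u. u \<notin> lattice tau \<Longrightarrow> K (u + w) = \<kappa> * K u + d"
    and u: "u \<notin> lattice tau"
  shows "(deriv ^^ m) K (u + w) = \<kappa> * (deriv ^^ m) K u + (if m = 0 then d else 0)"
  using u
proof (induction m arbitrary: u)
  case 0
  then show ?case using eq by simp
next
  case (Suc m)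
  define D where "D = (deriv ^^ m) K"
  define e where "e = (if m = 0 then d else 0)"
  have op: "open (- lattice tau)" using closed_lattice by (simp add: open_Compl)
  have D: "D holomorphic_on - lattice tau"
    unfolding D_def by (intro holomorphic_intros K op)
  have uw: "u + w \<notin> lattice tau"
    using Suc.prems w lattice_diff[of "u + w" tau w] by auto
  have "((\<lambda>u. D (u + w)) has_field_derivative deriv D (u + w)) (at u)"
    using holomorphic_derivI[OF D op, of "u + w" UNIV] uw by (simp add: DERIV_shift)
  moreover have "((\<lambda>u. \<kappa> * D u + e) has_field_derivative \<kappa> * deriv D u) (at u)"
    using holomorphic_derivI[OF D op] Suc.prems by (auto intro!: derivative_eq_intros)
  then have "((\<lambda>u. D (u + w)) has_field_derivative \<kappa> * deriv D u) (at u)"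
    by (rule has_field_derivative_transform_within_open[OF _ op])
       (use Suc.IH Suc.prems in \<open>auto simp: D_def e_def\<close>)
  ultimately have "deriv D (u + w) = \<kappa> * deriv D u" by (rule DERIV_unique)
  then show ?case by (simp add: D_def)
qed

end

section \<open>Sections on the torus with marked points\<close>

locale marked_torus = upper_half_plane +
  fixes t :: "nat \<Rightarrow> complex" and n :: nat
  assumes t_incong: "\<And>i j. i \<in> {1..n} \<Longrightarrow> j \<in> {1..n} \<Longrightarrow> i \<noteq> j \<Longrightarrow> t i - t j \<notin> lattice tau"
begin

lemma pole_set_iff: "u \<in> pole_set tau t n \<longleftrightarrow> (\<exists>j\<in>{1..n}. u - t j \<in> lattice tau)"
proof
  assume "\<exists>j\<in>{1..n}. u - t j \<in> lattice tau"
  then obtain j where "j \<in> {1..n}" "u - t j \<in> lattice tau" by blast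
  moreover have "u = t j + (u - t j)" by simp
  ultimately show "u \<in> pole_set tau t n" unfolding pole_set_def by blast
next
  assume "u \<in> pole_set tau t n"
  then obtain j w where "u = t j + w" "j \<in> {1..n}" "w \<in> lattice tau" unfolding pole_set_def by blast
  then show "\<exists>j\<in>{1..n}. u - t j \<in> lattice tau" by (intro bexI[of _ j]) auto
qed

lemma not_poleD: "u \<notin> pole_set tau t n \<Longrightarrow> j \<in> {1..n} \<Longrightarrow> u - t j \<notin> lattice tau"
  by (auto simp: pole_set_iff)

lemma pole_set_shift:
  assumes "w \<in> lattice tau"
  shows "u + w \<in> pole_set tau t n \<longleftrightarrow> u \<in> pole_set tau t n"
proof -
  have "u + w - t j \<in> lattice tau \<longleftrightarrow> u - t j \<in> lattice tau" for j
    using lattice_add[of "u - t j" tau w] lattice_diff[of "u + w - t j" tau w] assms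
    by (auto simp: algebra_simps)
  then show ?thesis by (simp add: pole_set_iff)
qed

lemma eventually_not_pole: "\<forall>\<^sub>F u in at z. u \<notin> pole_set tau t n"
  unfolding pole_set_iff by (simp add: eventually_ball_finite_distrib eventually_not_lattice)

lemma closed_pole_set: "closed (pole_set tau t n)"
proof -
  have "pole_set tau t n = (\<Union>j\<in>{1..n}. (+) (t j) ` lattice tau)"
    unfolding pole_set_def by blast
  then show ?thesis by (auto intro!: closed_UN closed_translation closed_lattice)
qed

lemma open_not_pole: "open (- pole_set tau t n)"
  using closed_pole_set by (simp add: open_Compl)

lemma holomorphic_imp_analytic_off_poles:
  "f holomorphic_on - pole_set tau t n \<Longrightarrow> u \<notin> pole_set tau t n \<Longrightarrow> f analytic_on {u}"
  using open_not_pole analytic_at by blast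

text \<open>Supplies the limit hypothesis of \<open>quasi_periodic_extension\<close>: every point
  either is regular or is a translate of some \<open>t j\<close>.\<close>

lemma limit_at_lattice_translate:
  assumes f: "f holomorphic_on - pole_set tau t n"
    and lim: "\<And>j. j \<in> {1..n} \<Longrightarrow> \<exists>c. f \<midarrow>t j\<rightarrow> c"
  shows "\<exists>w\<in>lattice tau. \<exists>c. f \<midarrow>z + w\<rightarrow> c"
proof (cases "z \<in> pole_set tau t n")
  case True
  then obtain j where "j \<in> {1..n}" "z - t j \<in> lattice tau" by (auto simp: pole_set_iff)
  then show ?thesis
    using lim[of j] lattice_uminus[of "z - t j" tau] by (intro bexI[of _ "t j - z"]) auto
next
  case False
  then show ?thesis
    using analytic_at_imp_isCont[OF holomorphic_imp_analytic_off_poles[OF f False]]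
    by (intro bexI[of _ 0]) (auto simp: isCont_def)
qed

lemma t_not_lattice: "i \<in> {1..n} \<Longrightarrow> j \<in> {1..n} \<Longrightarrow> t i - t j \<in> lattice tau \<longleftrightarrow> i = j"
  using t_incong by auto

text \<open>The pole set is discrete, so absence of essential singularities on it amounts to being
  meromorphic. This gives access to the closure properties of meromorphic functions.\<close>

lemma merom_sections_iff:
  "f \<in> merom_sections tau t n \<mu> \<longleftrightarrow> f holomorphic_on - pole_set tau t n \<and> f meromorphic_on UNIV \<and>
     (\<forall>u. u \<notin> pole_set tau t n \<longrightarrow> f (u + 1) = f u \<and> f (u + tau) = exp (2 * pi * \<i> * \<mu>) * f u)"
proof -
  have "f meromorphic_on UNIV \<longleftrightarrow> (\<forall>z\<in>pole_set tau t n. not_essential f z)"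
    if hol: "f holomorphic_on - pole_set tau t n"
  proof
    assume "f meromorphic_on UNIV"
    then show "\<forall>z\<in>pole_set tau t n. not_essential f z" by (simp add: meromorphic_on_altdef)
  next
    assume ess: "\<forall>z\<in>pole_set tau t n. not_essential f z"
    show "f meromorphic_on UNIV"
    proof (rule meromorphic_onI_open[where pts = "pole_set tau t n"])
      show "f analytic_on UNIV - pole_set tau t n"
        using hol open_not_pole by (simp add: analytic_on_open Compl_eq_Diff_UNIV)
      show "\<not> z islimpt pole_set tau t n \<inter> UNIV" for z
        using eventually_not_pole[of z] by (simp add: islimpt_iff_eventually)
    qed (use ess in auto)
  qed
  then show ?thesis by (auto simp: merom_sections_def)
qed

text \<open>Ansatz for a global function with prescribed principal parts at the marked points, meant
  for a kernel \<open>K\<close> with simple poles at the lattice points.\<close>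

definition principal_sum :: "(complex \<Rightarrow> complex) \<Rightarrow> (nat \<Rightarrow> nat) \<Rightarrow> (nat \<Rightarrow> nat \<Rightarrow> complex) \<Rightarrow> complex \<Rightarrow> complex" where
  "principal_sum K N a u = (\<Sum>j=1..n. \<Sum>m\<le>N j. a j m * (deriv ^^ m) K (u - t j))"

context
  fixes K :: "complex \<Rightarrow> complex"
  assumes K_hol: "K holomorphic_on - lattice tau" and K_mero: "K meromorphic_on UNIV"
begin

lemma K_higher_deriv_analytic:
  assumes "u - t j \<notin> lattice tau"
  shows "(\<lambda>u. (deriv ^^ m) K (u - t j)) analytic_on {u}"
proof -
  have "(deriv ^^ m) K analytic_on - lattice tau"
    using K_hol closed_lattice by (intro analytic_intros) (simp add: analytic_on_open open_Compl)
  moreover have "(\<lambda>u. u - t j) analytic_on {u}" by (intro analytic_intros)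
  ultimately show ?thesis
    using analytic_on_compose_gen[of "\<lambda>u. u - t j" "{u}" "(deriv ^^ m) K" "- lattice tau"] assms
    unfolding o_def by blast
qed

lemma principal_sum_holomorphic: "principal_sum K N a holomorphic_on - pole_set tau t n"
proof -
  have "principal_sum K N a analytic_on {u}" if "u \<notin> pole_set tau t n" for u
    unfolding principal_sum_def [abs_def] using not_poleD[OF that]
    by (intro analytic_intros K_higher_deriv_analytic) auto
  then show ?thesis
    by (meson ComplD analytic_imp_holomorphic analytic_on_analytic_at)
qed

lemma principal_sum_meromorphic: "principal_sum K N a meromorphic_on UNIV"
  unfolding principal_sum_def [abs_def]
  by (intro meromorphic_on_sum meromorphic_on_mult meromorphic_on_const
        meromorphic_on_compose[OF meromorphic_on_higher_deriv[OF K_mero]] analytic_intros) auto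

text \<open>The additive constant \<open>d\<close> reaches only the terms with m = 0, whose
  coefficients are the residues.\<close>

lemma principal_sum_quasi_periodic:
  assumes "w \<in> lattice tau" "\<And>u. u \<notin> lattice tau \<Longrightarrow> K (u + w) = \<kappa> * K u + d"
    and "u \<notin> pole_set tau t n"
  shows "principal_sum K N a (u + w) = \<kappa> * principal_sum K N a u + d * (\<Sum>j=1..n. a j 0)"
proof -
  have "(\<Sum>m\<le>N j. a j m * (deriv ^^ m) K (u + w - t j)) =
      \<kappa> * (\<Sum>m\<le>N j. a j m * (deriv ^^ m) K (u - t j)) + d * a j 0" if "j \<in> {1..n}" for j
  proof -
    have "(deriv ^^ m) K (u + w - t j) = \<kappa> * (deriv ^^ m) K (u - t j) + (if m = 0 then d else 0)" for m
      using higher_deriv_quasi_periodic[OF K_hol assms(1,2) not_poleD[OF assms(3) that]]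
      by (simp add: algebra_simps)
    then have "(\<Sum>m\<le>N j. a j m * (deriv ^^ m) K (u + w - t j)) =
        (\<Sum>m\<le>N j. \<kappa> * (a j m * (deriv ^^ m) K (u - t j)) + (if m = 0 then d * a j 0 else 0))"
      by (intro sum.cong) (auto simp: algebra_simps)
    then show ?thesis by (simp add: sum.distrib sum_distrib_left)
  qed
  then show ?thesis
    by (simp add: principal_sum_def sum.distrib sum_distrib_left)
qed

text \<open>At \<open>t j\<close> only the j-th inner sum is singular; the others are analytic there
  because the marked points are incongruent.\<close>

lemma principal_sum_exists:
  assumes K1: "(\<lambda>x. K x * x) \<midarrow>0\<rightarrow> 1" and f: "\<And>j. j \<in> {1..n} \<Longrightarrow> f j meromorphic_on {t j}"
  obtains N a where
    "\<And>j. j \<in> {1..n} \<Longrightarrow> \<exists>c. (\<lambda>u. f j u - principal_sum K N a u) \<midarrow>t j\<rightarrow> c"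
    "\<And>j. j \<in> {1..n} \<Longrightarrow> a j 0 = residue (f j) (t j)"
proof -
  have "\<exists>N a. (\<exists>c. (\<lambda>u. f j u - (\<Sum>m\<le>N. a m * (deriv ^^ m) K (u - t j))) \<midarrow>t j\<rightarrow> c) \<and>
      a 0 = residue (f j) (t j)" if "j \<in> {1..n}" for j
    by (rule meromorphic_principal_part[OF f[OF that] meromorphic_on_subset[OF K_mero] K1]) auto
  then have "\<forall>j\<in>{1..n}. \<exists>N a. (\<exists>c. (\<lambda>u. f j u - (\<Sum>m\<le>N. a m * (deriv ^^ m) K (u - t j))) \<midarrow>t j\<rightarrow> c) \<and>
      a 0 = residue (f j) (t j)" by blast
  then have "\<exists>N a. \<forall>j\<in>{1..n}. (\<exists>c. (\<lambda>u. f j u - (\<Sum>m\<le>N j. a j m * (deriv ^^ m) K (u - t j))) \<midarrow>t j\<rightarrow> c) \<and>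
      a j 0 = residue (f j) (t j)"
    by (simp only: bchoice_iff)
  then obtain N a where Na: "\<And>j. j \<in> {1..n} \<Longrightarrow>
      \<exists>c. (\<lambda>u. f j u - (\<Sum>m\<le>N j. a j m * (deriv ^^ m) K (u - t j))) \<midarrow>t j\<rightarrow> c"
      "\<And>j. j \<in> {1..n} \<Longrightarrow> a j 0 = residue (f j) (t j)"
    by blast
  have "\<exists>c. (\<lambda>u. f j u - principal_sum K N a u) \<midarrow>t j\<rightarrow> c" if j: "j \<in> {1..n}" for j
  proof -
    obtain c where c: "(\<lambda>u. f j u - (\<Sum>m\<le>N j. a j m * (deriv ^^ m) K (u - t j))) \<midarrow>t j\<rightarrow> c"
      using Na(1)[OF j] by blast
    define R where "R = (\<lambda>u. \<Sum>l\<in>{1..n} - {j}. \<Sum>m\<le>N l. a l m * (deriv ^^ m) K (u - t l))"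
    have "R analytic_on {t j}"
      unfolding R_def using j
      by (intro analytic_intros K_higher_deriv_analytic) (auto simp: t_not_lattice)
    then have "R \<midarrow>t j\<rightarrow> R (t j)" using analytic_at_imp_isCont by (simp add: isCont_def)
    from tendsto_diff[OF c this]
    have "(\<lambda>u. f j u - (\<Sum>m\<le>N j. a j m * (deriv ^^ m) K (u - t j)) - R u) \<midarrow>t j\<rightarrow> c - R (t j)" .
    moreover have "principal_sum K N a u = (\<Sum>m\<le>N j. a j m * (deriv ^^ m) K (u - t j)) + R u" for u
      unfolding principal_sum_def R_def using j by (intro sum.remove) auto
    ultimately show ?thesis by (auto simp: diff_diff_eq)
  qed
  with Na(2) show thesis using that by blast
qed

end

text \<open>Removing the principal parts by derivatives of rho leaves an entire \<open>H\<close> of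
  period 1 with H (u + tau) = H u + d, where \<open>d\<close> is 2 pi i times the sum of the
  residues. The derivative of \<open>H\<close> is entire and elliptic, hence constant; period 1
  makes this constant 0, and then \<open>d\<close> is 0.\<close>

lemma sum_residues_eq_0:
  assumes E: "E \<in> merom_sections tau t n 0"
  shows "(\<Sum>j=1..n. residue E (t j)) = 0"
proof -
  have E': "E holomorphic_on - pole_set tau t n" "E meromorphic_on UNIV"
    "\<And>u. u \<notin> pole_set tau t n \<Longrightarrow> E (u + 1) = E u" "\<And>u. u \<notin> pole_set tau t n \<Longrightarrow> E (u + tau) = E u"
    using E by (auto simp: merom_sections_iff)
  have rho_hol: "rho tau holomorphic_on - lattice tau"
    using rho_analytic[of "\<lambda>u. u" "- lattice tau"] by (simp add: analytic_imp_holomorphic)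
  have rho_mero: "rho tau meromorphic_on UNIV"
    using rho_meromorphic[of "\<lambda>u. u" UNIV] by simp
  note G_facts = rho_hol rho_mero
  obtain N a where Na: "\<And>j. j \<in> {1..n} \<Longrightarrow> \<exists>c. (\<lambda>u. E u - principal_sum (rho tau) N a u) \<midarrow>t j\<rightarrow> c"
    "\<And>j. j \<in> {1..n} \<Longrightarrow> a j 0 = residue E (t j)"
    by (rule principal_sum_exists[OF G_facts tendsto_rho_mult, of "\<lambda>_. E"])
       (use E'(2) meromorphic_on_subset in blast)+
  define h where "h = (\<lambda>u. E u - principal_sum (rho tau) N a u)"
  define d where "d = 2 * pi * \<i> * (\<Sum>j=1..n. residue E (t j))"
  have h1: "h (u + 1) = h u" if "u \<notin> pole_set tau t n" for u
    using principal_sum_quasi_periodic[OF G_facts, of 1 1 0 u N a] that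
    by (simp add: h_def E' rho_add_1)
  have htau: "h (u + tau) = 1 * h u + d" if "u \<notin> pole_set tau t n" for u
    using principal_sum_quasi_periodic[OF G_facts, of tau 1 "- (2 * pi * \<i>)" u N a] that
    by (simp add: h_def E' rho_add_tau d_def Na(2))
  have mero: "h meromorphic_on UNIV"
    unfolding h_def by (intro meromorphic_intros E' principal_sum_meromorphic G_facts)
  have hol: "h holomorphic_on - pole_set tau t n"
    unfolding h_def by (intro holomorphic_intros E' principal_sum_holomorphic G_facts)
  note lims = limit_at_lattice_translate[OF hol Na(1)[folded h_def]]
  have ev: "\<forall>\<^sub>F u in at z. h (u + 1) = h u" "\<forall>\<^sub>F u in at z. h (u + tau) = 1 * h u + d" for z
    using eventually_not_pole[of z] by (auto elim!: eventually_mono simp: h1 htau)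
  define H where "H = remove_sings h"
  have H: "H holomorphic_on UNIV" "\<And>u. H (u + 1) = H u" "\<And>u. H (u + tau) = H u + d"
    using quasi_periodic_extension[OF mero ev _ lims] by (simp_all add: H_def)
  have H': "(H has_field_derivative deriv H u) (at u)" for u
    using H(1) holomorphic_derivI open_UNIV UNIV_I by blast
  have "deriv H (u + 1) = deriv H u" for u
    using DERIV_unique[OF _ H'[of u]] H'[of "u + 1"] H(2) by (simp add: DERIV_shift)
  moreover have "deriv H (u + tau) = deriv H u" for u
  proof -
    have "((\<lambda>u. H u + d) has_field_derivative deriv H u) (at u)"
      using H'[of u] by (auto intro!: derivative_eq_intros)
    then show ?thesis using H'[of "u + tau"] H(3) DERIV_unique by (simp add: DERIV_shift)
  qed
  moreover have "deriv H holomorphic_on UNIV" using H(1) by (intro holomorphic_intros) auto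
  ultimately obtain \<alpha> where \<alpha>: "\<And>u. deriv H u = \<alpha>"
    using entire_norm_periodic_constant by metis
  have "((\<lambda>u. H u - \<alpha> * u) has_field_derivative 0) (at u)" for u
    using H'[of u] by (auto intro!: derivative_eq_intros simp: \<alpha>)
  then obtain b where b: "\<And>u. H u - \<alpha> * u = b"
    using has_field_derivative_zero_constant[of UNIV "\<lambda>u. H u - \<alpha> * u"] by auto
  have "\<alpha> = 0" using b[of 0] b[of 1] H(2)[of 0] by simp
  then have "d = 0" using b[of 0] b[of tau] H(3)[of 0] by simp
  then show ?thesis by (simp add: d_def)
qed

text \<open>With its singularities removed the section is entire with a nontrivial multiplier, so
  \<open>entire_multiplier_eq_0\<close> applies.\<close>

lemma section_eq_0:
  assumes X: "X \<in> merom_sections tau t n \<mu>" and \<mu>: "\<mu> \<notin> lattice tau"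
    and lim: "\<And>j. j \<in> {1..n} \<Longrightarrow> \<exists>c. X \<midarrow>t j\<rightarrow> c" and u: "u \<notin> pole_set tau t n"
  shows "X u = 0"
proof -
  have X': "X holomorphic_on - pole_set tau t n" "X meromorphic_on UNIV"
    "\<And>u. u \<notin> pole_set tau t n \<Longrightarrow> X (u + 1) = X u"
    "\<And>u. u \<notin> pole_set tau t n \<Longrightarrow> X (u + tau) = exp (2 * pi * \<i> * \<mu>) * X u"
    using X by (auto simp: merom_sections_iff)
  note lims = limit_at_lattice_translate[OF X'(1) lim]
  have ev: "\<forall>\<^sub>F u in at z. X (u + 1) = X u" "\<forall>\<^sub>F u in at z. X (u + tau) = exp (2 * pi * \<i> * \<mu>) * X u + 0" for z
    using eventually_not_pole[of z] by (auto elim!: eventually_mono simp: X')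
  have "remove_sings X u = 0"
    using quasi_periodic_extension[OF X'(2) ev _ lims]
    by (intro entire_multiplier_eq_0[OF _ _ _ \<mu>]) auto
  then show ?thesis
    using holomorphic_imp_analytic_off_poles[OF X'(1) u] by simp
qed

end

section \<open>Local solutions\<close>

text \<open>Comparing power series gives b_m = a_m / (m + c). The denominators are nonzero by
  hypothesis and of norm at least 1 for large m, so the series for \<open>k\<close> converges
  wherever that for \<open>\<psi>\<close> does.\<close>

lemma euler_equation_solution:
  assumes \<psi>: "\<psi> holomorphic_on ball 0 r" and c: "\<And>m. c \<noteq> - of_nat m"
  obtains k where "k holomorphic_on ball 0 r" "\<And>x. x \<in> ball 0 r \<Longrightarrow> x * deriv k x + c * k x = \<psi> x"
proof -
  define a where "a = (\<lambda>m. (deriv ^^ m) \<psi> 0 / fact m)"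
  have a: "(\<lambda>m. a m * x ^ m) sums \<psi> x" if "norm x < r" for x
    using holomorphic_power_series[OF \<psi>, of x] that by (simp add: a_def)
  define b where "b = (\<lambda>m. a m / (of_nat m + c))"
  define k where "k = (\<lambda>x. \<Sum>m. b m * x ^ m)"
  have b: "(\<lambda>m. b m * x ^ m) sums k x" if x: "norm x < r" for x
    unfolding k_def
  proof (rule summable_sums, rule summable_comparison_test_ev)
    obtain y where y: "norm x < y" "y < r" using x dense by blast
    have "0 \<le> y" using y(1) norm_ge_zero[of x] by linarith
    then have "summable (\<lambda>m. a m * (of_real y) ^ m)" "norm x < norm (of_real y :: complex)"
      using a[of "of_real y"] y by (auto simp: sums_iff)
    then show "summable (\<lambda>m. norm (a m * x ^ m))" by (rule powser_insidea)
    show "\<forall>\<^sub>F m in sequentially. norm (b m * x ^ m) \<le> norm (a m * x ^ m)"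
    proof (rule eventually_sequentiallyI)
      fix m assume m: "m \<ge> nat \<lceil>norm c + 1\<rceil>"
      then have "real m - norm c \<ge> 1" by linarith
      moreover have "norm (of_nat m + c) \<ge> real m - norm c"
        using norm_diff_ineq[of "of_nat m" c] by simp
      ultimately have "norm (of_nat m + c) \<ge> 1" by linarith
      then have "norm (b m) \<le> norm (a m)"
        by (simp add: b_def norm_divide divide_le_eq mult_le_cancel_left1)
      then show "norm (b m * x ^ m) \<le> norm (a m * x ^ m)"
        by (simp add: norm_mult mult_right_mono)
    qed
  qed
  have k: "k holomorphic_on ball 0 r"
    by (rule power_series_holomorphic[where a = b]) (use b in auto)
  moreover have "x * deriv k x + c * k x = \<psi> x" if "x \<in> ball 0 r" for x
  proof -
    have x: "norm x < r" using that by simp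
    have "(\<lambda>m. diffs b m * x ^ m) sums deriv k x"
      by (rule termdiffs_sums_strong[OF b _ x]) (use holomorphic_derivI[OF k _ that] in auto)
    from sums_mult[OF this, of x] have "(\<lambda>m. of_nat (Suc m) * b (Suc m) * x ^ Suc m) sums (x * deriv k x)"
      by (simp add: diffs_def mult_ac)
    then have "(\<lambda>m. of_nat m * b m * x ^ m) sums (x * deriv k x)"
      by (subst (asm) sums_Suc_iff) simp
    from sums_add[OF this sums_mult[OF b[OF x], of c]]
    have "(\<lambda>m. of_nat m * b m * x ^ m + c * (b m * x ^ m)) sums (x * deriv k x + c * k x)" .
    also have "(\<lambda>m. of_nat m * b m * x ^ m + c * (b m * x ^ m)) = (\<lambda>m. a m * x ^ m)"
    proof
      fix m
      have "of_nat m + c \<noteq> 0" using c[of m] by (metis add.commute eq_neg_iff_add_eq_0)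
      then have "(of_nat m + c) * b m = a m" by (simp add: b_def)
      then show "of_nat m * b m * x ^ m + c * (b m * x ^ m) = a m * x ^ m"
        by (metis (no_types, lifting) distrib_right mult.assoc)
    qed
    finally show ?thesis using a[OF x] sums_unique2 by blast
  qed
  ultimately show thesis by (rule that)
qed

lemma meromorphic_times_power_analytic:
  assumes "f meromorphic_on {z}"
  obtains N \<Phi> where "\<Phi> analytic_on {z}" "\<forall>\<^sub>F u in at z. f u = \<Phi> u / (u - z) ^ N"
proof -
  obtain F where F: "(\<lambda>x. f (z + x)) has_laurent_expansion F"
    using assms meromorphic_on_imp_has_laurent_expansion[of f "{z}" z] by auto
  define N where "N = nat (- fls_subdegree F)"
  define g where "g = (\<lambda>u. f u * (u - z) ^ N)"
  have "(\<lambda>x. f (z + x) * x powi int N) has_laurent_expansion fls_shift (- int N) F"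
    by (intro laurent_expansion_intros F)
  then have "(\<lambda>x. g (z + x)) has_laurent_expansion fls_shift (- int N) F"
    by (simp add: g_def)
  moreover have "fls_subdegree (fls_shift (- int N) F) \<ge> 0"
    by (cases "F = 0") (auto simp: N_def)
  ultimately have "g \<midarrow>z\<rightarrow> fls_nth (fls_shift (- int N) F) 0"
    by (rule has_laurent_expansion_imp_tendsto)
  moreover have iso: "isolated_singularity_at g z"
    using \<open>(\<lambda>x. g (z + x)) has_laurent_expansion _\<close> has_laurent_expansion_isolated by blast
  ultimately have "remove_sings g analytic_on {z}" by (intro remove_sings_analytic_at)
  moreover have "\<forall>\<^sub>F u in at z. f u = remove_sings g u / (u - z) ^ N"
    using eventually_remove_sings_eq_at[OF iso] eventually_neq_at_within[of z]
    by eventually_elim (simp add: g_def)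
  ultimately show thesis by (rule that)
qed

text \<open>Integrating factor: with \<open>H\<close> a primitive of the regular part
  \<open>h\<close>, the ansatz f = k (u - z) exp (- H u) / (u - z)^N reduces the equation to an
  Euler equation with parameter c - N. As \<open>c\<close> is not an integer, this parameter avoids
  0, -1, -2 and so on.\<close>

lemma local_solution_exists:
  assumes \<phi>: "\<phi> meromorphic_on {z}" and h: "h analytic_on {z}"
    and \<omega>: "\<forall>\<^sub>F u in at z. \<omega> u = c / (u - z) + h u" and c: "c \<notin> \<int>"
  obtains f where "f meromorphic_on {z}" "\<forall>\<^sub>F u in at z. deriv f u + f u * \<omega> u = \<phi> u"
proof -
  obtain N \<Phi> where \<Phi>: "\<Phi> analytic_on {z}" "\<forall>\<^sub>F u in at z. \<phi> u = \<Phi> u / (u - z) ^ N"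
    using \<phi> by (rule meromorphic_times_power_analytic)
  obtain r1 where r1: "r1 > 0" "\<Phi> holomorphic_on ball z r1"
    using \<Phi>(1) by (auto simp: analytic_on_def)
  obtain r2 where r2: "r2 > 0" "h holomorphic_on ball z r2"
    using h by (auto simp: analytic_on_def)
  define r where "r = min r1 r2"
  have r: "r > 0" using r1 r2 by (simp add: r_def)
  have \<Phi>_hol: "\<Phi> holomorphic_on ball z r" and h_hol: "h holomorphic_on ball z r"
    using r1 r2 holomorphic_on_subset by (auto simp: r_def)
  obtain H where H: "\<And>u. u \<in> ball z r \<Longrightarrow> (H has_field_derivative h u) (at u within ball z r)"
    using holomorphic_convex_primitive'[OF convex_ball open_ball h_hol] by blast
  then have H': "(H has_field_derivative h u) (at u)" if "u \<in> ball z r" for u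
    using that by (simp add: at_within_open[of _ "ball z r"])
  have H_hol: "H holomorphic_on ball z r"
    using H' by (meson holomorphic_on_open open_ball)
  \<comment> \<open>The right-hand side \<open>\<phi>\<close>, written in x = u - z, after
    multiplication by exp H and by x^(N + 1).\<close>
  define \<psi> where "\<psi> = (\<lambda>x. exp (H (z + x)) * (\<Phi> (z + x) * x))"
  have shift: "(\<lambda>x. g (z + x)) holomorphic_on ball 0 r" if "g holomorphic_on ball z r" for g
  proof -
    have "(\<lambda>x. z + x) holomorphic_on ball 0 r" by (intro holomorphic_intros)
    from holomorphic_on_compose_gen[OF this that] show ?thesis by (auto simp: o_def dist_norm)
  qed
  have "\<psi> holomorphic_on ball 0 r"
    unfolding \<psi>_def by (intro holomorphic_intros shift H_hol \<Phi>_hol)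
  moreover have "c - of_nat N \<noteq> - of_nat m" for m
  proof
    assume "c - of_nat N = - of_nat m"
    then have "c = of_int (int N - int m)" by (simp add: algebra_simps)
    then show False using c by (metis Ints_of_int)
  qed
  ultimately obtain k where k: "k holomorphic_on ball 0 r"
    "\<And>x. x \<in> ball 0 r \<Longrightarrow> x * deriv k x + (c - of_nat N) * k x = \<psi> x"
    using euler_equation_solution[of \<psi> r "c - of_nat N"] by blast
  define k1 where "k1 = (\<lambda>u. k (u - z) * exp (- H u))"
  define f where "f = (\<lambda>u. k1 u / (u - z) ^ N)"
  have kz: "(\<lambda>u. k (u - z)) holomorphic_on ball z r"
  proof -
    have "(\<lambda>u. u - z) holomorphic_on ball z r" by (intro holomorphic_intros)
    moreover have "(\<lambda>u. u - z) ` ball z r \<subseteq> ball 0 r"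
      by (auto simp: dist_norm norm_minus_commute)
    ultimately show ?thesis
      using holomorphic_on_compose_gen[OF _ k(1)] unfolding o_def by blast
  qed
  have "k1 holomorphic_on ball z r"
    unfolding k1_def by (intro holomorphic_intros kz H_hol)
  then have "k1 analytic_on {z}" using r by (metis analytic_at centre_in_ball open_ball)
  then have "f meromorphic_on {z}"
    unfolding f_def by (intro meromorphic_on_divide analytic_on_imp_meromorphic_on analytic_intros)
  moreover have "\<forall>\<^sub>F u in at z. deriv f u + f u * \<omega> u = \<phi> u"
  proof -
    have "\<forall>\<^sub>F u in at z. u \<in> ball z r - {z}"
      using r by (intro eventually_at_in_open) auto
    with \<omega> \<Phi>(2) show ?thesis
    proof eventually_elim
      case (elim u)
      define x where "x = u - z"
      have x: "x \<noteq> 0" "x \<in> ball 0 r" using elim by (auto simp: x_def dist_norm norm_minus_commute)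
      have u: "u \<in> ball z r" using elim by auto
      have dk: "((\<lambda>u. k (u - z)) has_field_derivative deriv k x) (at u)"
        using holomorphic_derivI[OF k(1) open_ball x(2), of UNIV]
          DERIV_shift[of k "deriv k x" u "- z"] by (simp add: x_def)
      have "((\<lambda>u. k1 u / (u - z) ^ N) has_field_derivative
          ((deriv k x * exp (- H u) + k x * (exp (- H u) * - h u)) * x ^ N
            - k1 u * (of_nat N * x ^ (N - 1))) / (x ^ N * x ^ N)) (at u)"
        unfolding k1_def using x(1)
        by (auto intro!: derivative_eq_intros dk H'[OF u] simp: x_def)
      then have "deriv f u = ((deriv k x * exp (- H u) + k x * (exp (- H u) * - h u)) * x ^ N
            - k1 u * (of_nat N * x ^ (N - 1))) / (x ^ N * x ^ N)"
        unfolding f_def by (rule DERIV_imp_deriv)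
      also have "\<dots> = exp (- H u) / x ^ N * (deriv k x - h u * k x - of_nat N * k x / x)"
        using x(1) by (cases N) (simp_all add: k1_def x_def[symmetric] field_simps)
      finally have "deriv f u + f u * \<omega> u = exp (- H u) / x ^ N * (deriv k x - h u * k x - of_nat N * k x / x)
          + k x * exp (- H u) / x ^ N * (c / x + h u)"
        using elim by (simp add: f_def k1_def x_def)
      also have "\<dots> = exp (- H u) / x ^ N / x * (x * deriv k x + (c - of_nat N) * k x)"
        using x(1) by (simp add: field_simps)
      also have "\<dots> = exp (- H u) * exp (H u) * \<Phi> u / x ^ N"
        using x(1) unfolding k(2)[OF x(2)] \<psi>_def by (simp add: x_def)
      also have "\<dots> = \<phi> u" using elim by (simp add: x_def exp_minus)
      finally show ?case .
    qed
  qed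
  ultimately show thesis by (rule that)
qed

lemma deriv_shift: "deriv (\<lambda>x. f (z + x)) x = deriv f (z + x)"
  for f :: "complex \<Rightarrow> complex"
  by (simp add: deriv_def DERIV_shift add.commute[of z])

text \<open>If a nonzero \<open>d\<close> has order k, the coefficient of order k - 1 in the
  equation is (k + c) times the leading coefficient of \<open>d\<close>, and k + c is not 0 because
  \<open>c\<close> is not an integer.\<close>

lemma homogeneous_solution_eq_0:
  assumes d: "d meromorphic_on {z}" and \<omega>: "\<omega> meromorphic_on {z}"
    and lim: "(\<lambda>u. \<omega> u * (u - z)) \<midarrow>z\<rightarrow> c" and c: "c \<notin> \<int>"
    and eq: "\<forall>\<^sub>F u in at z. deriv d u + d u * \<omega> u = 0"
  shows "\<forall>\<^sub>F u in at z. d u = 0"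
proof -
  obtain D where D: "(\<lambda>x. d (z + x)) has_laurent_expansion D"
    using d meromorphic_on_imp_has_laurent_expansion[of d "{z}" z] by auto
  obtain W where W: "(\<lambda>x. \<omega> (z + x)) has_laurent_expansion W"
    using \<omega> meromorphic_on_imp_has_laurent_expansion[of \<omega> "{z}" z] by auto
  have "(\<lambda>x. \<omega> (z + x) * x) \<midarrow>0\<rightarrow> c"
    using lim filterlim_at_shift[of "\<lambda>u. \<omega> u * (u - z)" "nhds c" 0 z] by (simp add: add.commute)
  note W' = laurent_expansion_simple_pole[OF W this]
  have "c \<noteq> 0" using c by auto
  then have sub: "fls_subdegree W = -1"
    using W' by (intro fls_subdegree_eqI) auto
  have "(\<lambda>x. deriv d (z + x)) has_laurent_expansion fls_deriv D"
    using has_laurent_expansion_deriv[OF D] by (simp add: deriv_shift[abs_def])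
  then have "(\<lambda>x. deriv d (z + x) + d (z + x) * \<omega> (z + x)) has_laurent_expansion fls_deriv D + D * W"
    by (intro laurent_expansion_intros D W)
  moreover have "(\<lambda>x. deriv d (z + x) + d (z + x) * \<omega> (z + x)) has_laurent_expansion 0"
  proof -
    have "\<forall>\<^sub>F x in at 0. deriv d (z + x) + d (z + x) * \<omega> (z + x) = 0"
      using eq by (subst (asm) eventually_at_to_0) (simp add: add.commute)
    then show ?thesis by (subst has_laurent_expansion_cong[OF _ refl]) auto
  qed
  ultimately have zero: "fls_deriv D + D * W = 0" by (rule has_laurent_expansion_unique)
  have "D = 0"
  proof (rule ccontr)
    assume "D \<noteq> 0"
    define k where "k = fls_subdegree D"
    have "fls_nth (fls_deriv D + D * W) (k + -1) = of_int k * fls_nth D k + fls_nth D k * c"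
      using fls_times_base[of D W] by (simp add: sub k_def W'(2))
    then have "(of_int k + c) * fls_nth D k = 0" by (simp add: zero algebra_simps)
    moreover have "fls_nth D k \<noteq> 0" using \<open>D \<noteq> 0\<close> by (simp add: k_def)
    ultimately have "c = of_int (- k)" by (simp add: add_eq_0_iff)
    then show False using c by (metis Ints_of_int)
  qed
  then have "\<forall>\<^sub>F x in at 0. d (z + x) = 0"
    using D by (auto simp: has_laurent_expansion_def elim: eventually_mono)
  then show ?thesis by (subst eventually_at_to_0) (simp add: add.commute)
qed

lemma eventually_differentiable_at:
  assumes "f meromorphic_on {z}"
  shows "\<forall>\<^sub>F u in at z. (f has_field_derivative deriv f u) (at u)"
proof -
  obtain r where r: "r > 0" "f analytic_on ball z r - {z}"
    using assms by (auto simp: meromorphic_at_iff isolated_singularity_at_def)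
  have "\<forall>\<^sub>F u in at z. u \<in> ball z r - {z}"
    using r by (intro eventually_at_in_open) auto
  then show ?thesis
    by eventually_elim (use r in \<open>auto intro!: analytic_derivI intro: analytic_on_subset\<close>)
qed

text \<open>Justifies the definite description in \<open>local_res\<close>: two meromorphic local
  solutions differ by a homogeneous one, which is 0 near \<open>t j\<close>, so every solution gives
  the same residue.\<close>

lemma local_res_eq_residue:
  assumes f: "f meromorphic_on {t j}" "\<forall>\<^sub>F u in at (t j). deriv f u + f u * omega \<tau> t n c u = \<phi> u"
    and \<omega>: "omega \<tau> t n c meromorphic_on {t j}" "(\<lambda>u. omega \<tau> t n c u * (u - t j)) \<midarrow>t j\<rightarrow> e" "e \<notin> \<int>"
  shows "local_res \<tau> t n c j \<phi> \<phi>' = residue (\<lambda>u. f u * \<phi>' u) (t j)"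
  unfolding local_res_def
proof (rule the_equality)
  obtain r1 where r1: "r1 > 0" "f analytic_on ball (t j) r1 - {t j}"
    using f(1) by (auto simp: meromorphic_at_iff isolated_singularity_at_def)
  obtain r2 where r2: "r2 > 0" "\<And>u. u \<in> ball (t j) r2 - {t j} \<Longrightarrow> deriv f u + f u * omega \<tau> t n c u = \<phi> u"
    using f(2) by (auto simp: eventually_at dist_commute)
  show "\<exists>g e. e > 0 \<and> g holomorphic_on (ball (t j) e - {t j}) \<and> not_essential g (t j) \<and>
      (\<forall>u \<in> ball (t j) e - {t j}. deriv g u + g u * omega \<tau> t n c u = \<phi> u) \<and>
      residue (\<lambda>u. f u * \<phi>' u) (t j) = residue (\<lambda>u. g u * \<phi>' u) (t j)"
  proof (intro exI[of _ f] exI[of _ "min r1 r2"] conjI)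
    show "f holomorphic_on (ball (t j) (min r1 r2) - {t j})"
      using r1(2) by (auto intro: analytic_imp_holomorphic holomorphic_on_subset)
    show "not_essential f (t j)" using f(1) by (simp add: meromorphic_at_iff)
  qed (use r1 r2 in auto)
next
  fix r
  assume "\<exists>g e. e > 0 \<and> g holomorphic_on (ball (t j) e - {t j}) \<and> not_essential g (t j) \<and>
      (\<forall>u \<in> ball (t j) e - {t j}. deriv g u + g u * omega \<tau> t n c u = \<phi> u) \<and>
      r = residue (\<lambda>u. g u * \<phi>' u) (t j)"
  then obtain g e where g: "e > 0" "g holomorphic_on (ball (t j) e - {t j})" "not_essential g (t j)"
    "\<And>u. u \<in> ball (t j) e - {t j} \<Longrightarrow> deriv g u + g u * omega \<tau> t n c u = \<phi> u"
    "r = residue (\<lambda>u. g u * \<phi>' u) (t j)" by blast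
  have gm: "g meromorphic_on {t j}"
    unfolding meromorphic_at_iff using g(1,2,3)
    by (auto intro!: isolated_singularity_at_holomorphic[of _ "ball (t j) e"])
  have "\<forall>\<^sub>F u in at (t j). u \<in> ball (t j) e - {t j}"
    using g(1) by (intro eventually_at_in_open) auto
  then have g4: "\<forall>\<^sub>F u in at (t j). deriv g u + g u * omega \<tau> t n c u = \<phi> u"
    by eventually_elim (rule g(4))
  have "\<forall>\<^sub>F u in at (t j). deriv (\<lambda>u. f u - g u) u + (f u - g u) * omega \<tau> t n c u = 0"
    using f(2) g4 eventually_differentiable_at[OF f(1)] eventually_differentiable_at[OF gm]
  proof eventually_elim
    case (elim u)
    have "deriv (\<lambda>u. f u - g u) u = deriv f u - deriv g u"
      by (intro DERIV_imp_deriv derivative_intros elim)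
    then have "deriv (\<lambda>u. f u - g u) u + (f u - g u) * omega \<tau> t n c u =
        (deriv f u + f u * omega \<tau> t n c u) - (deriv g u + g u * omega \<tau> t n c u)"
      by (simp add: left_diff_distrib)
    then show ?case using elim(1,2) by simp
  qed
  then have "\<forall>\<^sub>F u in at (t j). f u - g u = 0"
    by (rule homogeneous_solution_eq_0[OF meromorphic_on_diff[OF f(1) gm] \<omega>])
  then have "\<forall>\<^sub>F u in at (t j). g u * \<phi>' u = f u * \<phi>' u"
    by eventually_elim simp
  then show "r = residue (\<lambda>u. f u * \<phi>' u) (t j)"
    unfolding g(5) by (rule residue_cong) simp
qed

section \<open>Reduction to simple poles\<close>

lemma residue_simple_analytic:
  assumes "Q analytic_on {z}" "\<forall>\<^sub>F u in at z. f u = Q u / (u - z)"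
  shows "residue f z = Q z"
proof -
  obtain S where S: "open S" "z \<in> S" "Q holomorphic_on S" using assms(1) by (auto simp: analytic_at)
  have "residue f z = residue (\<lambda>u. Q u / (u - z)) z" by (rule residue_cong) (use assms in auto)
  also have "\<dots> = Q z" using S by (rule residue_simple)
  finally show ?thesis .
qed

lemma residue_double_analytic:
  assumes "Q analytic_on {z}" "\<forall>\<^sub>F u in at z. f u = Q u / (u - z) ^ 2"
  shows "residue f z = deriv Q z"
proof -
  obtain S where S: "open S" "z \<in> S" "Q holomorphic_on S" using assms(1) by (auto simp: analytic_at)
  have "residue f z = residue (\<lambda>u. Q u / (u - z) ^ Suc 1) z"
    by (rule residue_cong) (use assms in \<open>auto simp: power2_eq_square\<close>)
  also have "\<dots> = deriv Q z" using residue_holomorphic_over_power[OF S, of 1] by simp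
  finally show ?thesis .
qed

lemma residue_analytic_eq_0:
  assumes "Q analytic_on {z}" "\<forall>\<^sub>F u in at z. f u = Q u"
  shows "residue f z = 0"
proof -
  obtain S where S: "open S" "z \<in> S" "Q holomorphic_on S" using assms(1) by (auto simp: analytic_at)
  have "residue f z = residue Q z" by (rule residue_cong) (use assms in auto)
  also have "\<dots> = 0" using S by (rule residue_holo)
  finally show ?thesis .
qed

text \<open>Read off from Laurent series, so that poles of any order at \<open>z\<close> are
  allowed.\<close>

lemma residue_lincomb:
  assumes f: "f meromorphic_on {z}" and g: "g meromorphic_on {z}"
  shows "residue (\<lambda>u. f u + a * g u) z = residue f z + a * residue g z"
proof -
  obtain F where F: "(\<lambda>x. f (z + x)) has_laurent_expansion F"
    using f meromorphic_on_imp_has_laurent_expansion[of f "{z}" z] by auto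
  obtain G where G: "(\<lambda>x. g (z + x)) has_laurent_expansion G"
    using g meromorphic_on_imp_has_laurent_expansion[of g "{z}" z] by auto
  have "(\<lambda>x. f (z + x) + a * g (z + x)) has_laurent_expansion F + fls_const a * G"
    by (intro laurent_expansion_intros F G)
  then show ?thesis
    using has_laurent_expansion_residue[OF F] has_laurent_expansion_residue[OF G]
      has_laurent_expansion_residue[of "\<lambda>u. f u + a * g u" z "F + fls_const a * G"] by simp
qed

lemma analytic_quotient_tendsto:
  assumes "Q analytic_on {z}" "Q z = 0"
  shows "(\<lambda>u. Q u / (u - z)) \<midarrow>z\<rightarrow> deriv Q z"
  using analytic_derivI[OF assms(1), of UNIV] assms(2) by (simp add: has_field_derivative_iff)

section \<open>Theta and s with the factor x split off\<close>

context upper_half_plane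
begin

text \<open>Turns zeros of theta at marked points into explicit powers of u - t_j, the form in which
  the residue lemmas take their input.\<close>

definition theta_red :: "complex \<Rightarrow> complex" where
  "theta_red x = (if x = 0 then deriv (theta1 tau) 0 else theta1 tau x / x)"

lemma theta1_eq_red: "theta1 tau x = x * theta_red x"
  by (simp add: theta_red_def)

lemma theta_red_0 [simp]: "theta_red 0 = deriv (theta1 tau) 0"
  by (simp add: theta_red_def)

lemma theta_red_holomorphic: "theta_red holomorphic_on UNIV"
  using pole_lemma[OF theta1_holomorphic_UNIV, of 0] unfolding theta_red_def [abs_def]
  by (simp cong: if_cong)

lemma theta_red_analytic [analytic_intros]:
  assumes "f analytic_on A" shows "(\<lambda>u. theta_red (f u)) analytic_on A"
proof -
  have "theta_red analytic_on UNIV" using theta_red_holomorphic by (simp add: analytic_on_open)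
  then show ?thesis
    using analytic_on_compose_gen[OF assms, of theta_red UNIV] by (simp add: o_def)
qed

lemma deriv_theta_red_analytic [analytic_intros]:
  assumes "f analytic_on A" shows "(\<lambda>u. deriv theta_red (f u)) analytic_on A"
proof -
  have "deriv theta_red analytic_on UNIV"
    using theta_red_holomorphic by (simp add: analytic_on_open holomorphic_deriv)
  then show ?thesis
    using analytic_on_compose_gen[OF assms, of "deriv theta_red" UNIV] by (simp add: o_def)
qed

lemma theta_red_deriv: "(theta_red has_field_derivative deriv theta_red x) (at x)"
  using theta_red_holomorphic holomorphic_derivI open_UNIV UNIV_I by blast

lemma theta_red_neq_0: "x \<notin> lattice tau \<or> x = 0 \<Longrightarrow> theta_red x \<noteq> 0"
  using deriv_theta1_0_neq_0 theta1_eq_0_iff[of x] by (auto simp: theta_red_def)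

text \<open>The function theta (x) / x is even. Hence rho (x) - 1 / x tends to 0 at 0 and adds no
  constant to later expansions.\<close>

lemma deriv_theta_red_0 [simp]: "deriv theta_red 0 = 0"
proof -
  have even: "theta_red (- x) = theta_red x" for x by (simp add: theta_red_def)
  have "((\<lambda>u. theta_red (- u)) has_field_derivative deriv theta_red (- 0) * - 1) (at 0)"
    by (rule DERIV_chain2[where g = uminus], rule theta_red_deriv) (auto intro!: derivative_eq_intros)
  then have "(theta_red has_field_derivative - deriv theta_red 0) (at 0)" by (simp add: even)
  then have "- deriv theta_red 0 = deriv theta_red 0" using theta_red_deriv DERIV_unique by blast
  then show ?thesis by (simp add: equal_neg_zero)
qed

lemma rho_eq_red:
  assumes "x \<notin> lattice tau"
  shows "rho tau x = 1 / x + deriv theta_red x / theta_red x"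
proof -
  have x: "x \<noteq> 0" "theta_red x \<noteq> 0" using assms theta_red_neq_0 by auto
  have "((\<lambda>x. x * theta_red x) has_field_derivative theta_red x + x * deriv theta_red x) (at x)"
    by (auto intro!: derivative_eq_intros theta_red_deriv)
  then have "deriv (theta1 tau) x = theta_red x + x * deriv theta_red x"
    using DERIV_imp_deriv by (simp add: theta1_eq_red[abs_def])
  then show ?thesis using x by (simp add: rho_def theta1_eq_red field_simps)
qed

definition sfun_red :: "complex \<Rightarrow> complex \<Rightarrow> complex" where
  "sfun_red \<mu> x = theta1 tau (x - \<mu>) * deriv (theta1 tau) 0 / (theta_red x * theta1 tau (- \<mu>))"

lemma sfun_eq_red: "sfun tau x \<mu> = sfun_red \<mu> x / x"
  by (simp add: sfun_def sfun_red_def theta1_eq_red[of x])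

lemma sfun_red_0: "\<mu> \<notin> lattice tau \<Longrightarrow> sfun_red \<mu> 0 = 1"
  using deriv_theta1_0_neq_0 by (simp add: sfun_red_def theta1_eq_0_iff)

text \<open>This is the expansion s (x; mu) = 1 / x - rho (mu) + ...; the denominator contributes
  nothing, since \<open>theta_red\<close> has derivative 0 at 0.\<close>

lemma sfun_red_deriv_0:
  assumes "\<mu> \<notin> lattice tau"
  shows "(sfun_red \<mu> has_field_derivative - rho tau \<mu>) (at 0)"
proof -
  have \<mu>: "theta1 tau \<mu> \<noteq> 0" using assms by (simp add: theta1_eq_0_iff)
  have d: "((\<lambda>x. theta1 tau (x - \<mu>)) has_field_derivative deriv (theta1 tau) (- \<mu>)) (at 0)"
    using DERIV_shift[of "theta1 tau" "deriv (theta1 tau) (- \<mu>)" 0 "- \<mu>"] theta1_deriv[of "- \<mu>"] by simp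
  show ?thesis
    unfolding sfun_red_def [abs_def]
    apply (rule derivative_eq_intros d theta_red_deriv refl)+
    using \<mu> deriv_theta1_0_neq_0 by (auto simp: rho_def deriv_theta1_minus field_simps)
qed

lemma sfun_red_analytic [analytic_intros]:
  assumes "f analytic_on A" "\<And>z. z \<in> A \<Longrightarrow> f z \<notin> lattice tau \<or> f z = 0"
  shows "(\<lambda>u. sfun_red \<mu> (f u)) analytic_on A"
proof (cases "theta1 tau (- \<mu>) = 0")
  case False
  then show ?thesis
    unfolding sfun_red_def using assms theta_red_neq_0 by (intro analytic_intros) auto
qed (simp add: sfun_red_def)

end

section \<open>Algebra of sections and the local form of omega\<close>

context marked_torus
begin

lemma sectionsD:
  assumes "f \<in> merom_sections tau t n \<mu>"
  shows "f holomorphic_on - pole_set tau t n" "f meromorphic_on A"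
    "u \<notin> pole_set tau t n \<Longrightarrow> f (u + 1) = f u"
    "u \<notin> pole_set tau t n \<Longrightarrow> f (u + tau) = exp (2 * pi * \<i> * \<mu>) * f u"
  using assms meromorphic_on_subset[of f UNIV A] by (auto simp: merom_sections_iff)

lemma sections_add:
  assumes "f \<in> merom_sections tau t n \<mu>" "g \<in> merom_sections tau t n \<mu>"
  shows "(\<lambda>u. f u + g u) \<in> merom_sections tau t n \<mu>"
  using assms unfolding merom_sections_iff
  by (auto intro!: holomorphic_on_add meromorphic_on_add simp: algebra_simps)

lemma sections_mult:
  assumes "f \<in> merom_sections tau t n \<mu>" "g \<in> merom_sections tau t n \<nu>"
  shows "(\<lambda>u. f u * g u) \<in> merom_sections tau t n (\<mu> + \<nu>)"
  using assms unfolding merom_sections_iff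
  by (auto intro!: holomorphic_on_mult meromorphic_on_mult simp: ring_distribs exp_add)

lemma sections_cmult:
  assumes "f \<in> merom_sections tau t n \<mu>"
  shows "(\<lambda>u. a * f u) \<in> merom_sections tau t n \<mu>"
  using assms unfolding merom_sections_iff
  by (auto intro!: holomorphic_on_mult meromorphic_on_mult)

lemma sections_diff:
  assumes "f \<in> merom_sections tau t n \<mu>" "g \<in> merom_sections tau t n \<mu>"
  shows "(\<lambda>u. f u - g u) \<in> merom_sections tau t n \<mu>"
  using sections_add[OF assms(1) sections_cmult[OF assms(2), of "-1"]] by simp

lemma sections_zero: "(\<lambda>u. 0) \<in> merom_sections tau t n \<mu>"
  unfolding merom_sections_iff by auto

lemma sections_sum:
  assumes "\<And>j. j \<in> A \<Longrightarrow> f j \<in> merom_sections tau t n \<mu>"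
  shows "(\<lambda>u. \<Sum>j\<in>A. f j u) \<in> merom_sections tau t n \<mu>"
  using assms by (induction A rule: infinite_finite_induct) (auto intro!: sections_add sections_zero)

lemma sections_deriv:
  assumes f: "f \<in> merom_sections tau t n \<mu>"
  shows "deriv f \<in> merom_sections tau t n \<mu>"
proof -
  note f' = sectionsD[OF f]
  have d: "(f has_field_derivative deriv f u) (at u)" if "u \<notin> pole_set tau t n" for u
    using holomorphic_derivI[OF f'(1) open_not_pole] that by simp
  have shift: "deriv f (u + w) = \<kappa> * deriv f u"
    if u: "u \<notin> pole_set tau t n" and w: "w \<in> lattice tau"
      and eq: "\<And>u. u \<notin> pole_set tau t n \<Longrightarrow> f (u + w) = \<kappa> * f u" for u w \<kappa>
  proof -
    have "((\<lambda>u. f (u + w)) has_field_derivative deriv f (u + w)) (at u)"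
      using d[of "u + w"] u w by (simp add: DERIV_shift pole_set_shift)
    moreover have "((\<lambda>u. \<kappa> * f u) has_field_derivative \<kappa> * deriv f u) (at u)"
      using d[OF u] by (auto intro!: derivative_eq_intros)
    then have "((\<lambda>u. f (u + w)) has_field_derivative \<kappa> * deriv f u) (at u)"
      by (rule has_field_derivative_transform_within_open[OF _ open_not_pole]) (use u eq in auto)
    ultimately show ?thesis by (rule DERIV_unique)
  qed
  show ?thesis
    unfolding merom_sections_iff
    using shift[of _ 1 1] shift[of _ tau "exp (2 * pi * \<i> * \<mu>)"] f'
    by (auto intro!: holomorphic_deriv open_not_pole meromorphic_on_deriv)
qed

lemma holomorphic_off_polesI:
  assumes "\<And>u. u \<notin> pole_set tau t n \<Longrightarrow> f analytic_on {u}"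
  shows "f holomorphic_on - pole_set tau t n"
  using assms by (meson ComplD analytic_imp_holomorphic analytic_on_analytic_at)

lemma sections_sfun:
  assumes "j \<in> {1..n}"
  shows "(\<lambda>u. sfun tau (u - t j) \<mu>) \<in> merom_sections tau t n \<mu>"
  unfolding merom_sections_iff
proof (intro conjI allI impI)
  show "(\<lambda>u. sfun tau (u - t j) \<mu>) holomorphic_on - pole_set tau t n"
    by (rule holomorphic_off_polesI, intro analytic_intros) (use not_poleD assms in auto)
  show "(\<lambda>u. sfun tau (u - t j) \<mu>) meromorphic_on UNIV"
    by (rule sfun_meromorphic) (intro analytic_intros)
  show "sfun tau (u + 1 - t j) \<mu> = sfun tau (u - t j) \<mu>" for u
    using sfun_add_1[of "u - t j" \<mu>] by (simp add: algebra_simps)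
  show "sfun tau (u + tau - t j) \<mu> = exp (2 * pi * \<i> * \<mu>) * sfun tau (u - t j) \<mu>" for u
    using sfun_add_tau[of "u - t j" \<mu>] by (simp add: algebra_simps)
qed

lemma sections_theta_quotient:
  assumes "j \<in> {1..n}"
  shows "(\<lambda>u. theta1 tau (u - a) / theta1 tau (u - t j)) \<in> merom_sections tau t n (a - t j)"
  unfolding merom_sections_iff
proof (intro conjI allI impI)
  show "(\<lambda>u. theta1 tau (u - a) / theta1 tau (u - t j)) holomorphic_on - pole_set tau t n"
    by (rule holomorphic_off_polesI, intro analytic_intros) (use not_poleD assms in \<open>auto simp: theta1_eq_0_iff\<close>)
  show "(\<lambda>u. theta1 tau (u - a) / theta1 tau (u - t j)) meromorphic_on UNIV"
    by (rule meromorphic_on_divide; rule analytic_on_imp_meromorphic_on; intro analytic_intros)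
qed (simp_all only: theta1_quotient_add_1 theta1_quotient_add_tau)

text \<open>Under u + tau each rho (u - t_j) changes by - 2 pi i, and these changes cancel because
  the c_j sum to 0.\<close>

lemma sections_omega:
  assumes "(\<Sum>j=1..n. c j) = 0"
  shows "omega tau t n c \<in> merom_sections tau t n 0"
  unfolding merom_sections_iff omega_def [abs_def]
proof (intro conjI allI impI)
  show "(\<lambda>u. 2 * pi * \<i> * c 0 + (\<Sum>j=1..n. c j * rho tau (u - t j))) holomorphic_on - pole_set tau t n"
    by (rule holomorphic_off_polesI, intro analytic_intros) (use not_poleD in auto)
  show "(\<lambda>u. 2 * pi * \<i> * c 0 + (\<Sum>j=1..n. c j * rho tau (u - t j))) meromorphic_on UNIV"
    by (intro meromorphic_on_add meromorphic_on_sum meromorphic_on_mult meromorphic_on_const rho_meromorphic analytic_intros)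
  fix u assume u: "u \<notin> pole_set tau t n"
  have "rho tau (u + 1 - t j) = rho tau (u - t j)" for j
    using rho_add_1[of "u - t j"] by (simp add: algebra_simps)
  then show "2 * pi * \<i> * c 0 + (\<Sum>j=1..n. c j * rho tau (u + 1 - t j)) =
      2 * pi * \<i> * c 0 + (\<Sum>j=1..n. c j * rho tau (u - t j))" by simp
  have "rho tau (u + tau - t j) = rho tau (u - t j) - 2 * pi * \<i>" if "j \<in> {1..n}" for j
    using rho_add_tau[OF not_poleD[OF u that]] by (simp add: algebra_simps)
  then have "(\<Sum>j=1..n. c j * rho tau (u + tau - t j)) =
      (\<Sum>j=1..n. c j * rho tau (u - t j) - c j * (2 * pi * \<i>))"
    by (intro sum.cong) (auto simp: right_diff_distrib)
  also have "\<dots> = (\<Sum>j=1..n. c j * rho tau (u - t j)) - (\<Sum>j=1..n. c j) * (2 * pi * \<i>)"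
    by (simp only: sum_subtractf sum_distrib_right)
  finally show "2 * pi * \<i> * c 0 + (\<Sum>j=1..n. c j * rho tau (u + tau - t j)) = exp (2 * pi * \<i> * 0) *
      (2 * pi * \<i> * c 0 + (\<Sum>j=1..n. c j * rho tau (u - t j)))" using assms by simp
qed

text \<open>Regular part of omega at \<open>t j\<close>; its last summand comes from rho (x) - 1 / x
  and vanishes at \<open>t j\<close> itself.\<close>

definition omega_reg :: "(nat \<Rightarrow> complex) \<Rightarrow> nat \<Rightarrow> complex \<Rightarrow> complex" where
  "omega_reg c j u = 2 * pi * \<i> * c 0 + (\<Sum>l\<in>{1..n} - {j}. c l * rho tau (u - t l))
     + c j * (deriv theta_red (u - t j) / theta_red (u - t j))"

lemma omega_eq_reg:
  assumes "j \<in> {1..n}" "u \<notin> pole_set tau t n"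
  shows "omega tau t n c u = c j / (u - t j) + omega_reg c j u"
proof -
  have "(\<Sum>l=1..n. c l * rho tau (u - t l)) = c j * rho tau (u - t j) + (\<Sum>l\<in>{1..n} - {j}. c l * rho tau (u - t l))"
    using assms(1) by (intro sum.remove) auto
  moreover have "rho tau (u - t j) = 1 / (u - t j) + deriv theta_red (u - t j) / theta_red (u - t j)"
    using rho_eq_red not_poleD[OF assms(2,1)] by blast
  ultimately show ?thesis by (simp add: omega_def omega_reg_def ring_distribs)
qed

lemma omega_reg_analytic:
  assumes "j \<in> {1..n}"
  shows "omega_reg c j analytic_on {t j}"
  unfolding omega_reg_def [abs_def] using assms
  by (intro analytic_intros) (auto simp: t_not_lattice deriv_theta1_0_neq_0)

lemma omega_reg_at: "omega_reg c j (t j) = 2 * pi * \<i> * c 0 + (\<Sum>l\<in>{1..n} - {j}. c l * rho tau (t j - t l))"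
  by (simp add: omega_reg_def)

lemma eventually_omega_eq_reg:
  assumes "j \<in> {1..n}"
  shows "\<forall>\<^sub>F u in at (t j). omega tau t n c u = c j / (u - t j) + omega_reg c j u"
  using eventually_not_pole by eventually_elim (rule omega_eq_reg[OF assms])

lemma omega_meromorphic: "omega tau t n c meromorphic_on A"
  unfolding omega_def [abs_def]
  by (intro meromorphic_on_add meromorphic_on_sum meromorphic_on_mult meromorphic_on_const rho_meromorphic analytic_intros)

lemma tendsto_omega_mult:
  assumes j: "j \<in> {1..n}"
  shows "(\<lambda>u. omega tau t n c u * (u - t j)) \<midarrow>t j\<rightarrow> c j"
proof -
  have "omega_reg c j \<midarrow>t j\<rightarrow> omega_reg c j (t j)"
    using analytic_at_imp_isCont[OF omega_reg_analytic[OF j]] by (simp add: isCont_def)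
  then have "(\<lambda>u. c j + omega_reg c j u * (u - t j)) \<midarrow>t j\<rightarrow> c j + omega_reg c j (t j) * (t j - t j)"
    by (intro tendsto_intros)
  moreover have "\<forall>\<^sub>F u in at (t j). c j + omega_reg c j u * (u - t j) = omega tau t n c u * (u - t j)"
    using eventually_omega_eq_reg[OF j, of c] eventually_neq_at_within[of "t j"]
    by eventually_elim (simp add: distrib_right)
  ultimately show ?thesis using tendsto_cong by fastforce
qed

text \<open>Any global section with the principal parts of the local solutions reduces \<open>\<Phi>\<close> to a form
  with at most simple poles, whose residues are read off from the regular parts \<open>h j\<close>.\<close>
lemma simple_pole_reduction:
  assumes \<Phi>: "\<Phi> \<in> merom_sections tau t n \<mu>" and \<mu>: "\<mu> \<notin> lattice tau"
    and csum: "(\<Sum>j=1..n. c j) = 0"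
    and F: "\<And>j. j \<in> {1..n} \<Longrightarrow> F j meromorphic_on {t j}"
      "\<And>j. j \<in> {1..n} \<Longrightarrow> \<forall>\<^sub>F u in at (t j). deriv (F j) u + F j u * omega tau t n c u = \<Phi> u"
  obtains G h where "G \<in> merom_sections tau t n \<mu>"
    "\<And>j. j \<in> {1..n} \<Longrightarrow> h j analytic_on {t j}"
    "\<And>j. j \<in> {1..n} \<Longrightarrow> \<forall>\<^sub>F u in at (t j). F j u = h j u + G u"
    "\<And>j. j \<in> {1..n} \<Longrightarrow> \<forall>\<^sub>F u in at (t j). deriv (h j) u + h j u * omega tau t n c u =
        (\<Sum>l=1..n. c l * h l (t l) * sfun tau (u - t l) \<mu>)"
    "\<And>u. u \<notin> pole_set tau t n \<Longrightarrow> \<Phi> u - (\<Sum>l=1..n. c l * h l (t l) * sfun tau (u - t l) \<mu>) =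
        deriv G u + G u * omega tau t n c u"
proof -
  define K where "K = (\<lambda>u. sfun tau u \<mu>)"
  have "K analytic_on - lattice tau"
    unfolding K_def by (intro analytic_intros) auto
  then have K_hol: "K holomorphic_on - lattice tau" by (rule analytic_imp_holomorphic)
  have K_mero: "K meromorphic_on UNIV"
    unfolding K_def by (rule sfun_meromorphic) (intro analytic_intros)
  note K = K_hol K_mero
  have K1: "(\<lambda>x. K x * x) \<midarrow>0\<rightarrow> 1" unfolding K_def using \<mu> by (rule tendsto_sfun_mult)
  obtain N a where lim: "\<And>j. j \<in> {1..n} \<Longrightarrow> \<exists>c. (\<lambda>u. F j u - principal_sum K N a u) \<midarrow>t j\<rightarrow> c"
    using principal_sum_exists[OF K K1 F(1)] by blast
  \<comment> \<open>The kernel s already has the multiplier of the sections and no additive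
    constant, so principal parts can be prescribed without a condition on residues.\<close>
  define G where "G = principal_sum K N a"
  have G: "G \<in> merom_sections tau t n \<mu>"
    unfolding merom_sections_iff G_def
    using principal_sum_holomorphic[OF K, of N a] principal_sum_meromorphic[OF K, of N a]
      principal_sum_quasi_periodic[OF K, of 1 1 0 _ N a]
      principal_sum_quasi_periodic[OF K, of tau "exp (2 * pi * \<i> * \<mu>)" 0 _ N a]
    by (auto simp: K_def sfun_add_1 sfun_add_tau)
  note G_mero = sectionsD(2)[OF G]
  define h where "h = (\<lambda>j. remove_sings (\<lambda>u. F j u - G u))"
  \<comment> \<open>The residue of the reduced form \<open>Y\<close> at \<open>t l\<close>: near
    \<open>t l\<close> it is h' + h omega with \<open>h l\<close> analytic, and omega has residue
    \<open>c l\<close>.\<close>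
  define A where "A = (\<lambda>l. c l * h l (t l))"
  define Y where "Y = (\<lambda>u. \<Phi> u - (deriv G u + G u * omega tau t n c u))"
  define X where "X = (\<lambda>u. Y u - (\<Sum>l=1..n. A l * sfun tau (u - t l) \<mu>))"
  have diff_mero: "(\<lambda>u. F j u - G u) meromorphic_on {t j}" if "j \<in> {1..n}" for j
    by (intro meromorphic_on_diff F that G_mero)
  then have iso: "isolated_singularity_at (\<lambda>u. F j u - G u) (t j)" if "j \<in> {1..n}" for j
    using that by (simp add: meromorphic_at_iff)
  have h_ana: "h j analytic_on {t j}" if j: "j \<in> {1..n}" for j
    using lim[OF j] remove_sings_analytic_at[OF iso[OF j]] by (auto simp: h_def G_def)
  have h_eq: "\<forall>\<^sub>F u in at (t j). F j u = h j u + G u" if j: "j \<in> {1..n}" for j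
    using eventually_remove_sings_eq_at[OF iso[OF j]] by eventually_elim (simp add: h_def)
  have h_ode: "\<forall>\<^sub>F u in at (t j). deriv (h j) u + h j u * omega tau t n c u = Y u" if j: "j \<in> {1..n}" for j
  proof -
    obtain r where r: "r > 0" "(\<lambda>u. F j u - G u) analytic_on ball (t j) r - {t j}"
      using iso[OF j] by (auto simp: isolated_singularity_at_def)
    have "\<forall>\<^sub>F u in at (t j). u \<in> ball (t j) r - {t j}"
      using r(1) by (intro eventually_at_in_open) auto
    then have ev: "\<forall>\<^sub>F u in at (t j). deriv (h j) u = deriv (\<lambda>u. F j u - G u) u"
    proof eventually_elim
      case (elim u)
      then have "(\<lambda>u. F j u - G u) analytic_on {u}" using r(2) by (auto intro: analytic_on_subset)
      then show ?case unfolding h_def by (rule deriv_remove_sings_at_analytic)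
    qed
    show ?thesis
      using ev h_eq[OF j] F(2)[OF j] eventually_differentiable_at[OF F(1)[OF j]]
        eventually_differentiable_at[OF G_mero, of "t j"]
    proof eventually_elim
      case (elim u)
      have "deriv (\<lambda>u. F j u - G u) u = deriv (F j) u - deriv G u"
        by (intro DERIV_imp_deriv derivative_intros elim)
      moreover have "h j u = F j u - G u" using elim by simp
      ultimately have "deriv (h j) u + h j u * omega tau t n c u =
          (deriv (F j) u + F j u * omega tau t n c u) - (deriv G u + G u * omega tau t n c u)"
        using elim(1) by (simp add: left_diff_distrib)
      then show ?case using elim(3) by (simp add: Y_def)
    qed
  qed
  have "(\<lambda>u. G u * omega tau t n c u) \<in> merom_sections tau t n \<mu>"
    using sections_mult[OF G sections_omega[OF csum]] by simp
  then have X_sec: "X \<in> merom_sections tau t n \<mu>"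
    unfolding X_def Y_def
    by (intro sections_diff sections_add sections_sum sections_cmult sections_sfun sections_deriv \<Phi> G)
  have X_lim: "\<exists>d. X \<midarrow>t j\<rightarrow> d" if j: "j \<in> {1..n}" for j
  proof -
    \<comment> \<open>Near \<open>t j\<close> the defect \<open>X\<close> is Q / (u - t_j) + R with
      \<open>R\<close> analytic. The choice of \<open>A j\<close> makes \<open>Q\<close> vanish at
      \<open>t j\<close>, so no pole is left.\<close>
    define Q where "Q = (\<lambda>u. c j * h j u - A j * sfun_red \<mu> (u - t j))"
    define R where "R = (\<lambda>u. deriv (h j) u + h j u * omega_reg c j u
      - (\<Sum>l\<in>{1..n} - {j}. A l * sfun tau (u - t l) \<mu>))"
    have "Q analytic_on {t j}"
      unfolding Q_def by (intro analytic_intros h_ana j) auto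
    moreover have "Q (t j) = 0"
      using \<mu> by (simp add: Q_def A_def sfun_red_0)
    ultimately have "(\<lambda>u. Q u / (u - t j)) \<midarrow>t j\<rightarrow> deriv Q (t j)" by (rule analytic_quotient_tendsto)
    moreover have "R analytic_on {t j}"
      unfolding R_def
      by (intro analytic_intros h_ana j omega_reg_analytic) (use j in \<open>auto simp: t_not_lattice\<close>)
    then have "R \<midarrow>t j\<rightarrow> R (t j)"
      using analytic_at_imp_isCont by (simp add: isCont_def)
    ultimately have "(\<lambda>u. Q u / (u - t j) + R u) \<midarrow>t j\<rightarrow> deriv Q (t j) + R (t j)"
      by (rule tendsto_add)
    moreover have "\<forall>\<^sub>F u in at (t j). Q u / (u - t j) + R u = X u"
      using h_ode[OF j] eventually_omega_eq_reg[OF j, of c]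
    proof eventually_elim
      case (elim u)
      have "(\<Sum>l=1..n. A l * sfun tau (u - t l) \<mu>) =
          A j * sfun tau (u - t j) \<mu> + (\<Sum>l\<in>{1..n} - {j}. A l * sfun tau (u - t l) \<mu>)"
        using j by (intro sum.remove) auto
      then show ?case
        unfolding X_def elim(1)[symmetric] elim(2) sfun_eq_red[of "u - t j"] Q_def R_def
        by (simp add: ring_distribs diff_divide_distrib)
    qed
    ultimately have "X \<midarrow>t j\<rightarrow> deriv Q (t j) + R (t j)" using tendsto_cong by fastforce
    then show ?thesis by blast
  qed
  have X0: "X u = 0" if "u \<notin> pole_set tau t n" for u
    using X_sec \<mu> X_lim that by (rule section_eq_0)
  show thesis
  proof (rule that[OF G h_ana h_eq])
    fix j assume "j \<in> {1..n}"
    from h_ode[OF this] eventually_not_pole[of "t j"]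
    show "\<forall>\<^sub>F u in at (t j). deriv (h j) u + h j u * omega tau t n c u =
        (\<Sum>l=1..n. c l * h l (t l) * sfun tau (u - t l) \<mu>)"
      by eventually_elim (use X0 in \<open>simp add: X_def A_def\<close>)
  next
    fix u assume "u \<notin> pole_set tau t n"
    then show "\<Phi> u - (\<Sum>l=1..n. c l * h l (t l) * sfun tau (u - t l) \<mu>) =
        deriv G u + G u * omega tau t n c u"
      using X0[of u] by (simp add: X_def Y_def A_def algebra_simps)
  qed
qed

text \<open>Constant terms of the equation at \<open>t j\<close>: h times c_j / (u - t_j)
  contributes c_j h' (t_j), and the j-th s-function contributes - rho (mu). This will eliminate the
  derivative of \<open>h p\<close> that a double pole brings into \<open>J p\<close>.\<close>

lemma constant_term_relation:
  assumes j: "j \<in> {1..n}" and \<mu>: "\<mu> \<notin> lattice tau" and h: "h analytic_on {t j}"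
    and A: "A j = c j * h (t j)"
    and ode: "\<forall>\<^sub>F u in at (t j). deriv h u + h u * omega tau t n c u = (\<Sum>l=1..n. A l * sfun tau (u - t l) \<mu>)"
  shows "(c j + 1) * deriv h (t j) + h (t j) * (2 * pi * \<i> * c 0 + (\<Sum>l\<in>{1..n} - {j}. c l * rho tau (t j - t l)))
    = - A j * rho tau \<mu> + (\<Sum>l\<in>{1..n} - {j}. A l * sfun tau (t j - t l) \<mu>)"
proof -
  define R where "R = (\<lambda>u. \<Sum>l\<in>{1..n} - {j}. A l * sfun tau (u - t l) \<mu>)"
  \<comment> \<open>The difference of the two sides times u - t_j. It is analytic, and the constant
    terms become its derivative at \<open>t j\<close>.\<close>
  define L where "L = (\<lambda>u. (u - t j) * deriv h u + h u * (c j + (u - t j) * omega_reg c j u)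
    - A j * sfun_red \<mu> (u - t j) - (u - t j) * R u)"
  have R_ana: "R analytic_on {t j}"
    unfolding R_def by (intro analytic_intros) (use j in \<open>auto simp: t_not_lattice\<close>)
  have "\<forall>\<^sub>F u in at (t j). L u = 0"
    using ode eventually_omega_eq_reg[OF j, of c] eventually_neq_at_within[of "t j"]
  proof eventually_elim
    case (elim u)
    have "(\<Sum>l=1..n. A l * sfun tau (u - t l) \<mu>) = A j * sfun tau (u - t j) \<mu> + R u"
      unfolding R_def using j by (intro sum.remove) auto
    with elim(1) have "deriv h u + h u * (c j / (u - t j) + omega_reg c j u) =
        A j * (sfun_red \<mu> (u - t j) / (u - t j)) + R u"
      by (simp add: elim(2) sfun_eq_red)
    then have "(u - t j) * (deriv h u + h u * (c j / (u - t j) + omega_reg c j u)) =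
        (u - t j) * (A j * (sfun_red \<mu> (u - t j) / (u - t j)) + R u)" by simp
    moreover have "(u - t j) * (deriv h u + h u * (c j / (u - t j) + omega_reg c j u)) =
        (u - t j) * deriv h u + h u * (c j + (u - t j) * omega_reg c j u)"
      using elim(3) by (simp add: field_simps)
    moreover have "(u - t j) * (A j * (sfun_red \<mu> (u - t j) / (u - t j)) + R u) =
        A j * sfun_red \<mu> (u - t j) + (u - t j) * R u"
      using elim(3) by (simp add: field_simps)
    ultimately show ?case by (simp add: L_def)
  qed
  \<comment> \<open>The condition on \<open>A j\<close> fills in the centre, so that
    \<open>L\<close> vanishes on a full neighbourhood and may be differentiated there.\<close>
  moreover have "L (t j) = 0" using \<mu> by (simp add: L_def A sfun_red_0 mult.commute)
  ultimately have "\<forall>\<^sub>F u in nhds (t j). L u = 0" by (simp add: eventually_nhds_conv_at)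
  then have "deriv L (t j) = deriv (\<lambda>u. 0) (t j)" by (intro deriv_cong_ev) auto
  then have L0: "deriv L (t j) = 0" by simp
  have s: "((\<lambda>u. sfun_red \<mu> (u - t j)) has_field_derivative - rho tau \<mu>) (at (t j))"
    using DERIV_shift[of "sfun_red \<mu>" "- rho tau \<mu>" "t j" "- t j"] sfun_red_deriv_0[OF \<mu>] by simp
  have "(L has_field_derivative (deriv h (t j) + (deriv h (t j) * c j + h (t j) * omega_reg c j (t j))
      - A j * - rho tau \<mu> - R (t j))) (at (t j))"
    unfolding L_def
    apply (rule derivative_eq_intros s analytic_derivI[OF h] analytic_derivI[OF analytic_deriv[OF h]]
      analytic_derivI[OF R_ana] analytic_derivI[OF omega_reg_analytic[OF j]] refl)+
    by simp
  then have "deriv h (t j) + (deriv h (t j) * c j + h (t j) * omega_reg c j (t j)) + A j * rho tau \<mu> - R (t j) = 0"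
    using L0 DERIV_imp_deriv by fastforce
  then show ?thesis
    unfolding omega_reg_at R_def by (simp add: algebra_simps)
qed

end

section \<open>Residues of the dual forms\<close>

context marked_torus
begin

lemma fund_par_lattice:
  assumes "x \<in> fund_par tau" "x \<in> lattice tau"
  shows "x = 0"
proof -
  obtain a b :: real where ab: "x = of_real a + of_real b * tau" "0 \<le> a" "a < 1" "0 \<le> b" "b < 1"
    using assms(1) by (auto simp: fund_par_def)
  obtain m k :: int where mk: "x = of_int m + of_int k * tau" using assms(2) by (rule latticeE)
  have "Im x = b * Im tau" "Im x = of_int k * Im tau"
    unfolding ab(1) by simp (simp add: mk flip: ab(1))
  then have "b = of_int k" using Im_tau by simp
  then have "k = 0" "b = 0" using ab by auto
  then have "of_real a = (of_int m :: complex)" using ab(1) mk by simp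
  then have "a = of_int m" by (metis of_real_eq_iff of_real_of_int_eq)
  then have "m = 0" using ab by linarith
  with \<open>k = 0\<close> mk show ?thesis by simp
qed

context
  fixes p q :: nat and \<nu> :: complex
  assumes p: "p \<in> {1..n}" and q: "q \<in> {1..n}" and pq: "p \<noteq> q" and \<nu>: "\<nu> \<notin> lattice tau"
begin

text \<open>The dual form psi'_l divided by g = theta (u - t_p) / theta (u - t_q). For
  \<open>\<nu>\<close> = lam' it has multiplier parameter - lam, opposite to that of the global
  section to be paired with it.\<close>

definition twisted_psi :: "nat \<Rightarrow> complex \<Rightarrow> complex" where
  "twisted_psi l u = theta1 tau (u - t q) / theta1 tau (u - t p) * sfun tau (u - t l) (- \<nu>)"

lemma theta1_t_neq_0: "i \<in> {1..n} \<Longrightarrow> j \<in> {1..n} \<Longrightarrow> i \<noteq> j \<Longrightarrow> theta1 tau (t i - t j) \<noteq> 0"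
  by (simp add: theta1_eq_0_iff t_not_lattice)

lemma theta1_nu_neq_0: "theta1 tau \<nu> \<noteq> 0"
  using \<nu> by (simp add: theta1_eq_0_iff)

lemma sections_twisted_psi:
  assumes "l \<in> {1..n}"
  shows "twisted_psi l \<in> merom_sections tau t n (t q - t p - \<nu>)"
  using sections_mult[OF sections_theta_quotient[OF p, of "t q"] sections_sfun[OF assms, of "- \<nu>"]]
  by (simp add: twisted_psi_def [abs_def])

text \<open>The zero of theta (u - t_q) cancels the pole of s, which leaves only the simple pole at
  \<open>t p\<close>.\<close>

lemma residue_twisted_psi_q:
  assumes j: "j \<in> {1..n}" and h: "h analytic_on {t j}"
  shows "residue (\<lambda>u. h u * twisted_psi q u) (t j) =
    (if j = p then h (t p) * theta1 tau (t p - t q + \<nu>) / theta1 tau \<nu> else 0)"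
proof -
  have eq: "twisted_psi q u = theta1 tau (u - t q + \<nu>) * deriv (theta1 tau) 0 / (theta1 tau \<nu> * theta1 tau (u - t p))"
    if "u \<notin> pole_set tau t n" for u
    using not_poleD[OF that q] by (simp add: twisted_psi_def sfun_def theta1_eq_0_iff)
  show ?thesis
  proof (cases "j = p")
    case True
    define Q where "Q = (\<lambda>u. h u * (theta1 tau (u - t q + \<nu>) * deriv (theta1 tau) 0 / (theta1 tau \<nu> * theta_red (u - t p))))"
    have "Q analytic_on {t p}"
      unfolding Q_def using h True theta1_nu_neq_0 deriv_theta1_0_neq_0
      by (intro analytic_intros) auto
    moreover have "\<forall>\<^sub>F u in at (t p). h u * twisted_psi q u = Q u / (u - t p)"
      using eventually_not_pole[of "t p"]
      by eventually_elim (simp add: eq Q_def theta1_eq_red[of "_ - t p"] mult_ac)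
    ultimately have "residue (\<lambda>u. h u * twisted_psi q u) (t p) = Q (t p)"
      by (rule residue_simple_analytic)
    then show ?thesis using True deriv_theta1_0_neq_0 by (simp add: Q_def)
  next
    case False
    define Q where "Q = (\<lambda>u. h u * (theta1 tau (u - t q + \<nu>) * deriv (theta1 tau) 0 / (theta1 tau \<nu> * theta1 tau (u - t p))))"
    have "Q analytic_on {t j}"
      unfolding Q_def using h False theta1_nu_neq_0 theta1_t_neq_0[OF j p]
      by (intro analytic_intros) auto
    moreover have "\<forall>\<^sub>F u in at (t j). h u * twisted_psi q u = Q u"
      using eventually_not_pole[of "t j"] by eventually_elim (simp add: eq Q_def)
    ultimately show ?thesis using False residue_analytic_eq_0 by auto
  qed
qed

text \<open>The pole of s at \<open>t l\<close> and the zero of theta (u - t_p) at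
  \<open>t p\<close> are distinct, so both poles are simple.\<close>

lemma residue_twisted_psi:
  assumes j: "j \<in> {1..n}" and h: "h analytic_on {t j}" and l: "l \<in> {1..n}" "l \<noteq> p" "l \<noteq> q"
  shows "residue (\<lambda>u. h u * twisted_psi l u) (t j) =
    (if j = l then h (t l) * theta1 tau (t l - t q) / theta1 tau (t l - t p)
     else if j = p then h (t p) * theta1 tau (t p - t q) * sfun tau (t p - t l) (- \<nu>) / deriv (theta1 tau) 0
     else 0)"
proof -
  consider "j = l" | "j = p" "j \<noteq> l" | "j \<noteq> l" "j \<noteq> p" by blast
  then show ?thesis
  proof cases
    case 1
    define Q where "Q = (\<lambda>u. h u * (theta1 tau (u - t q) / theta1 tau (u - t p) * sfun_red (- \<nu>) (u - t l)))"
    have "Q analytic_on {t l}"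
      unfolding Q_def using h 1 theta1_t_neq_0[OF l(1) p l(2)] by (intro analytic_intros) auto
    moreover have "\<forall>\<^sub>F u in at (t l). h u * twisted_psi l u = Q u / (u - t l)"
      by (simp add: Q_def twisted_psi_def sfun_eq_red)
    ultimately have "residue (\<lambda>u. h u * twisted_psi l u) (t l) = Q (t l)"
      by (rule residue_simple_analytic)
    then show ?thesis using 1 \<nu> by (simp add: Q_def sfun_red_0)
  next
    case 2
    define Q where "Q = (\<lambda>u. h u * (theta1 tau (u - t q) / theta_red (u - t p) * sfun tau (u - t l) (- \<nu>)))"
    have "Q analytic_on {t p}"
      unfolding Q_def using h 2 l p deriv_theta1_0_neq_0 by (intro analytic_intros) (auto simp: t_not_lattice)
    moreover have "\<forall>\<^sub>F u in at (t p). h u * twisted_psi l u = Q u / (u - t p)"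
      by (simp add: Q_def twisted_psi_def theta1_eq_red[of "_ - t p"] mult_ac)
    ultimately have "residue (\<lambda>u. h u * twisted_psi l u) (t p) = Q (t p)"
      by (rule residue_simple_analytic)
    then show ?thesis using 2 by (simp add: Q_def)
  next
    case 3
    have "(\<lambda>u. h u * twisted_psi l u) analytic_on {t j}"
      unfolding twisted_psi_def using h 3 l j p theta1_t_neq_0[OF j p]
      by (intro analytic_intros) (auto simp: t_not_lattice)
    then show ?thesis using 3 residue_analytic_eq_0 by auto
  qed
qed

text \<open>The pole of s meets the zero of theta (u - t_p), so the pole is double and its residue
  is a derivative. The factors \<open>theta_red\<close> have derivative 0 at 0; the three others
  give h', rho (t_p - t_q) and rho (nu).\<close>

lemma residue_twisted_psi_p:
  assumes j: "j \<in> {1..n}" and h: "h analytic_on {t j}"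
  shows "residue (\<lambda>u. h u * twisted_psi p u) (t j) =
    (if j = p then theta1 tau (t p - t q) / deriv (theta1 tau) 0 *
       (deriv h (t p) + h (t p) * (rho tau (t p - t q) + rho tau \<nu>)) else 0)"
proof (cases "j = p")
  case True
  define d where "d = deriv (theta1 tau) 0"
  have d: "d \<noteq> 0" using deriv_theta1_0_neq_0 by (simp add: d_def)
  define Q where "Q = (\<lambda>u. h u * theta1 tau (u - t q) * theta1 tau (u - t p + \<nu>) * d
    / (theta1 tau \<nu> * (theta_red (u - t p) * theta_red (u - t p))))"
  have "Q analytic_on {t p}"
    unfolding Q_def using h True theta1_nu_neq_0 deriv_theta1_0_neq_0 by (intro analytic_intros) auto
  moreover have "\<forall>\<^sub>F u in at (t p). h u * twisted_psi p u = Q u / (u - t p) ^ 2"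
    by (simp add: Q_def twisted_psi_def sfun_def theta1_eq_red[of "_ - t p"] power2_eq_square d_def mult_ac)
  ultimately have "residue (\<lambda>u. h u * twisted_psi p u) (t p) = deriv Q (t p)"
    by (rule residue_double_analytic)
  also have "deriv Q (t p) = theta1 tau (t p - t q) / d *
       (deriv h (t p) + h (t p) * (rho tau (t p - t q) + rho tau \<nu>))"
  proof (rule DERIV_imp_deriv)
    have h': "(h has_field_derivative deriv h (t p)) (at (t p))"
      using analytic_derivI h True by blast
    have 1: "((\<lambda>u. theta1 tau (u - t q)) has_field_derivative deriv (theta1 tau) (t p - t q)) (at (t p))"
      using DERIV_shift[of "theta1 tau" _ "t p" "- t q"] theta1_deriv[of "t p - t q"] by simp
    have 2: "((\<lambda>u. theta1 tau (u - t p + \<nu>)) has_field_derivative deriv (theta1 tau) \<nu>) (at (t p))"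
      using DERIV_shift[of "theta1 tau" "deriv (theta1 tau) \<nu>" "t p" "- t p + \<nu>"] theta1_deriv[of \<nu>]
      by (simp add: add_diff_eq diff_add_eq add.commute)
    have 3: "((\<lambda>u. theta_red (u - t p)) has_field_derivative 0) (at (t p))"
      using DERIV_shift[of theta_red "deriv theta_red 0" "t p" "- t p"] theta_red_deriv[of 0] by simp
    show "(Q has_field_derivative theta1 tau (t p - t q) / d *
       (deriv h (t p) + h (t p) * (rho tau (t p - t q) + rho tau \<nu>))) (at (t p))"
      unfolding Q_def
      apply (rule derivative_eq_intros h' 1 2 3 refl)+
      using d theta1_nu_neq_0 theta1_t_neq_0[OF p q pq]
      by (auto simp: rho_def d_def[symmetric] field_simps)
  qed
  finally show ?thesis using True by (simp add: d_def)
next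
  case False
  have "(\<lambda>u. h u * twisted_psi p u) analytic_on {t j}"
    unfolding twisted_psi_def using h False j p theta1_t_neq_0[OF j p]
    by (intro analytic_intros) (auto simp: t_not_lattice)
  then show ?thesis using False residue_analytic_eq_0 by auto
qed

end

lemma intersection_eq_residues:
  assumes c: "\<And>j. j \<in> {1..n} \<Longrightarrow> c j \<notin> \<int>"
    and f: "\<And>j. j \<in> {1..n} \<Longrightarrow> f j meromorphic_on {t j}"
      "\<And>j. j \<in> {1..n} \<Longrightarrow> \<forall>\<^sub>F u in at (t j). deriv (f j) u + f j u * omega tau t n c u = \<phi> u"
  shows "intersection tau t n c \<phi> \<eta> / (2 * pi * \<i>) = (\<Sum>j=1..n. residue (\<lambda>u. f j u * \<eta> u) (t j))"
proof -
  have "local_res tau t n c j \<phi> \<eta> = residue (\<lambda>u. f j u * \<eta> u) (t j)" if "j \<in> {1..n}" for j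
    using f[OF that] omega_meromorphic tendsto_omega_mult[OF that] c[OF that] by (rule local_res_eq_residue)
  then show ?thesis by (simp add: intersection_def)
qed

lemma deriv_theta_quotient:
  assumes u: "u \<notin> pole_set tau t n" and p: "p \<in> {1..n}" and q: "q \<in> {1..n}"
  shows "((\<lambda>u. theta1 tau (u - t p) / theta1 tau (u - t q)) has_field_derivative
    theta1 tau (u - t p) / theta1 tau (u - t q) * (rho tau (u - t p) - rho tau (u - t q))) (at u)"
proof -
  have d: "((\<lambda>u. theta1 tau (u - a)) has_field_derivative deriv (theta1 tau) (u - a)) (at u)" for a
    using DERIV_shift[of "theta1 tau" _ u "- a"] theta1_deriv[of "u - a"] by simp
  have nz: "theta1 tau (u - t p) \<noteq> 0" "theta1 tau (u - t q) \<noteq> 0"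
    using not_poleD[OF u] p q by (auto simp: theta1_eq_0_iff)
  show ?thesis
    apply (rule derivative_eq_intros d refl)+
    using nz by (auto simp: rho_def field_simps)
qed

text \<open>Together with \<open>deriv_theta_quotient\<close> this is dlog g = omega_c' -
  omega_c.\<close>

lemma omega_shift:
  assumes "p \<in> {1..n}" "q \<in> {1..n}" "p \<noteq> q"
  shows "omega tau t n (c(p := c p + 1, q := c q - 1)) u =
    omega tau t n c u + rho tau (u - t p) - rho tau (u - t q)"
proof -
  have "(\<Sum>j=1..n. (c(p := c p + 1, q := c q - 1)) j * rho tau (u - t j)) =
     (\<Sum>j=1..n. c j * rho tau (u - t j) + (if j = p then rho tau (u - t p) else 0)
        - (if j = q then rho tau (u - t q) else 0))"
    using assms(3) by (intro sum.cong) (auto simp: ring_distribs)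
  also have "\<dots> = (\<Sum>j=1..n. c j * rho tau (u - t j)) + rho tau (u - t p) - rho tau (u - t q)"
    using assms by (simp add: sum.distrib sum_subtractf)
  finally show ?thesis using assms by (simp add: omega_def)
qed

end

theorem mainTheorem9:
  fixes \<tau> lam :: complex and t c :: "nat \<Rightarrow> complex" and n p q :: nat
    and \<phi> :: "complex \<Rightarrow> complex"
  assumes tau: "Im \<tau> > 0"
    and n: "n \<ge> 2"
    and t_incong: "\<forall>i\<in>{1..n}. \<forall>j\<in>{1..n}. i \<noteq> j \<longrightarrow> t i - t j \<notin> lattice \<tau>"
    and c_nonint: "\<forall>j\<in>{1..n}. c j \<notin> \<int>"
    and c_sum: "(\<Sum>j=1..n. c j) = 0"
    and lam_P: "lam \<in> fund_par \<tau>" "lam \<noteq> 0"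
    and pq: "p \<in> {1..n}" "q \<in> {1..n}" "p \<noteq> q"
    and gen1: "t p - t q + lam \<notin> lattice \<tau>"
    and gen2: "t p - t q - lam \<notin> lattice \<tau>"
    and phi: "\<phi> \<in> merom_sections \<tau> t n (lam - t p + t q)"
  shows
   "let lam' = lam - t p + t q;
        c' = c(p := c p + 1, q := c q - 1);
        \<psi>' = (\<lambda>j u. sfun \<tau> (u - t j) (- lam'));
        \<eta>' = (\<lambda>k. if k = q then \<psi>' q
                  else if k = p then
                    (\<lambda>u. \<psi>' p u + (1 / sfun \<tau> (t p - t q) (- lam')) *
                       ((1 / (c p + 1)) * (2 * pi * \<i> * c 0 +
                           (\<Sum>l\<in>{1..n} - {p}. c' l * rho \<tau> (t p - t l)))
                        - rho \<tau> lam') * \<psi>' q u)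
                  else (\<lambda>u. \<psi>' k u - sfun \<tau> (t p - t k) (- lam') / sfun \<tau> (t p - t q) (- lam') * \<psi>' q u));
        J = (\<lambda>k. intersection \<tau> t n c' \<phi> (\<eta>' k) / (2 * pi * \<i>));
        \<psi> = (\<lambda>j u. sfun \<tau> (u - t j) lam);
        \<theta> = theta1 \<tau>;
        B = J p * (c p + 1) * \<theta> lam / \<theta> (lam - t p + t q)
            - J q * c p * \<theta> (t p - t q) / deriv \<theta> 0 * (rho \<tau> (t p - t q) - rho \<tau> lam)
            + (\<Sum>j\<in>{1..n} - {p, q}. J j * c j * \<theta> (t p - t q) * \<theta> (lam - t p + t j)
                 / (\<theta> (t j - t q) * \<theta> (lam - t p + t q)))
    in cohom_eq \<tau> t n c lam
         (\<lambda>u. \<theta> (u - t p) / \<theta> (u - t q) * \<phi> u)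
         (\<lambda>u. (\<Sum>j\<in>{1..n} - {p, q}. J j * c j * \<theta> (t j - t p) / \<theta> (t j - t q) * \<psi> j u)
              + J q * c p * \<theta> (lam - t p + t q) / \<theta> lam * \<psi> p u
              + B * \<psi> q u)"
proof -
  interpret marked_torus \<tau> t n
    by unfold_locales (use tau t_incong in auto)
  note p = pq(1) and q = pq(2)
  define lam' where "lam' = lam - t p + t q"
  define c' where "c' = c(p := c p + 1, q := c q - 1)"
  define \<psi>' where "\<psi>' = (\<lambda>j u. sfun \<tau> (u - t j) (- lam'))"
  define \<kappa> where "\<kappa> = (1 / sfun \<tau> (t p - t q) (- lam')) *
    ((1 / (c p + 1)) * (2 * pi * \<i> * c 0 + (\<Sum>l\<in>{1..n} - {p}. c' l * rho \<tau> (t p - t l))) - rho \<tau> lam')"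
  define \<eta>' where "\<eta>' = (\<lambda>k. if k = q then \<psi>' q
                  else if k = p then
                    (\<lambda>u. \<psi>' p u + (1 / sfun \<tau> (t p - t q) (- lam')) *
                       ((1 / (c p + 1)) * (2 * pi * \<i> * c 0 +
                           (\<Sum>l\<in>{1..n} - {p}. c' l * rho \<tau> (t p - t l)))
                        - rho \<tau> lam') * \<psi>' q u)
                  else (\<lambda>u. \<psi>' k u - sfun \<tau> (t p - t k) (- lam') / sfun \<tau> (t p - t q) (- lam') * \<psi>' q u))"
  define J where "J = (\<lambda>k. intersection \<tau> t n c' \<phi> (\<eta>' k) / (2 * pi * \<i>))"
  define \<theta> where "\<theta> = theta1 \<tau>"
  define B where "B = J p * (c p + 1) * \<theta> lam / \<theta> (lam - t p + t q)
            - J q * c p * \<theta> (t p - t q) / deriv \<theta> 0 * (rho \<tau> (t p - t q) - rho \<tau> lam)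
            + (\<Sum>j\<in>{1..n} - {p, q}. J j * c j * \<theta> (t p - t q) * \<theta> (lam - t p + t j)
                 / (\<theta> (t j - t q) * \<theta> (lam - t p + t q)))"
  define g where "g = (\<lambda>u. \<theta> (u - t p) / \<theta> (u - t q))"

  have lam: "lam \<notin> lattice \<tau>" using fund_par_lattice lam_P by blast
  \<comment> \<open>Here t_p - t_q - lam = - lam', so this is \<open>gen2\<close> up to
    sign.\<close>
  have lam': "lam' \<notin> lattice \<tau>"
    using gen2 lattice_uminus[of lam' \<tau>] by (simp add: lam'_def algebra_simps)
  have cp: "c p + 1 \<noteq> 0"
    using c_nonint p by (metis Ints_1 Ints_minus add_eq_0_iff2 minus_minus)
  have c'_nonint: "c' j \<notin> \<int>" if "j \<in> {1..n}" for j
  proof -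
    have "c j \<notin> \<int>" using c_nonint that by blast
    moreover have "c j + 1 \<notin> \<int>" using calculation Ints_diff[of "c j + 1" 1] by auto
    moreover have "c j - 1 \<notin> \<int>" using calculation Ints_add[of "c j - 1" 1] by auto
    ultimately show ?thesis by (auto simp: c'_def)
  qed

  \<comment> \<open>Local solutions and reduction of the product of g and \<open>\<phi>\<close> to
    simple poles\<close>
  have "\<exists>f. f meromorphic_on {t j} \<and> (\<forall>\<^sub>F u in at (t j). deriv f u + f u * omega \<tau> t n c' u = \<phi> u)"
    if "j \<in> {1..n}" for j
    using local_solution_exists[where \<omega> = "omega \<tau> t n c'" and c = "c' j", OF sectionsD(2)[OF phi]
        omega_reg_analytic[OF that, of c'] eventually_omega_eq_reg[OF that, of c'] c'_nonint[OF that]]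
    by metis
  then obtain f where f: "\<And>j. j \<in> {1..n} \<Longrightarrow> f j meromorphic_on {t j}"
    "\<And>j. j \<in> {1..n} \<Longrightarrow> \<forall>\<^sub>F u in at (t j). deriv (f j) u + f j u * omega \<tau> t n c' u = \<phi> u"
    by metis
  have g_sec: "g \<in> merom_sections \<tau> t n (t p - t q)"
    unfolding g_def \<theta>_def by (rule sections_theta_quotient[OF q])
  have g_nz: "g u \<noteq> 0" if "u \<notin> pole_set \<tau> t n" for u
    using not_poleD[OF that] p q by (auto simp: g_def \<theta>_def theta1_eq_0_iff)
  have "(\<lambda>u. g u * \<phi> u) \<in> merom_sections \<tau> t n lam"
    using sections_mult[OF g_sec phi] by simp
  moreover have gf_mero: "(\<lambda>u. g u * f j u) meromorphic_on {t j}" if "j \<in> {1..n}" for j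
    by (intro meromorphic_on_mult sectionsD(2)[OF g_sec] f that)
  moreover have "\<forall>\<^sub>F u in at (t j). deriv (\<lambda>u. g u * f j u) u + g u * f j u * omega \<tau> t n c u = g u * \<phi> u"
    if j: "j \<in> {1..n}" for j
    using f(2)[OF j] eventually_differentiable_at[OF f(1)[OF j]] eventually_not_pole[of "t j"]
  proof eventually_elim
    case (elim u)
    have "((\<lambda>u. g u * f j u) has_field_derivative
        g u * (rho \<tau> (u - t p) - rho \<tau> (u - t q)) * f j u + deriv (f j) u * g u) (at u)"
      using deriv_theta_quotient[OF elim(3) p q] elim(2) unfolding g_def \<theta>_def by (rule DERIV_mult)
    then have 1: "deriv (\<lambda>u. g u * f j u) u = g u * (rho \<tau> (u - t p) - rho \<tau> (u - t q)) * f j u + deriv (f j) u * g u"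
      by (rule DERIV_imp_deriv)
    have 2: "omega \<tau> t n c' u = omega \<tau> t n c u + rho \<tau> (u - t p) - rho \<tau> (u - t q)"
      unfolding c'_def by (rule omega_shift[OF pq])
    show ?case
      unfolding elim(1)[symmetric] 1 2 by (simp add: algebra_simps)
  qed
  ultimately obtain G h where G: "G \<in> merom_sections \<tau> t n lam"
    and h: "\<And>j. j \<in> {1..n} \<Longrightarrow> h j analytic_on {t j}"
    and gf_eq: "\<And>j. j \<in> {1..n} \<Longrightarrow> \<forall>\<^sub>F u in at (t j). g u * f j u = h j u + G u"
    and h_ode: "\<And>j. j \<in> {1..n} \<Longrightarrow> \<forall>\<^sub>F u in at (t j). deriv (h j) u + h j u * omega \<tau> t n c u =
        (\<Sum>l=1..n. c l * h l (t l) * sfun \<tau> (u - t l) lam)"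
    and exact: "\<And>u. u \<notin> pole_set \<tau> t n \<Longrightarrow> g u * \<phi> u - (\<Sum>l=1..n. c l * h l (t l) * sfun \<tau> (u - t l) lam) =
        deriv G u + G u * omega \<tau> t n c u"
    using simple_pole_reduction[of "\<lambda>u. g u * \<phi> u" lam c "\<lambda>j u. g u * f j u", OF _ lam c_sum] by blast

  \<comment> \<open>The pairings as residues of \<open>h j\<close> against the twisted dual
    forms\<close>
  define V where "V = twisted_psi p q lam'"
  note V_eq = twisted_psi_def[OF p q pq(3) lam', folded V_def]
  \<comment> \<open>The pairings with the single forms psi'_l, over 2 pi i. By \<open>J_lin\<close>
    each \<open>J k\<close> is such a pairing plus a multiple of \<open>Jp q\<close>.\<close>
  define Jp where "Jp = (\<lambda>l. \<Sum>j=1..n. residue (\<lambda>u. f j u * \<psi>' l u) (t j))"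
  have \<psi>'_sec: "\<psi>' l \<in> merom_sections \<tau> t n (- lam')" if "l \<in> {1..n}" for l
    unfolding \<psi>'_def by (rule sections_sfun[OF that])
  have V_sec: "V l \<in> merom_sections \<tau> t n (t q - t p - lam')" if "l \<in> {1..n}" for l
    unfolding V_def by (rule sections_twisted_psi[OF p q pq(3) lam' that])
  have Jp_eq: "Jp l = (\<Sum>j=1..n. residue (\<lambda>u. h j u * V l u) (t j))" if l: "l \<in> {1..n}" for l
  proof -
    \<comment> \<open>The parameters lam and - lam add up to 0, so the residue theorem removes the
      contribution of \<open>G\<close>.\<close>
    have GV: "(\<lambda>u. G u * V l u) \<in> merom_sections \<tau> t n 0"
      using sections_mult[OF G V_sec[OF l]] by (simp add: lam'_def)
    have "residue (\<lambda>u. f j u * \<psi>' l u) (t j) =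
        residue (\<lambda>u. h j u * V l u) (t j) + 1 * residue (\<lambda>u. G u * V l u) (t j)" if j: "j \<in> {1..n}" for j
    proof -
      have "\<forall>\<^sub>F u in at (t j). f j u * \<psi>' l u = h j u * V l u + 1 * (G u * V l u)"
        using gf_eq[OF j] eventually_not_pole[of "t j"]
      proof eventually_elim
        case (elim u)
        have "V l u = \<psi>' l u / g u" by (simp add: V_eq \<psi>'_def g_def \<theta>_def)
        then have "h j u * V l u + 1 * (G u * V l u) = (g u * f j u) * (\<psi>' l u / g u)"
          unfolding elim(1) by (simp add: ring_distribs add_divide_distrib)
        then show ?case using g_nz[OF elim(2)] by simp
      qed
      then have "residue (\<lambda>u. f j u * \<psi>' l u) (t j) = residue (\<lambda>u. h j u * V l u + 1 * (G u * V l u)) (t j)"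
        by (rule residue_cong) simp
      also have "\<dots> = residue (\<lambda>u. h j u * V l u) (t j) + 1 * residue (\<lambda>u. G u * V l u) (t j)"
        by (intro residue_lincomb meromorphic_on_mult sectionsD(2)[OF G] sectionsD(2)[OF V_sec[OF l]]
            analytic_on_imp_meromorphic_on h j)
      finally show ?thesis .
    qed
    then have "Jp l = (\<Sum>j=1..n. residue (\<lambda>u. h j u * V l u) (t j)) + (\<Sum>j=1..n. residue (\<lambda>u. G u * V l u) (t j))"
      by (simp add: Jp_def sum.distrib)
    then show ?thesis using sum_residues_eq_0[OF GV] by simp
  qed
  have J_lin: "intersection \<tau> t n c' \<phi> (\<lambda>u. \<psi>' k u + a * \<psi>' q u) / (2 * pi * \<i>) = Jp k + a * Jp q"
    if k: "k \<in> {1..n}" for k a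
  proof -
    have "residue (\<lambda>u. f j u * (\<psi>' k u + a * \<psi>' q u)) (t j) =
        residue (\<lambda>u. f j u * \<psi>' k u) (t j) + a * residue (\<lambda>u. f j u * \<psi>' q u) (t j)" if j: "j \<in> {1..n}" for j
    proof -
      have "(\<lambda>u. f j u * (\<psi>' k u + a * \<psi>' q u)) = (\<lambda>u. f j u * \<psi>' k u + a * (f j u * \<psi>' q u))"
        by (simp add: algebra_simps)
      then show ?thesis
        using residue_lincomb[of "\<lambda>u. f j u * \<psi>' k u" "t j" "\<lambda>u. f j u * \<psi>' q u" a]
          meromorphic_on_mult[OF f(1)[OF j] sectionsD(2)[OF \<psi>'_sec]] k q by simp
    qed
    moreover have "intersection \<tau> t n c' \<phi> (\<lambda>u. \<psi>' k u + a * \<psi>' q u) / (2 * pi * \<i>) =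
        (\<Sum>j=1..n. residue (\<lambda>u. f j u * (\<psi>' k u + a * \<psi>' q u)) (t j))"
      using c'_nonint f by (rule intersection_eq_residues)
    ultimately show ?thesis by (simp add: Jp_def sum.distrib sum_distrib_left)
  qed

  \<comment> \<open>Explicit values of the pairings\<close>
  define d where "d = deriv (theta1 \<tau>) 0"
  define T where "T = \<theta> (t p - t q)"
  define L where "L = \<theta> lam"
  define L' where "L' = \<theta> lam'"
  define h0 where "h0 = h p (t p)"
  define h1 where "h1 = deriv (h p) (t p)"
  define A where "A = (\<lambda>l. c l * h l (t l))"
  have nz: "d \<noteq> 0" "T \<noteq> 0" "L \<noteq> 0" "L' \<noteq> 0"
    using deriv_theta1_0_neq_0 lam lam' p q pq(3)
    by (auto simp: d_def T_def L_def L'_def \<theta>_def theta1_eq_0_iff t_not_lattice)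
  have theta_t_nz: "\<theta> (t i - t j) \<noteq> 0" if "i \<in> {1..n}" "j \<in> {1..n}" "i \<noteq> j" for i j
    using that by (simp add: \<theta>_def theta1_eq_0_iff t_not_lattice)
  have theta_lam: "\<theta> (t p - t q + lam') = L" by (simp add: lam'_def L_def)
  have theta_minus: "\<theta> (- x) = - \<theta> x" for x by (simp add: \<theta>_def)
  have s_pq': "sfun \<tau> (t p - t q) (- lam') = L * d / (T * L')"
    using theta_lam by (simp add: sfun_def T_def L'_def d_def \<theta>_def)

  have Jp_q: "Jp q = h0 * L / L'"
  proof -
    have "Jp q = (\<Sum>j=1..n. if j = p then h p (t p) * theta1 \<tau> (t p - t q + lam') / theta1 \<tau> lam' else 0)"
      unfolding Jp_eq[OF q] V_def
      by (intro sum.cong refl) (simp add: residue_twisted_psi_q[OF p q pq(3) lam'] h)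
    then show ?thesis using p theta_lam by (simp add: h0_def L'_def \<theta>_def)
  qed
  have Jp_p: "Jp p = T / d * (h1 + h0 * (rho \<tau> (t p - t q) + rho \<tau> lam'))"
  proof -
    have "Jp p = (\<Sum>j=1..n. if j = p then theta1 \<tau> (t p - t q) / deriv (theta1 \<tau>) 0 *
       (deriv (h p) (t p) + h p (t p) * (rho \<tau> (t p - t q) + rho \<tau> lam')) else 0)"
      unfolding Jp_eq[OF p] V_def
      by (intro sum.cong refl) (simp add: residue_twisted_psi_p[OF p q pq(3) lam'] h)
    then show ?thesis using p by (simp add: h0_def h1_def T_def d_def \<theta>_def)
  qed
  have Jp_l: "Jp l = h l (t l) * \<theta> (t l - t q) / \<theta> (t l - t p) + h0 * T * sfun \<tau> (t p - t l) (- lam') / d"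
    if l: "l \<in> {1..n}" "l \<noteq> p" "l \<noteq> q" for l
  proof -
    have "Jp l = (\<Sum>j=1..n. (if j = l then h l (t l) * \<theta> (t l - t q) / \<theta> (t l - t p) else 0)
        + (if j = p then h0 * T * sfun \<tau> (t p - t l) (- lam') / d else 0))"
      unfolding Jp_eq[OF l(1)] V_def using l
      by (intro sum.cong refl)
         (auto simp: residue_twisted_psi[OF p q pq(3) lam'] h h0_def T_def d_def \<theta>_def)
    then show ?thesis using p l by (simp add: sum.distrib)
  qed

  have J_q: "J q = h0 * L / L'"
    using J_lin[OF q, of 0] by (simp add: J_def \<eta>'_def Jp_q)
  have J_p: "J p = Jp p + \<kappa> * Jp q"
    using J_lin[OF p, of \<kappa>] pq(3) by (simp add: J_def \<eta>'_def \<kappa>_def)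
  have J_l: "J l = h l (t l) * \<theta> (t l - t q) / \<theta> (t l - t p)" if l: "l \<in> {1..n}" "l \<noteq> p" "l \<noteq> q" for l
  proof -
    define s where "s = sfun \<tau> (t p - t l) (- lam')"
    have "J l = Jp l - s / sfun \<tau> (t p - t q) (- lam') * Jp q"
      using J_lin[OF l(1), of "- (s / sfun \<tau> (t p - t q) (- lam'))"] l by (simp add: J_def \<eta>'_def s_def)
    \<comment> \<open>This is the contribution of \<open>t p\<close> to \<open>Jp l\<close>: the
      coefficient of psi'_q in eta'_l is made to cancel it.\<close>
    also have "s / sfun \<tau> (t p - t q) (- lam') * Jp q = h0 * T * s / d"
      unfolding s_pq' Jp_q using nz by (simp add: field_simps)
    finally show ?thesis unfolding Jp_l[OF l] by (simp add: s_def)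
  qed

  \<comment> \<open>Identification of the coefficients of the psi_j\<close>
  have A_l: "A l = J l * c l * \<theta> (t l - t p) / \<theta> (t l - t q)" if l: "l \<in> {1..n}" "l \<noteq> p" "l \<noteq> q" for l
    using theta_t_nz[of l p] theta_t_nz[of l q] l p q by (simp add: A_def J_l[OF l])
  have A_p: "A p = J q * c p * \<theta> (lam - t p + t q) / \<theta> lam"
    using nz by (simp add: A_def J_q h0_def lam'_def[symmetric] L_def[symmetric] L'_def[symmetric])
  \<comment> \<open>The value \<open>h q (t q)\<close> is not visible in any twisted form, all of
    which are regular at \<open>t q\<close>. It enters through the constant term relation at
    \<open>t p\<close>, which trades the derivative \<open>h1\<close> in \<open>J p\<close> for the
    numbers \<open>A l\<close>.\<close>
  have A_q: "A q = B"
  proof -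
    define W where "W = 2 * pi * \<i> * c 0 + (\<Sum>l\<in>{1..n} - {p}. c l * rho \<tau> (t p - t l))"
    define r where "r = rho \<tau> (t p - t q)"
    define S where "S = (\<Sum>l\<in>{1..n} - {p, q}. A l * sfun \<tau> (t p - t l) lam)"
    have split: "{1..n} - {p} = insert q ({1..n} - {p, q})" using q pq(3) by auto
    have "\<theta> (t p - t q - lam) = - L'"
      using theta_minus[of lam'] by (simp add: L'_def lam'_def algebra_simps)
    then have "sfun \<tau> (t p - t q) lam = L' * d / (T * L)"
      using theta_minus[of lam] by (simp add: sfun_def T_def L_def d_def \<theta>_def)
    then have sumA: "(\<Sum>l\<in>{1..n} - {p}. A l * sfun \<tau> (t p - t l) lam) = A q * (L' * d / (T * L)) + S"
      unfolding split S_def by simp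
    \<comment> \<open>The prefactor 1 / s of \<open>\<kappa>\<close> cancels L / L' in
      \<open>Jp q\<close> and leaves the factor T / d that \<open>Jp p\<close> has as well.\<close>
    have \<kappa>J: "\<kappa> * Jp q = T / d * (h0 * ((W - r) / (c p + 1) - rho \<tau> lam'))"
    proof -
      have "(\<Sum>l\<in>{1..n} - {p}. c' l * rho \<tau> (t p - t l)) = (\<Sum>l\<in>{1..n} - {p}. c l * rho \<tau> (t p - t l)) - r"
        unfolding split using pq(3) by (simp add: c'_def r_def left_diff_distrib)
      then have "2 * pi * \<i> * c 0 + (\<Sum>l\<in>{1..n} - {p}. c' l * rho \<tau> (t p - t l)) = W - r"
        by (simp add: W_def)
      then have "\<kappa> = T * L' / (L * d) * ((W - r) / (c p + 1) - rho \<tau> lam')"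
        unfolding \<kappa>_def s_pq' by simp
      then show ?thesis unfolding Jp_q using nz by simp
    qed
    have factor: "x * (y * v + y * w) = y * (x * v + x * w)" for x y v w :: complex
      by (simp add: algebra_simps)
    have "(c p + 1) * J p = T / d * ((c p + 1) * (h1 + h0 * (r + rho \<tau> lam')) + (c p + 1) * (h0 * ((W - r) / (c p + 1) - rho \<tau> lam')))"
      unfolding J_p \<kappa>J Jp_p r_def[symmetric] by (rule factor)
    \<comment> \<open>The terms with rho (lam') cancel, and (c_p + 1) r - r = c_p r, where the
      subtracted r stems from c'_q = c_q - 1.\<close>
    also have "(c p + 1) * (h1 + h0 * (r + rho \<tau> lam')) + (c p + 1) * (h0 * ((W - r) / (c p + 1) - rho \<tau> lam'))
        = (c p + 1) * h1 + h0 * W + c p * h0 * r"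
      using cp by (simp add: field_simps)
    also have "(c p + 1) * h1 + h0 * W = - A p * rho \<tau> lam + (A q * (L' * d / (T * L)) + S)"
      using constant_term_relation[OF p lam h[OF p], of A c] h_ode[OF p] sumA
      by (simp add: A_def W_def h0_def h1_def)
    finally have Jp1: "(c p + 1) * J p = T / d * (- A p * rho \<tau> lam + (A q * (L' * d / (T * L)) + S) + c p * h0 * r)" .
    have sumS: "(\<Sum>l\<in>{1..n} - {p, q}. J l * c l * \<theta> (t p - t q) * \<theta> (lam - t p + t l)
                 / (\<theta> (t l - t q) * \<theta> (lam - t p + t q))) = - (T * L / (d * L')) * S"
      unfolding S_def sum_distrib_left
    proof (rule sum.cong[OF refl])
      fix l assume "l \<in> {1..n} - {p, q}"
      then have l: "l \<in> {1..n}" "l \<noteq> p" "l \<noteq> q" by auto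
      have 1: "\<theta> (t p - t l - lam) = - \<theta> (lam - t p + t l)" "\<theta> (t p - t l) = - \<theta> (t l - t p)"
        using theta_minus[of "lam - t p + t l"] theta_minus[of "t l - t p"] by (simp_all add: algebra_simps)
      then have sl: "sfun \<tau> (t p - t l) lam = - (\<theta> (lam - t p + t l) * d / (\<theta> (t l - t p) * L))"
        using theta_minus[of lam] by (simp add: sfun_def L_def d_def \<theta>_def)
      show "J l * c l * \<theta> (t p - t q) * \<theta> (lam - t p + t l) / (\<theta> (t l - t q) * \<theta> (lam - t p + t q)) =
          - (T * L / (d * L')) * (A l * sfun \<tau> (t p - t l) lam)"
        unfolding A_l[OF l] sl T_def[symmetric] lam'_def[symmetric] L'_def[symmetric]
        using nz theta_t_nz[OF l(1) p l(2)] theta_t_nz[OF l(1) q l(3)] by (simp add: field_simps)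
    qed
    have Ap: "A p = c p * h0" by (simp add: A_def h0_def)
    have "B = (c p + 1) * J p * L / L' - h0 * L / L' * c p * T / d * (r - rho \<tau> lam) - T * L / (d * L') * S"
      unfolding B_def sumS by (simp add: T_def L_def L'_def lam'_def[symmetric] r_def d_def \<theta>_def J_q mult_ac)
    \<comment> \<open>In \<open>Jp1\<close> the unknown \<open>A q\<close> appears linearly; the
      terms with \<open>S\<close>, r and rho (lam) are matched by the other two summands of
      \<open>B\<close>.\<close>
    also have "\<dots> = A q"
      unfolding Jp1 Ap using nz by (simp add: field_simps)
    finally show ?thesis ..
  qed

  have "cohom_eq \<tau> t n c lam (\<lambda>u. \<theta> (u - t p) / \<theta> (u - t q) * \<phi> u)
     (\<lambda>u. (\<Sum>j\<in>{1..n} - {p, q}. J j * c j * \<theta> (t j - t p) / \<theta> (t j - t q) * sfun \<tau> (u - t j) lam)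
              + J q * c p * \<theta> (lam - t p + t q) / \<theta> lam * sfun \<tau> (u - t p) lam
              + B * sfun \<tau> (u - t q) lam)"
    unfolding cohom_eq_def
  \<comment> \<open>The primitive that realises the equality of classes is the section
    \<open>G\<close> from the reduction.\<close>
  proof (intro bexI[OF _ G] allI impI)
    fix u assume u: "u \<notin> pole_set \<tau> t n"
    have split: "{1..n} = insert p (insert q ({1..n} - {p, q}))" using p q by auto
    have "(\<Sum>l=1..n. A l * sfun \<tau> (u - t l) lam) =
        A p * sfun \<tau> (u - t p) lam + (A q * sfun \<tau> (u - t q) lam + (\<Sum>l\<in>{1..n} - {p, q}. A l * sfun \<tau> (u - t l) lam))"
      by (subst split) (use pq(3) in simp)
    also have "(\<Sum>l\<in>{1..n} - {p, q}. A l * sfun \<tau> (u - t l) lam) =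
        (\<Sum>j\<in>{1..n} - {p, q}. J j * c j * \<theta> (t j - t p) / \<theta> (t j - t q) * sfun \<tau> (u - t j) lam)"
      by (intro sum.cong) (auto simp: A_l)
    finally show "\<theta> (u - t p) / \<theta> (u - t q) * \<phi> u -
       ((\<Sum>j\<in>{1..n} - {p, q}. J j * c j * \<theta> (t j - t p) / \<theta> (t j - t q) * sfun \<tau> (u - t j) lam)
              + J q * c p * \<theta> (lam - t p + t q) / \<theta> lam * sfun \<tau> (u - t p) lam
              + B * sfun \<tau> (u - t q) lam) = deriv G u + G u * omega \<tau> t n c u"
      using exact[OF u] unfolding A_p[symmetric] A_q[symmetric] by (simp add: A_def g_def add_ac)
  qed
  then show ?thesis
    unfolding B_def J_def \<eta>'_def \<psi>'_def c'_def lam'_def \<theta>_def Let_def .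
qed

end
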